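(* Let $(E,\mathcal{P})$ be a random locally convex module over $K$ with base $(\Omega,\mathcal{F},P)$ which is complete with respect to its $(\varepsilon,\lambda)$-topology, and let $G$ be a closed $L^0$-convex subset of $E$. If $G$ is $L^0$-convexly compact, then $G$ is convexly compact, i.e. every family of closed convex subsets of $G$ with the finite intersection property has nonempty intersection.
   Context: $(\Omega,\mathcal{F},P)$ is a probability space, $K=\mathbb{R}$ or $\mathbb{C}$, $L^0(\mathcal{F},K)$ is the algebra of equivalence classes (modulo $P$-a.s. equality) of $K$-valued $\mathcal{F}$-measurable random variables, $L^0=L^0(\mathcal{F},\mathbb{R})$, $L^0_+=\{\xi\in L^0:\xi\ge0\}$. An $L^0$-seminorm on an $L^0(\mathcal{F},K)$-module $E$ is a map $\|\cdot\|:E\to L^0_+$ with $\|\xi x\|=|\xi|\|x\|$ and $\|x+y\|\le\|x\|+\|y\|$. A random locally convex module $(E,\mathcal{P})$ is an $L^0(\mathcal{F},K)$-module $E$ with a family $\mathcal{P}$ of $L^0$-seminorms such that $\bigvee\{\|x\|:\|\cdot\|\in\mathcal{P}\}=0$ iff $x=\theta$. For finite nonempty $\mathcal{Q}\subset\mathcal{P}$ let $\|x\|_{\mathcal{Q}}=\bigvee_{\|\cdot\|\in\mathcal{Q}}\|x\|$; the $(\varepsilon,\lambda)$-topology on $E$ is the Hausdorff linear topology with local base at $\theta$ the sets $\{x: P\{\|x\|_{\mathcal{Q}}<\varepsilon\}>1-\lambda\}$ ($\mathcal{Q}$ finite nonempty, $\varepsilon>0$, $0<\lambda<1$); completeness refers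 to this (linear) topology. $G\subset E$ is $L^0$-convex if $\xi x+(1-\xi)y\in G$ for all $x,y\in G$, $\xi\in L^0$, $0\le\xi\le1$ (in particular $G$ is convex). An $L^0$-convex set $G$ is $L^0$-convexly compact if every family of $L^0$-convex subsets of $G$ which are closed and which has the finite intersection property has nonempty intersection. Convex compactness (in the sense of Žitković) is the analogous property with "convex" in place of "$L^0$-convex", in the topological vector space $E$ with the $(\varepsilon,\lambda)$-topology. *)

theory Defs
  imports "HOL-Probability.Probability"
begin

text \<open>
  Elements of L0(F,K) are represented by F-measurable K-valued functions; all
  relations between them are taken almost surely.  The scalar field K (R or C) is
  a type 'k of class real_normed_field and banach (complete real normed fields
  with multiplicative norm are exactly R and C up to isometric isomorphism).
  The module E is a carrier set of some type 'e with addition add, zero th and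
  scalar multiplication smul by (representatives of) elements of L0(F,K).
  An L0-seminorm p assigns to each x a representative p x of an element of L0_+.
\<close>

definition L0 :: "'w measure \<Rightarrow> ('w \<Rightarrow> 'k::real_normed_field) set" where
  "L0 M = borel_measurable M"

definition L0_module ::
  "'w measure \<Rightarrow> 'e set \<Rightarrow> ('e \<Rightarrow> 'e \<Rightarrow> 'e) \<Rightarrow> (('w \<Rightarrow> 'k::real_normed_field) \<Rightarrow> 'e \<Rightarrow> 'e) \<Rightarrow> 'e \<Rightarrow> bool" where
  "L0_module M E add smul th \<longleftrightarrow>
     th \<in> E \<and>
     (\<forall>x\<in>E. \<forall>y\<in>E. add x y \<in> E) \<and>
     (\<forall>\<xi>\<in>L0 M. \<forall>x\<in>E. smul \<xi> x \<in> E) \<and>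
     (\<forall>\<xi>\<in>L0 M. \<forall>\<eta>\<in>L0 M. \<forall>x\<in>E. (AE \<omega> in M. \<xi> \<omega> = \<eta> \<omega>) \<longrightarrow> smul \<xi> x = smul \<eta> x) \<and>
     (\<forall>x\<in>E. \<forall>y\<in>E. \<forall>z\<in>E. add (add x y) z = add x (add y z)) \<and>
     (\<forall>x\<in>E. \<forall>y\<in>E. add x y = add y x) \<and>
     (\<forall>x\<in>E. add x th = x) \<and>
     (\<forall>x\<in>E. add x (smul (\<lambda>_. - 1) x) = th) \<and>
     (\<forall>x\<in>E. smul (\<lambda>_. 1) x = x) \<and>
     (\<forall>\<xi>\<in>L0 M. \<forall>\<eta>\<in>L0 M. \<forall>x\<in>E. smul (\<lambda>\<omega>. \<xi> \<omega> * \<eta> \<omega>) x = smul \<xi> (smul \<eta> x)) \<and>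
     (\<forall>\<xi>\<in>L0 M. \<forall>\<eta>\<in>L0 M. \<forall>x\<in>E. smul (\<lambda>\<omega>. \<xi> \<omega> + \<eta> \<omega>) x = add (smul \<xi> x) (smul \<eta> x)) \<and>
     (\<forall>\<xi>\<in>L0 M. \<forall>x\<in>E. \<forall>y\<in>E. smul \<xi> (add x y) = add (smul \<xi> x) (smul \<xi> y))"

definition L0_seminorm ::
  "'w measure \<Rightarrow> 'e set \<Rightarrow> ('e \<Rightarrow> 'e \<Rightarrow> 'e) \<Rightarrow> (('w \<Rightarrow> 'k::real_normed_field) \<Rightarrow> 'e \<Rightarrow> 'e)
   \<Rightarrow> ('e \<Rightarrow> 'w \<Rightarrow> real) \<Rightarrow> bool" where
  "L0_seminorm M E add smul p \<longleftrightarrow>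
     (\<forall>x\<in>E. p x \<in> borel_measurable M \<and> (AE \<omega> in M. 0 \<le> p x \<omega>)) \<and>
     (\<forall>\<xi>\<in>L0 M. \<forall>x\<in>E. AE \<omega> in M. p (smul \<xi> x) \<omega> = norm (\<xi> \<omega>) * p x \<omega>) \<and>
     (\<forall>x\<in>E. \<forall>y\<in>E. AE \<omega> in M. p (add x y) \<omega> \<le> p x \<omega> + p y \<omega>)"

text \<open>Random locally convex module: the (essential) supremum of the nonnegative
  family {p x : p in P} is 0 iff every p x = 0 a.s.\<close>
definition RLC_module ::
  "'w measure \<Rightarrow> 'e set \<Rightarrow> ('e \<Rightarrow> 'e \<Rightarrow> 'e) \<Rightarrow> (('w \<Rightarrow> 'k::real_normed_field) \<Rightarrow> 'e \<Rightarrow> 'e) \<Rightarrow> 'e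
   \<Rightarrow> ('e \<Rightarrow> 'w \<Rightarrow> real) set \<Rightarrow> bool" where
  "RLC_module M E add smul th PP \<longleftrightarrow>
     L0_module M E add smul th \<and>
     (\<forall>p\<in>PP. L0_seminorm M E add smul p) \<and>
     (\<forall>x\<in>E. (\<forall>p\<in>PP. AE \<omega> in M. p x \<omega> = 0) \<longleftrightarrow> x = th)"

definition mdiff :: "('e \<Rightarrow> 'e \<Rightarrow> 'e) \<Rightarrow> (('w \<Rightarrow> 'k::real_normed_field) \<Rightarrow> 'e \<Rightarrow> 'e) \<Rightarrow> 'e \<Rightarrow> 'e \<Rightarrow> 'e" where
  "mdiff add smul x y = add x (smul (\<lambda>_. - 1) y)"

definition normQ :: "('e \<Rightarrow> 'w \<Rightarrow> real) set \<Rightarrow> 'e \<Rightarrow> 'w \<Rightarrow> real" where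
  "normQ Q x = (\<lambda>\<omega>. Max ((\<lambda>p. p x \<omega>) ` Q))"

definition el_nbhd ::
  "'w measure \<Rightarrow> 'e set \<Rightarrow> ('e \<Rightarrow> 'e \<Rightarrow> 'e) \<Rightarrow> (('w \<Rightarrow> 'k::real_normed_field) \<Rightarrow> 'e \<Rightarrow> 'e)
   \<Rightarrow> 'e \<Rightarrow> ('e \<Rightarrow> 'w \<Rightarrow> real) set \<Rightarrow> real \<Rightarrow> real \<Rightarrow> 'e set" where
  "el_nbhd M E add smul x Q \<epsilon> l =
     {y\<in>E. measure M {\<omega>\<in>space M. normQ Q (mdiff add smul y x) \<omega> < \<epsilon>} > 1 - l}"

definition el_basic :: "('e \<Rightarrow> 'w \<Rightarrow> real) set \<Rightarrow> ('e \<Rightarrow> 'w \<Rightarrow> real) set \<Rightarrow> real \<Rightarrow> real \<Rightarrow> bool" where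
  "el_basic PP Q \<epsilon> l \<longleftrightarrow> Q \<subseteq> PP \<and> finite Q \<and> Q \<noteq> {} \<and> 0 < \<epsilon> \<and> 0 < l \<and> l < 1"

definition el_topology ::
  "'w measure \<Rightarrow> 'e set \<Rightarrow> ('e \<Rightarrow> 'e \<Rightarrow> 'e) \<Rightarrow> (('w \<Rightarrow> 'k::real_normed_field) \<Rightarrow> 'e \<Rightarrow> 'e)
   \<Rightarrow> ('e \<Rightarrow> 'w \<Rightarrow> real) set \<Rightarrow> 'e topology" where
  "el_topology M E add smul PP = topology (\<lambda>U. U \<subseteq> E \<and>
     (\<forall>x\<in>U. \<exists>Q \<epsilon> l. el_basic PP Q \<epsilon> l \<and> el_nbhd M E add smul x Q \<epsilon> l \<subseteq> U))"

definition el_complete ::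
  "'w measure \<Rightarrow> 'e set \<Rightarrow> ('e \<Rightarrow> 'e \<Rightarrow> 'e) \<Rightarrow> (('w \<Rightarrow> 'k::real_normed_field) \<Rightarrow> 'e \<Rightarrow> 'e) \<Rightarrow> 'e
   \<Rightarrow> ('e \<Rightarrow> 'w \<Rightarrow> real) set \<Rightarrow> bool" where
  "el_complete M E add smul th PP \<longleftrightarrow>
     (\<forall>F :: 'e filter. F \<noteq> bot \<and> eventually (\<lambda>x. x \<in> E) F \<and>
        (\<forall>Q \<epsilon> l. el_basic PP Q \<epsilon> l \<longrightarrow>
           (\<exists>A. eventually (\<lambda>x. x \<in> A) F \<and>
                (\<forall>x\<in>A. \<forall>y\<in>A. mdiff add smul x y \<in> el_nbhd M E add smul th Q \<epsilon> l)))
      \<longrightarrow> (\<exists>x. limitin (el_topology M E add smul PP) id x F))"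

definition L0_convex ::
  "'w measure \<Rightarrow> ('e \<Rightarrow> 'e \<Rightarrow> 'e) \<Rightarrow> (('w \<Rightarrow> 'k::real_normed_field) \<Rightarrow> 'e \<Rightarrow> 'e) \<Rightarrow> 'e set \<Rightarrow> bool" where
  "L0_convex M add smul G \<longleftrightarrow>
     (\<forall>x\<in>G. \<forall>y\<in>G. \<forall>\<xi>::'w \<Rightarrow> real. \<xi> \<in> borel_measurable M \<and> (AE \<omega> in M. 0 \<le> \<xi> \<omega> \<and> \<xi> \<omega> \<le> 1) \<longrightarrow>
        add (smul (\<lambda>\<omega>. of_real (\<xi> \<omega>)) x) (smul (\<lambda>\<omega>. of_real (1 - \<xi> \<omega>)) y) \<in> G)"

definition mconvex ::
  "('e \<Rightarrow> 'e \<Rightarrow> 'e) \<Rightarrow> (('w \<Rightarrow> 'k::real_normed_field) \<Rightarrow> 'e \<Rightarrow> 'e) \<Rightarrow> 'e set \<Rightarrow> bool" where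
  "mconvex add smul G \<longleftrightarrow>
     (\<forall>x\<in>G. \<forall>y\<in>G. \<forall>t::real. 0 \<le> t \<and> t \<le> 1 \<longrightarrow>
        add (smul (\<lambda>_. of_real t) x) (smul (\<lambda>_. of_real (1 - t)) y) \<in> G)"

definition fip :: "'a set set \<Rightarrow> bool" where
  "fip \<F> \<longleftrightarrow> (\<forall>\<G>. \<G> \<subseteq> \<F> \<and> finite \<G> \<and> \<G> \<noteq> {} \<longrightarrow> \<Inter>\<G> \<noteq> {})"

definition L0_convexly_compact ::
  "'w measure \<Rightarrow> 'e set \<Rightarrow> ('e \<Rightarrow> 'e \<Rightarrow> 'e) \<Rightarrow> (('w \<Rightarrow> 'k::real_normed_field) \<Rightarrow> 'e \<Rightarrow> 'e)
   \<Rightarrow> ('e \<Rightarrow> 'w \<Rightarrow> real) set \<Rightarrow> 'e set \<Rightarrow> bool" where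
  "L0_convexly_compact M E add smul PP G \<longleftrightarrow>
     L0_convex M add smul G \<and>
     (\<forall>\<F>. (\<forall>A\<in>\<F>. A \<subseteq> G \<and> L0_convex M add smul A \<and> closedin (el_topology M E add smul PP) A)
          \<and> fip \<F> \<longrightarrow> \<Inter>\<F> \<noteq> {})"

definition convexly_compact ::
  "'w measure \<Rightarrow> 'e set \<Rightarrow> ('e \<Rightarrow> 'e \<Rightarrow> 'e) \<Rightarrow> (('w \<Rightarrow> 'k::real_normed_field) \<Rightarrow> 'e \<Rightarrow> 'e)
   \<Rightarrow> ('e \<Rightarrow> 'w \<Rightarrow> real) set \<Rightarrow> 'e set \<Rightarrow> bool" where
  "convexly_compact M E add smul PP G \<longleftrightarrow>
     mconvex add smul G \<and>
     (\<forall>\<F>. (\<forall>A\<in>\<F>. A \<subseteq> G \<and> mconvex add smul A \<and> closedin (el_topology M E add smul PP) A)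
          \<and> fip \<F> \<longrightarrow> \<Inter>\<F> \<noteq> {})"

end

theory Submission
  imports Defs
begin

text \<open>
  Extend the given family to a maximal family \<open>U\<close> of convex subsets of \<open>G\<close> with the finite
  intersection property. If \<open>f\<close> is an \<open>L\<^sup>0\<close>-linear functional with \<open>\<bar>f\<bar> \<le> 1\<close> on \<open>G\<close>, then uniform convexity
  of \<open>L\<^sup>2\<close> and maximality make the images \<open>f A\<close>, \<open>A \<in> U\<close>, a Cauchy filter base in \<open>L\<^sup>2\<close>; its limit
  is attained on \<open>G\<close>, simultaneously for finitely many and hence for all \<open>f\<close>, because conditions
  \<open>f z = g\<close> are closed and \<open>L\<^sup>0\<close>-convex. The resulting point \<open>z\<close> lies in every closed member \<open>A\<close>
  of \<open>U\<close>: otherwise \<open>z\<close> and \<open>A\<close> could be separated by the expectation of such an \<open>f\<close>.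

  The topology need not be locally convex. Separation is carried out in the seminorm \<open>E (w \<parallel>x\<parallel>\<^sub>Q)\<close> with a
  weight \<open>w > 0\<close> for which \<open>w \<parallel>x\<parallel>\<^sub>Q \<le> 1\<close> on \<open>G\<close>; such a weight exists because \<open>L\<^sup>0\<close>-convex compactness
  and a gliding hump bound \<open>\<parallel>x\<parallel>\<^sub>Q\<close> on \<open>G\<close>. The separating real functional is then turned into an
  \<open>L\<^sup>0\<close>-linear one by the Radon-Nikodym theorem.
\<close>

section \<open>Hahn-Banach separation on a carrier set\<close>

text \<open>The given sets are convex but in general not \<open>L0\<close>-convex, so the
  compactness of \<open>G\<close> says nothing about them directly. It reaches them through
  \<open>L0\<close>-linear functionals: almost sure bounds on \<open>f z\<close> define sets to
  which the compactness applies, while the images of the given sets under \<open>f\<close> can be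
  studied in an ordinary Hilbert space. A maximal family takes the place of an ultrafilter because
  only convex sets can be compared: the sets whose membership is needed are sublevel sets of
  quadratic functionals and balls in \<open>L^2\<close>, and these are convex.

  Scalar separation needs a scalar gap between \<open>z\<close> and \<open>A\<close>. Taking
  expectations produces one, but \<open>E (p x)\<close> may be infinite. The random weight does two
  things at once: it places \<open>G\<close> in the subspace where the expectation is finite, and it
  makes the resulting functional bounded by 1 on \<open>G\<close>, hence one of those for which
  \<open>z\<close> was constructed. Each finite \<open>Q\<close> has its own weight; the functionals
  coming from different \<open>Q\<close> meet only in the choice of \<open>z\<close>.\<close>

locale carrier_vector_space =
  fixes V :: "'e set" and add :: "'e \<Rightarrow> 'e \<Rightarrow> 'e" and sc :: "real \<Rightarrow> 'e \<Rightarrow> 'e" and th :: 'e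
  assumes th_V [simp]: "th \<in> V"
    and add_V [simp]: "x \<in> V \<Longrightarrow> y \<in> V \<Longrightarrow> add x y \<in> V"
    and sc_V [simp]: "x \<in> V \<Longrightarrow> sc s x \<in> V"
    and V_assoc: "x \<in> V \<Longrightarrow> y \<in> V \<Longrightarrow> z \<in> V \<Longrightarrow> add (add x y) z = add x (add y z)"
    and V_comm: "x \<in> V \<Longrightarrow> y \<in> V \<Longrightarrow> add x y = add y x"
    and V_zero [simp]: "x \<in> V \<Longrightarrow> add x th = x"
    and V_neg: "x \<in> V \<Longrightarrow> add x (sc (- 1) x) = th"
    and sc_one [simp]: "x \<in> V \<Longrightarrow> sc 1 x = x"
    and sc_sc: "x \<in> V \<Longrightarrow> sc s (sc t x) = sc (s * t) x"
    and sc_left: "x \<in> V \<Longrightarrow> sc (s + t) x = add (sc s x) (sc t x)"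
    and sc_right: "x \<in> V \<Longrightarrow> y \<in> V \<Longrightarrow> sc s (add x y) = add (sc s x) (sc s y)"
begin

lemma V_left_comm: "x \<in> V \<Longrightarrow> y \<in> V \<Longrightarrow> z \<in> V \<Longrightarrow> add y (add x z) = add x (add y z)"
  by (metis V_assoc V_comm)

lemmas V_ac = V_assoc V_comm V_left_comm

lemma V_exchange:
  "x \<in> V \<Longrightarrow> y \<in> V \<Longrightarrow> z \<in> V \<Longrightarrow> w \<in> V \<Longrightarrow> add (add x y) (add z w) = add (add x z) (add y w)"
  by (simp add: V_ac)

lemma sc_zero: "x \<in> V \<Longrightarrow> sc 0 x = th"
  using sc_left[of x 1 "-1"] V_neg[of x] by simp

lemma sc_th: "sc s th = th"
  by (metis sc_zero sc_sc th_V mult_zero_right)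

lemma V_neg': "x \<in> V \<Longrightarrow> add (sc (- 1) x) x = th"
  by (metis V_neg V_comm sc_V)

text \<open>Only the upper estimate for homogeneity is demanded because it passes to infima; the
  reverse estimate follows by scaling back with \<open>1 / s\<close>. Negative values are allowed,
  since the functionals constructed below drop beneath the one they start from.\<close>

definition sublinear :: "('e \<Rightarrow> real) \<Rightarrow> bool" where
  "sublinear q \<longleftrightarrow> (\<forall>x\<in>V. \<forall>y\<in>V. q (add x y) \<le> q x + q y) \<and>
                 (\<forall>x\<in>V. \<forall>s>0. q (sc s x) \<le> s * q x)"

lemma sublinear_th: "sublinear q \<Longrightarrow> q th = 0"
proof -
  assume q: "sublinear q"
  \<comment> \<open>\<open>th\<close> is fixed by every scaling, so the factors 2 and 1/2 force
    \<open>q th\<close> to be both nonnegative and nonpositive.\<close>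
  have "q (sc 2 th) \<le> 2 * q th" "q (sc (1/2) th) \<le> (1/2) * q th"
    using q unfolding sublinear_def by (meson th_V zero_less_numeral half_gt_zero zero_less_one)+
  then show ?thesis by (simp add: sc_th)
qed

lemma sublinear_scale:
  assumes q: "sublinear q" and x: "x \<in> V" "s > 0"
  shows "q (sc s x) = s * q x"
proof (rule antisym)
  have le: "q (sc s x) \<le> s * q x" if "x \<in> V" "s > 0" for x s
    using q that unfolding sublinear_def by simp
  show "q (sc s x) \<le> s * q x" using le x by simp
  show "s * q x \<le> q (sc s x)"
    using le[of "sc s x" "1 / s"] x by (simp add: sc_sc field_simps)
qed

lemma sublinear_neg:
  assumes "sublinear q" "x \<in> V"
  shows "- q (sc (- 1) x) \<le> q x"
proof -
  have "q (add x (sc (-1) x)) \<le> q x + q (sc (-1) x)"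
    using assms unfolding sublinear_def by simp
  then show ?thesis using sublinear_th[OF assms(1)] V_neg[OF assms(2)] by simp
qed

text \<open>A convex cone in the hypograph of \<open>q\<close>. A pair \<open>(r, v)\<close> encodes
  the demand that the linear functional to be found be at least \<open>r\<close> at
  \<open>v\<close>.\<close>

definition cone_below :: "(real \<times> 'e) set \<Rightarrow> ('e \<Rightarrow> real) \<Rightarrow> bool" where
  "cone_below S q \<longleftrightarrow> (0, th) \<in> S \<and> (\<forall>(r, v)\<in>S. v \<in> V \<and> r \<le> q v) \<and>
     (\<forall>(r, v)\<in>S. \<forall>(r', v')\<in>S. (r + r', add v v') \<in> S) \<and>
     (\<forall>(r, v)\<in>S. \<forall>s>0. (s * r, sc s v) \<in> S)"

text \<open>\<open>q'\<close> builds these demands into the sublinear functional: at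
  \<open>- v\<close> it is at most \<open>q th - r = - r\<close>, so every linear functional below
  \<open>q'\<close> is at least \<open>r\<close> at \<open>v\<close>.\<close>

lemma sublinear_cone:
  assumes q: "sublinear q" and cone: "cone_below S q"
  defines "q' \<equiv> \<lambda>x. INF (r, v)\<in>S. q (add x v) - r"
  shows "sublinear q'" "\<And>x. x \<in> V \<Longrightarrow> q' x \<le> q x"
    "\<And>r v x. (r, v) \<in> S \<Longrightarrow> x \<in> V \<Longrightarrow> q' x \<le> q (add x v) - r"
proof -
  have S: "v \<in> V" "r \<le> q v" "s > 0 \<Longrightarrow> (s * r, sc s v) \<in> S"
      "(r', v') \<in> S \<Longrightarrow> (r + r', add v v') \<in> S" if "(r, v) \<in> S" for r v r' v' s
    using cone that unfolding cone_below_def by (blast dest: bspec)+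
  have S0: "(0, th) \<in> S" using cone unfolding cone_below_def by blast
  \<comment> \<open>Writing \<open>v\<close> as \<open>(x + v) - x\<close> gives
    \<open>r \<le> q v \<le> q (x + v) + q (- x)\<close>, a bound independent of
    \<open>(r, v)\<close>, so the infimum is a real number.\<close>
  have low: "- q (sc (- 1) x) \<le> q (add x v) - r" if "(r, v) \<in> S" "x \<in> V" for r v x
  proof -
    have v: "v \<in> V" using S(1) that(1) .
    have "add (add x v) (sc (-1) x) = add (add x (sc (-1) x)) v"
      using v that by (simp add: V_ac)
    then have "add (add x v) (sc (-1) x) = v" using v that V_neg[of x] by (simp add: V_comm[of th])
    moreover have "q (add (add x v) (sc (-1) x)) \<le> q (add x v) + q (sc (-1) x)"
      using q v that unfolding sublinear_def by simp
    ultimately show ?thesis using S(2)[OF that(1)] by simp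
  qed
  have bdd: "bdd_below ((\<lambda>(r, v). q (add x v) - r) ` S)" if "x \<in> V" for x
    by (rule bdd_belowI[of _ "- q (sc (- 1) x)"]) (use low that in auto)
  show le: "q' x \<le> q (add x v) - r" if "(r, v) \<in> S" "x \<in> V" for r v x
    unfolding q'_def using cINF_lower[OF bdd[OF that(2)] that(1)] by simp
  show "q' x \<le> q x" if "x \<in> V" for x
    using le[OF S0 that] that by simp
  have ge: "c \<le> q' x" if "\<And>r v. (r, v) \<in> S \<Longrightarrow> c \<le> q (add x v) - r" for c x
    unfolding q'_def by (rule cINF_greatest) (use S0 that in auto)
  show "sublinear q'"
    unfolding sublinear_def
  proof safe
    fix x y assume xy: "x \<in> V" "y \<in> V"
    \<comment> \<open>The two infima are taken one after the other; the sum of two cone elements is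
      an admissible competitor for \<open>add x y\<close>.\<close>
    have "q' (add x y) - q' y \<le> q' x"
    proof (rule ge)
      fix r v assume rv: "(r, v) \<in> S"
      have "q' (add x y) - (q (add x v) - r) \<le> q' y"
      proof (rule ge)
        fix r' v' assume rv': "(r', v') \<in> S"
        have vv: "v \<in> V" "v' \<in> V" using S(1) rv rv' by auto
        have "q' (add x y) \<le> q (add (add x y) (add v v')) - (r + r')"
          using le[OF S(4)[OF rv rv']] xy by simp
        also have "add (add x y) (add v v') = add (add x v) (add y v')"
          using xy vv by (simp add: V_ac)
        also have "q \<dots> \<le> q (add x v) + q (add y v')"
          using q xy vv unfolding sublinear_def by simp
        finally show "q' (add x y) - (q (add x v) - r) \<le> q (add y v') - r'" by simp
      qed
      then show "q' (add x y) - q' y \<le> q (add x v) - r" by simp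
    qed
    then show "q' (add x y) \<le> q' x + q' y" by simp
  next
    fix x and s :: real assume x: "x \<in> V" "s > 0"
    have "q' (sc s x) / s \<le> q' x"
    proof (rule ge)
      fix r v assume rv: "(r, v) \<in> S"
      have v: "v \<in> V" using S(1) rv .
      have "q' (sc s x) \<le> q (add (sc s x) (sc s v)) - s * r"
        using le[OF S(3)[OF rv]] x by simp
      also have "add (sc s x) (sc s v) = sc s (add x v)" using x v by (simp add: sc_right)
      also have "q \<dots> \<le> s * q (add x v)" using q x v unfolding sublinear_def by simp
      finally show "q' (sc s x) / s \<le> q (add x v) - r"
        using x by (simp add: field_simps)
    qed
    then show "q' (sc s x) \<le> s * q' x" using x by (simp add: field_simps)
  qed
qed

text \<open>Zorn's lemma applies because every sublinear functional below \<open>q0\<close> is at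
  least \<open>- q0 (- x)\<close> at \<open>x\<close>, so chains have pointwise infima. A minimal
  sublinear functional will turn out to be linear, which replaces the usual extension from
  subspaces.\<close>

lemma minimal_sublinear:
  assumes q0: "sublinear q0"
  obtains m where "sublinear m" "\<And>x. x \<in> V \<Longrightarrow> m x \<le> q0 x"
    "\<And>q x. sublinear q \<Longrightarrow> (\<And>y. y \<in> V \<Longrightarrow> q y \<le> m y) \<Longrightarrow> x \<in> V \<Longrightarrow> q x = m x"
proof -
  \<comment> \<open>Candidates vanish off \<open>V\<close> because the order \<open>P\<close>
    compares functions on the whole type, where sublinearity controls nothing.\<close>
  define A where "A = {q. sublinear q \<and> (\<forall>x\<in>V. q x \<le> q0 x) \<and> (\<forall>x. x \<notin> V \<longrightarrow> q x = 0)}"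
  define P where "P = (\<lambda>q q' :: 'e \<Rightarrow> real. \<forall>x. q' x \<le> q x)"
  have restr: "sublinear (\<lambda>x. if x \<in> V then q x else 0)" if "sublinear q" for q
    using that unfolding sublinear_def by simp
  have "\<exists>m\<in>A. \<forall>a\<in>A. P m a \<longrightarrow> a = m"
  proof (rule predicate_Zorn)
    show "partial_order_on A (relation_of P A)"
      by (rule partial_order_on_relation_ofI) (auto simp: P_def fun_eq_iff intro: order_trans antisym)
    fix C assume C: "C \<in> Chains (relation_of P A)"
    have CA: "C \<subseteq> A" using C unfolding Chains_def relation_of_def by auto
    show "\<exists>u\<in>A. \<forall>a\<in>C. P a u"
    proof (cases "C = {}")
      case True
      have "(\<lambda>x. if x \<in> V then q0 x else 0) \<in> A" using restr[OF q0] unfolding A_def by simp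
      then show ?thesis using True by auto
    next
      case False
      have chain: "P a b \<or> P b a" if "a \<in> C" "b \<in> C" for a b
        using C that unfolding Chains_def relation_of_def by auto
      define u where "u = (\<lambda>x. INF q\<in>C. q x)"
      have low: "(if x \<in> V then - q0 (sc (- 1) x) else 0) \<le> q x" if "q \<in> C" for q x
      proof (cases "x \<in> V")
        case True
        have "q (sc (-1) x) \<le> q0 (sc (-1) x)" using True that CA unfolding A_def by auto
        moreover have "- q (sc (-1) x) \<le> q x" using sublinear_neg that CA True unfolding A_def by auto
        ultimately show ?thesis using True by simp
      next
        case False then show ?thesis using that CA unfolding A_def by auto
      qed
      have le: "u x \<le> q x" if "q \<in> C" for q x
        unfolding u_def by (rule cINF_lower[OF _ that]) (rule bdd_belowI2[OF low])
      have ge: "c \<le> u x" if "\<And>q. q \<in> C \<Longrightarrow> c \<le> q x" for c x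
        unfolding u_def by (rule cINF_greatest) (use False that in auto)
      obtain q1 where q1: "q1 \<in> C" using False by auto
      have "sublinear u" unfolding sublinear_def
      proof safe
        fix x y assume xy: "x \<in> V" "y \<in> V"
        have "u (add x y) - u y \<le> u x"
        proof (rule ge)
          fix q assume q: "q \<in> C"
          have "u (add x y) - q x \<le> u y"
          proof (rule ge)
            fix q' assume q': "q' \<in> C"
            \<comment> \<open>Of two chain members the smaller lies below both, so its own
              subadditivity gives that of the infimum.\<close>
            obtain p where p: "p \<in> C" "\<And>x. p x \<le> q x" "\<And>x. p x \<le> q' x"
              using chain[OF q q'] q q' unfolding P_def by auto
            have "p (add x y) \<le> p x + p y" using p(1) CA xy unfolding A_def sublinear_def by auto
            then show "u (add x y) - q x \<le> q' y" using le[OF p(1), of "add x y"] p(2)[of x] p(3)[of y] by simp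
          qed
          then show "u (add x y) - u y \<le> q x" by simp
        qed
        then show "u (add x y) \<le> u x + u y" by simp
      next
        fix x and s :: real assume x: "x \<in> V" "s > 0"
        have "u (sc s x) / s \<le> u x"
        proof (rule ge)
          fix q assume q: "q \<in> C"
          have "q (sc s x) \<le> s * q x" using q CA x unfolding A_def sublinear_def by auto
          then have "u (sc s x) \<le> s * q x" using le[OF q, of "sc s x"] by simp
          then show "u (sc s x) / s \<le> q x" using x by (simp add: field_simps)
        qed
        then show "u (sc s x) \<le> s * u x" using x by (simp add: field_simps)
      qed
      moreover have "u x \<le> q0 x" if "x \<in> V" for x
        using le[OF q1, of x] q1 CA that unfolding A_def by force
      moreover have "u x = 0" if "x \<notin> V" for x
      proof -
        have "\<And>q. q \<in> C \<Longrightarrow> q x = 0" using CA that unfolding A_def by auto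
        then show ?thesis using le[OF q1, of x] ge[of 0 x] q1 by fastforce
      qed
      ultimately have "u \<in> A" unfolding A_def by simp
      then show ?thesis using le unfolding P_def by auto
    qed
  qed
  then obtain m where m: "m \<in> A" "\<And>a. a \<in> A \<Longrightarrow> P m a \<Longrightarrow> a = m" by auto
  show ?thesis
  proof (rule that)
    show "sublinear m" "\<And>x. x \<in> V \<Longrightarrow> m x \<le> q0 x" using m(1) unfolding A_def by auto
    fix q x assume q: "sublinear q" "\<And>y. y \<in> V \<Longrightarrow> q y \<le> m y" and x: "x \<in> V"
    let ?q = "\<lambda>x. if x \<in> V then q x else 0"
    have "?q \<in> A" using restr[OF q(1)] q(2) m(1) unfolding A_def by (auto intro: order_trans)
    moreover have "P m ?q" using q(2) m(1) unfolding P_def A_def by simp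
    ultimately have "?q = m" by (rule m(2))
    from fun_cong[OF this, of x] show "q x = m x" using x by simp
  qed
qed

definition linear_on :: "('e \<Rightarrow> real) \<Rightarrow> bool" where
  "linear_on l \<longleftrightarrow> (\<forall>x\<in>V. \<forall>y\<in>V. l (add x y) = l x + l y) \<and> (\<forall>x\<in>V. \<forall>s. l (sc s x) = s * l x)"

text \<open>A minimal \<open>m\<close> is additive: demanding the value \<open>m y\<close> at
  \<open>y\<close> yields a sublinear functional below \<open>m\<close>, which must be
  \<open>m\<close> again, and at \<open>x\<close> it is at most \<open>m (x + y) - m y\<close>.
  Homogeneity for negative factors then follows from additivity.\<close>

lemma hahn_banach_sublinear:
  assumes q0: "sublinear q0"
  obtains l where "linear_on l" "\<And>x. x \<in> V \<Longrightarrow> l x \<le> q0 x"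
proof -
  obtain m where m: "sublinear m" "\<And>x. x \<in> V \<Longrightarrow> m x \<le> q0 x"
    "\<And>q x. sublinear q \<Longrightarrow> (\<And>y. y \<in> V \<Longrightarrow> q y \<le> m y) \<Longrightarrow> x \<in> V \<Longrightarrow> q x = m x"
    using minimal_sublinear[OF q0] by blast
  note pos = sublinear_scale[OF m(1)]
  have add: "m (add x y) = m x + m y" if "x \<in> V" "y \<in> V" for x y
  proof (rule antisym)
    show "m (add x y) \<le> m x + m y" using m(1) that unfolding sublinear_def by simp
    let ?S = "{(t * m y, sc t y) | t. t \<ge> 0}"
    let ?q = "\<lambda>x. INF (r, v)\<in>?S. m (add x v) - r"
    have cone: "cone_below ?S m"
    proof -
      have 1: "\<And>r v. (r, v) \<in> ?S \<Longrightarrow> v \<in> V" using that by auto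
      have 2: "(0, th) \<in> ?S" using sc_zero[OF that(2)] by force
      have 3: "(r + r', add v v') \<in> ?S" if rv: "(r, v) \<in> ?S" "(r', v') \<in> ?S" for r v r' v'
      proof -
        obtain t where t: "r = t * m y" "v = sc t y" "t \<ge> 0" using rv(1) by auto
        obtain t' where t': "r' = t' * m y" "v' = sc t' y" "t' \<ge> 0" using rv(2) by auto
        have "r + r' = (t + t') * m y" "add v v' = sc (t + t') y" "t + t' \<ge> 0"
          using t t' sc_left[OF \<open>y \<in> V\<close>, of t t'] by (simp_all add: distrib_right)
        then show ?thesis by blast
      qed
      have 4: "(s * r, sc s v) \<in> ?S" if rv: "(r, v) \<in> ?S" and "s > 0" for r v s
      proof -
        obtain t where "r = t * m y" "v = sc t y" "t \<ge> 0" using rv by auto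
        then have "s * r = (s * t) * m y" "sc s v = sc (s * t) y" "s * t \<ge> 0"
          using sc_sc[OF \<open>y \<in> V\<close>] \<open>s > 0\<close> by auto
        then show ?thesis by blast
      qed
      have 5: "r \<le> m v" if rv: "(r, v) \<in> ?S" for r v
      proof -
        obtain t where t: "r = t * m y" "v = sc t y" "t \<ge> 0" using rv by auto
        then show ?thesis
          using pos[OF \<open>y \<in> V\<close>, of t] sc_zero[OF \<open>y \<in> V\<close>] sublinear_th[OF m(1)]
          by (cases "t = 0") auto
      qed
      show ?thesis
        unfolding cone_below_def
      proof (intro conjI)
        show "(0, th) \<in> ?S" by (rule 2)
        show "\<forall>(r, v)\<in>?S. v \<in> V \<and> r \<le> m v" by clarify (use 1 5 in blast)
        show "\<forall>(r, v)\<in>?S. \<forall>(r', v')\<in>?S. (r + r', add v v') \<in> ?S" by clarify (use 3 in blast)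
        show "\<forall>(r, v)\<in>?S. \<forall>s>0. (s * r, sc s v) \<in> ?S" by clarify (use 4 in blast)
      qed
    qed
    note c = sublinear_cone[OF m(1) cone]
    have "?q x = m x" using m(3)[OF c(1) c(2)] that by blast
    moreover have "(1 * m y, sc 1 y) \<in> ?S" using zero_le_one by blast
    then have "(m y, y) \<in> ?S" using that by simp
    from c(3)[OF this that(1)] have "?q x \<le> m (add x y) - m y" .
    ultimately show "m x + m y \<le> m (add x y)" by simp
  qed
  have neg: "m (sc (-1) x) = - m x" if "x \<in> V" for x
    using add[of x "sc (-1) x"] that V_neg[OF that] sublinear_th[OF m(1)] by simp
  have sc: "m (sc s x) = s * m x" if "x \<in> V" for s x
  proof -
    consider "s > 0" | "s = 0" | "s < 0" by linarith
    then show ?thesis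
    proof cases
      case 1 then show ?thesis using pos that by simp
    next
      case 2 then show ?thesis using sc_zero[OF that] sublinear_th[OF m(1)] by simp
    next
      case 3
      then have "m (sc (-1) (sc (- s) x)) = - ((- s) * m x)"
        using neg[of "sc (-s) x"] pos[of x "- s"] that by simp
      then show ?thesis using that by (simp add: sc_sc)
    qed
  qed
  show ?thesis by (rule that[of m]) (use m(2) add sc in \<open>auto simp: linear_on_def\<close>)
qed

text \<open>Separation of a convex set \<open>C\<close> from the origin when \<open>N \<ge> d\<close> on \<open>C\<close>: the functional is
  found below the sublinear functional \<open>INF (t, c). N (x + t c) - t d\<close>.\<close>

lemma hahn_banach_separation:
  assumes N: "sublinear N"
    and C: "C \<subseteq> V" "C \<noteq> {}"
      "\<And>x y t. x \<in> C \<Longrightarrow> y \<in> C \<Longrightarrow> 0 \<le> t \<Longrightarrow> t \<le> 1 \<Longrightarrow> add (sc t x) (sc (1 - t) y) \<in> C"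
    and d: "\<And>x. x \<in> C \<Longrightarrow> d \<le> N x"
  obtains l where "linear_on l" "\<And>x. x \<in> V \<Longrightarrow> l x \<le> N x" "\<And>x. x \<in> C \<Longrightarrow> d \<le> l x"
proof -
  let ?S = "{(t * d, sc t c) | t c. t \<ge> 0 \<and> c \<in> C}"
  let ?q = "\<lambda>x. INF (r, v)\<in>?S. N (add x v) - r"
  have cone: "cone_below ?S N"
  proof -
    have 1: "\<And>r v. (r, v) \<in> ?S \<Longrightarrow> v \<in> V" using C(1) by auto
    obtain c where "c \<in> C" using C(2) by auto
    then have 2: "(0, th) \<in> ?S" using sc_zero[of c] C(1) by force
    have 3: "(r + r', add v v') \<in> ?S" if rv: "(r, v) \<in> ?S" "(r', v') \<in> ?S" for r v r' v'
    proof -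
      obtain t c where tc: "r = t * d" "v = sc t c" "t \<ge> 0" "c \<in> C" using rv(1) by auto
      obtain t' c' where tc': "r' = t' * d" "v' = sc t' c'" "t' \<ge> 0" "c' \<in> C" using rv(2) by auto
      note t = tc tc'
      have cV: "c \<in> V" "c' \<in> V" using t C(1) by auto
      show ?thesis
      proof (cases "t + t' = 0")
        case True
        then have "t = 0" "t' = 0" using t by auto
        then show ?thesis using t cV \<open>(0, th) \<in> ?S\<close> by (simp add: sc_zero)
      next
        case False
        \<comment> \<open>For \<open>t + t' > 0\<close> the sum of the two cone vectors is
          \<open>t + t'\<close> times this convex combination, which lies in
          \<open>C\<close>.\<close>
        define e where "e = add (sc (t / (t + t')) c) (sc (1 - t / (t + t')) c')"
        have "e \<in> C" unfolding e_def using t False C(3) by simp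
        moreover have "1 - t / (t + t') = t' / (t + t')" using False by (simp add: field_simps)
        then have "add v v' = sc (t + t') e" unfolding e_def t using cV False
          by (simp add: sc_right sc_sc)
        moreover have "r + r' = (t + t') * d" "t + t' \<ge> 0" using t by (simp_all add: distrib_right)
        ultimately show ?thesis by blast
      qed
    qed
    have 4: "(s * r, sc s v) \<in> ?S" if rv: "(r, v) \<in> ?S" and "s > 0" for r v s
    proof -
      obtain t c where "r = t * d" "v = sc t c" "t \<ge> 0" "c \<in> C" using rv by auto
      then have "s * r = (s * t) * d" "sc s v = sc (s * t) c" "s * t \<ge> 0"
        using sc_sc[of c] C(1) \<open>s > 0\<close> by auto
      then show ?thesis using \<open>c \<in> C\<close> by blast
    qed
    have 5: "r \<le> N v" if rv: "(r, v) \<in> ?S" for r v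
    proof -
      obtain t c where t: "r = t * d" "v = sc t c" "t \<ge> 0" "c \<in> C" using rv by auto
      have cV: "c \<in> V" using t C(1) by auto
      show ?thesis
      proof (cases "t = 0")
        case True then show ?thesis using t sc_zero[OF cV] sublinear_th[OF N] by simp
      next
        case False
        then show ?thesis
          using mult_left_mono[OF d[OF t(4)] t(3)] sublinear_scale[OF N cV, of t] t by simp
      qed
    qed
    show ?thesis
      unfolding cone_below_def
    proof (intro conjI)
      show "(0, th) \<in> ?S" by (rule 2)
      show "\<forall>(r, v)\<in>?S. v \<in> V \<and> r \<le> N v" by clarify (use 1 5 in blast)
      show "\<forall>(r, v)\<in>?S. \<forall>(r', v')\<in>?S. (r + r', add v v') \<in> ?S" by clarify (use 3 in blast)
      show "\<forall>(r, v)\<in>?S. \<forall>s>0. (s * r, sc s v) \<in> ?S" by clarify (use 4 in blast)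
    qed
  qed
  note c = sublinear_cone[OF N cone]
  obtain l where l: "linear_on l" "\<And>x. x \<in> V \<Longrightarrow> l x \<le> ?q x"
    using hahn_banach_sublinear[OF c(1)] by blast
  show ?thesis
  proof (rule that[OF l(1)])
    show "l x \<le> N x" if "x \<in> V" for x using l(2)[OF that] c(2)[OF that] by simp
    fix x assume x: "x \<in> C"
    then have xV: "x \<in> V" using C(1) by auto
    have "(1 * d, sc 1 x) \<in> ?S" using x zero_le_one by blast
    then have "(d, x) \<in> ?S" using xV by simp
    \<comment> \<open>At \<open>- x\<close> the cone element \<open>(d, x)\<close> cancels the
      vector, and \<open>l (- x) \<le> - d\<close> remains.\<close>
    from c(3)[OF this, of "sc (-1) x"] have "?q (sc (-1) x) \<le> N th - d"
      using xV by (simp add: V_neg')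
    moreover have "l (sc (-1) x) \<le> ?q (sc (-1) x)" using xV l(2)[of "sc (-1) x"] by simp
    moreover have "l (sc (-1) x) = - l x" using l(1) xV unfolding linear_on_def by simp
    ultimately show "d \<le> l x" using sublinear_th[OF N] by simp
  qed
qed

end

section \<open>Densities of set functions\<close>

context prob_space
begin

lemma AE_le_of_set_integrals:
  fixes a b :: "'a \<Rightarrow> real"
  assumes [measurable]: "integrable M a" "integrable M b"
    and le: "\<And>B. B \<in> sets M \<Longrightarrow> (\<integral>\<omega>. indicator B \<omega> * a \<omega> \<partial>M) \<le> (\<integral>\<omega>. indicator B \<omega> * b \<omega> \<partial>M)"
  shows "AE \<omega> in M. a \<omega> \<le> b \<omega>"
proof -
  define B where "B = {\<omega> \<in> space M. b \<omega> < a \<omega>}"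
  have [measurable]: "B \<in> sets M" unfolding B_def by measurable
  have i: "integrable M (\<lambda>\<omega>. indicator B \<omega> * a \<omega>)" "integrable M (\<lambda>\<omega>. indicator B \<omega> * b \<omega>)"
    using integrable_mult_indicator[of B M a] integrable_mult_indicator[of B M b] assms(1,2) by auto
  let ?d = "\<lambda>\<omega>. indicator B \<omega> * a \<omega> - indicator B \<omega> * b \<omega>"
  have nn: "AE \<omega> in M. 0 \<le> ?d \<omega>" by (rule AE_I2) (auto simp: B_def indicator_def)
  have "integral\<^sup>L M ?d \<le> 0" using le[of B] i by simp
  moreover have "integral\<^sup>L M ?d \<ge> 0" using nn by (rule integral_nonneg_AE)
  ultimately have "integral\<^sup>L M ?d = 0" by simp
  then have "AE \<omega> in M. ?d \<omega> = 0"
    using integral_nonneg_eq_0_iff_AE[of M ?d] i nn by simp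
  then show ?thesis
    using AE_space by eventually_elim (auto simp: B_def indicator_def split: if_splits)
qed

text \<open>The values of an \<open>L0\<close>-linear functional are merely measurable. A positive
  weight makes the test integrals finite and cancels at the end.\<close>

lemma AE_eq_of_weighted_integrals:
  fixes a b u :: "'a \<Rightarrow> real"
  assumes "integrable M (\<lambda>\<omega>. u \<omega> * a \<omega>)" "integrable M (\<lambda>\<omega>. u \<omega> * b \<omega>)" "\<And>\<omega>. u \<omega> > 0"
    and eq: "\<And>B. B \<in> sets M \<Longrightarrow> (\<integral>\<omega>. (indicator B \<omega> * u \<omega>) * a \<omega> \<partial>M) = (\<integral>\<omega>. (indicator B \<omega> * u \<omega>) * b \<omega> \<partial>M)"
  shows "AE \<omega> in M. a \<omega> = b \<omega>"
proof -
  have "AE \<omega> in M. u \<omega> * a \<omega> \<le> u \<omega> * b \<omega>" "AE \<omega> in M. u \<omega> * b \<omega> \<le> u \<omega> * a \<omega>"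
    by (rule AE_le_of_set_integrals; use assms in \<open>simp add: mult.assoc\<close>)+
  then show ?thesis
  proof eventually_elim
    case (elim \<omega>)
    then have "u \<omega> * a \<omega> = u \<omega> * b \<omega>" by linarith
    then show ?case using assms(3)[of \<omega>] by simp
  qed
qed

text \<open>Shifting \<open>b\<close> by the dominating measure makes it nonnegative, and the
  domination upgrades finite to countable additivity by giving continuity at the empty set.
  Subtracting \<open>q\<close> from the Radon-Nikodym density of the shifted measure gives the
  density of \<open>b\<close>.\<close>

lemma bounded_additive_density:
  fixes b :: "'a set \<Rightarrow> real" and q :: "'a \<Rightarrow> real"
  assumes q: "integrable M q" "AE \<omega> in M. 0 \<le> q \<omega>"
    and add: "\<And>A B. A \<in> sets M \<Longrightarrow> B \<in> sets M \<Longrightarrow> A \<inter> B = {} \<Longrightarrow> b (A \<union> B) = b A + b B"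
    and bound: "\<And>A. A \<in> sets M \<Longrightarrow> \<bar>b A\<bar> \<le> (\<integral>\<omega>. indicator A \<omega> * q \<omega> \<partial>M)"
  obtains g where "integrable M g" "AE \<omega> in M. \<bar>g \<omega>\<bar> \<le> q \<omega>"
    "\<And>A. A \<in> sets M \<Longrightarrow> (\<integral>\<omega>. indicator A \<omega> * g \<omega> \<partial>M) = b A"
proof -
  let ?I = "\<lambda>A. \<integral>\<omega>. indicator A \<omega> * q \<omega> \<partial>M"
  have [measurable]: "q \<in> borel_measurable M" using q(1) by simp
  have int: "integrable M (\<lambda>\<omega>. indicator A \<omega> * f \<omega>)"
    if "A \<in> sets M" "integrable M f" for A and f :: "'a \<Rightarrow> real"
    using integrable_mult_indicator[OF that] by simp
  have Iadd: "?I (A \<union> B) = ?I A + ?I B" if "A \<in> sets M" "B \<in> sets M" "A \<inter> B = {}" for A B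
  proof -
    have "?I (A \<union> B) = (\<integral>\<omega>. indicator A \<omega> * q \<omega> + indicator B \<omega> * q \<omega> \<partial>M)"
      using that(3) by (intro Bochner_Integration.integral_cong) (auto simp: indicator_def)
    then show ?thesis using int that q by simp
  qed
  define \<nu> where "\<nu> = (\<lambda>A. ennreal (b A + ?I A))"
  have nn: "0 \<le> b A + ?I A" if "A \<in> sets M" for A using bound[OF that] by linarith
  have b0: "b {} = 0" using bound[of "{}"] by simp
  have pos: "positive (sets M) \<nu>" unfolding positive_def \<nu>_def using b0 by simp
  have "additive (sets M) \<nu>" unfolding additive_def \<nu>_def
    using add Iadd nn by (auto simp: ennreal_plus[symmetric] add_ac simp del: ennreal_plus)
  then have ca: "countably_additive (sets M) \<nu>"
  proof (intro sets.empty_continuous_imp_countably_additive pos)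
    show "\<forall>A\<in>sets M. \<nu> A \<noteq> \<infinity>" unfolding \<nu>_def by simp
    fix A :: "nat \<Rightarrow> 'a set" assume A: "range A \<subseteq> sets M" "decseq A" "(\<Inter>i. A i) = {}"
    have [measurable]: "A i \<in> sets M" for i using A by auto
    have "(\<lambda>i. ?I (A i)) \<longlonglongrightarrow> (\<integral>\<omega>. 0 \<partial>M)"
    proof (rule integral_dominated_convergence[where w = "\<lambda>\<omega>. \<bar>q \<omega>\<bar>"])
      show "AE \<omega> in M. (\<lambda>i. indicator (A i) \<omega> * q \<omega>) \<longlonglongrightarrow> 0"
      proof (rule AE_I2)
        fix \<omega>
        obtain k where k: "\<omega> \<notin> A k" using A(3) by auto
        then have "\<forall>i\<ge>k. \<omega> \<notin> A i" using A(2) unfolding decseq_def by blast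
        then have "eventually (\<lambda>i. indicator (A i) \<omega> * q \<omega> = 0) sequentially"
          unfolding eventually_sequentially by (intro exI[of _ k]) simp
        then show "(\<lambda>i. indicator (A i) \<omega> * q \<omega>) \<longlonglongrightarrow> 0" by (rule tendsto_eventually)
      qed
    qed (use q in \<open>auto simp: indicator_def\<close>)
    \<comment> \<open>The shifted set function lies between 0 and twice the dominating integral,
      because \<open>b A\<close> is at most \<open>?I A\<close>.\<close>
    then have lim: "(\<lambda>i. 2 * ?I (A i)) \<longlonglongrightarrow> 0" using tendsto_mult_right_zero by auto
    have "(\<lambda>i. b (A i) + ?I (A i)) \<longlonglongrightarrow> 0"
      by (rule tendsto_sandwich[OF _ _ tendsto_const lim])
        (use nn bound in \<open>auto intro!: always_eventually simp: abs_le_iff\<close>)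
    then have "(\<lambda>i. ennreal (b (A i) + ?I (A i))) \<longlonglongrightarrow> ennreal 0" by (rule tendsto_ennrealI)
    then show "(\<lambda>i. \<nu> (A i)) \<longlonglongrightarrow> 0" unfolding \<nu>_def by simp
  qed
  define N where "N = measure_of (space M) (sets M) \<nu>"
  have sN: "sets N = sets M" unfolding N_def by simp
  have eN: "emeasure N A = \<nu> A" if "A \<in> sets M" for A
    unfolding N_def by (rule emeasure_measure_of_sigma[OF sets.sigma_algebra_axioms pos ca that])
  have "space N = space M" using sets_eq_imp_space_eq[OF sN] .
  then have "finite_measure N"
    by (intro finite_measureI) (simp add: eN \<nu>_def)
  moreover have "absolutely_continuous M N"
    unfolding absolutely_continuous_def
  proof
    fix A assume A: "A \<in> null_sets M"
    then have As: "A \<in> sets M" by auto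
    have "?I A = (\<integral>\<omega>. 0 \<partial>M)"
      using As AE_not_in[OF A] by (intro integral_cong_AE) (auto elim!: eventually_mono)
    then have "\<nu> A = 0" using bound[OF As] unfolding \<nu>_def by simp
    then show "A \<in> null_sets N" using As sN eN by auto
  qed
  ultimately obtain h where h: "h \<in> borel_measurable M" "density M h = N"
    using Radon_Nikodym_finite_measure[OF _ sN] by auto
  note [measurable] = h(1)
  have hI: "(\<integral>\<^sup>+\<omega>. h \<omega> * indicator A \<omega> \<partial>M) = \<nu> A" if "A \<in> sets M" for A
    using emeasure_density[OF h(1) that] h(2) eN[OF that] by simp
  have "(\<integral>\<^sup>+\<omega>. h \<omega> \<partial>M) = \<nu> (space M)"
    unfolding hI[OF sets.top, symmetric] by (intro nn_integral_cong) simp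
  then have hfin: "(\<integral>\<^sup>+\<omega>. h \<omega> \<partial>M) \<noteq> \<infinity>" unfolding \<nu>_def by simp
  then have hAE: "AE \<omega> in M. h \<omega> \<noteq> \<infinity>" by (intro nn_integral_PInf_AE h)
  let ?h = "\<lambda>\<omega>. enn2real (h \<omega>)"
  have hh: "AE \<omega> in M. ennreal (?h \<omega>) = h \<omega>" using hAE by eventually_elim (simp add: top.not_eq_extremum)
  have ih: "integrable M ?h"
  proof (rule integrableI_nonneg)
    have "(\<integral>\<^sup>+\<omega>. ennreal (?h \<omega>) \<partial>M) = (\<integral>\<^sup>+\<omega>. h \<omega> \<partial>M)" using hh by (rule nn_integral_cong_AE)
    then show "(\<integral>\<^sup>+\<omega>. ennreal (?h \<omega>) \<partial>M) < \<infinity>" using hfin by (simp add: top.not_eq_extremum)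
  qed auto
  have hb: "(\<integral>\<omega>. indicator A \<omega> * ?h \<omega> \<partial>M) = b A + ?I A" if "A \<in> sets M" for A
  proof (rule integral_eq_nn_integral[THEN trans])
    have "(\<integral>\<^sup>+\<omega>. ennreal (indicator A \<omega> * ?h \<omega>) \<partial>M) = (\<integral>\<^sup>+\<omega>. h \<omega> * indicator A \<omega> \<partial>M)"
      using hh by (intro nn_integral_cong_AE) (auto simp: indicator_def elim!: eventually_mono)
    then show "enn2real (\<integral>\<^sup>+\<omega>. ennreal (indicator A \<omega> * ?h \<omega>) \<partial>M) = b A + ?I A"
      using hI[OF that] nn[OF that] unfolding \<nu>_def by simp
  qed (use that in auto)
  define g where "g = (\<lambda>\<omega>. ?h \<omega> - q \<omega>)"
  have ig: "integrable M g" unfolding g_def using ih q by simp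
  have gb: "(\<integral>\<omega>. indicator A \<omega> * g \<omega> \<partial>M) = b A" if "A \<in> sets M" for A
    unfolding g_def using hb[OF that] int[OF that ih] int[OF that q(1)] by (simp add: right_diff_distrib)
  have "AE \<omega> in M. g \<omega> \<le> q \<omega>"
    by (rule AE_le_of_set_integrals[OF ig q(1)]) (use gb bound in \<open>auto simp: abs_le_iff\<close>)
  moreover have "AE \<omega> in M. - g \<omega> \<le> q \<omega>"
  proof (rule AE_le_of_set_integrals[OF _ q(1)])
    fix A assume "A \<in> sets M"
    then show "(\<integral>\<omega>. indicator A \<omega> * - g \<omega> \<partial>M) \<le> ?I A"
      using gb[of A] bound[of A] by (simp add: abs_le_iff)
  qed (use ig in simp)
  ultimately have "AE \<omega> in M. \<bar>g \<omega>\<bar> \<le> q \<omega>" by eventually_elim simp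
  with ig gb show ?thesis using that by blast
qed

end

section \<open>\<open>L\<^sup>0\<close>-linear functionals on a module over \<open>L\<^sup>0\<close>\<close>

locale random_module = prob_space M for M :: "'w measure" +
  fixes E :: "'e set" and add :: "'e \<Rightarrow> 'e \<Rightarrow> 'e"
    and smul :: "('w \<Rightarrow> 'k::real_normed_field) \<Rightarrow> 'e \<Rightarrow> 'e" and th :: 'e
  assumes L0_module: "L0_module M E add smul th"
begin

text \<open>\<open>L0\<close>-convexity involves real random scalars only, so restricting to them
  treats the real and the complex case at once; in the complex case the functionals below play the
  role of real parts.\<close>

abbreviation rs :: "('w \<Rightarrow> real) \<Rightarrow> 'e \<Rightarrow> 'e" where
  "rs \<xi> x \<equiv> smul (\<lambda>\<omega>. of_real (\<xi> \<omega>)) x"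

lemma of_real_L0: "\<xi> \<in> borel_measurable M \<Longrightarrow> (\<lambda>\<omega>. of_real (\<xi> \<omega>) :: 'k) \<in> L0 M"
  unfolding L0_def by measurable

lemmas th_E [simp] = L0_module[unfolded L0_module_def, THEN conjunct1]
lemmas add_E [simp] = L0_module[unfolded L0_module_def, THEN conjunct2, THEN conjunct1, rule_format]
lemmas smul_E = L0_module[unfolded L0_module_def, THEN conjunct2, THEN conjunct2, THEN conjunct1, rule_format]
lemmas add_assoc = L0_module[unfolded L0_module_def, THEN conjunct2, THEN conjunct2, THEN conjunct2, THEN conjunct2, THEN conjunct1, rule_format]
lemmas add_comm = L0_module[unfolded L0_module_def, THEN conjunct2, THEN conjunct2, THEN conjunct2, THEN conjunct2, THEN conjunct2, THEN conjunct1, rule_format]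
lemmas add_th [simp] = L0_module[unfolded L0_module_def, THEN conjunct2, THEN conjunct2, THEN conjunct2, THEN conjunct2, THEN conjunct2, THEN conjunct2, THEN conjunct1, rule_format]
lemmas smul_neg = L0_module[unfolded L0_module_def, THEN conjunct2, THEN conjunct2, THEN conjunct2, THEN conjunct2, THEN conjunct2, THEN conjunct2, THEN conjunct2, THEN conjunct1, rule_format]
lemmas smul_one [simp] = L0_module[unfolded L0_module_def, THEN conjunct2, THEN conjunct2, THEN conjunct2, THEN conjunct2, THEN conjunct2, THEN conjunct2, THEN conjunct2, THEN conjunct2, THEN conjunct1, rule_format]
lemmas smul_smul = L0_module[unfolded L0_module_def, THEN conjunct2, THEN conjunct2, THEN conjunct2, THEN conjunct2, THEN conjunct2, THEN conjunct2, THEN conjunct2, THEN conjunct2, THEN conjunct2, THEN conjunct1, rule_format]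
lemmas smul_left = L0_module[unfolded L0_module_def, THEN conjunct2, THEN conjunct2, THEN conjunct2, THEN conjunct2, THEN conjunct2, THEN conjunct2, THEN conjunct2, THEN conjunct2, THEN conjunct2, THEN conjunct2, THEN conjunct1, rule_format]
lemmas smul_right = L0_module[unfolded L0_module_def, THEN conjunct2, THEN conjunct2, THEN conjunct2, THEN conjunct2, THEN conjunct2, THEN conjunct2, THEN conjunct2, THEN conjunct2, THEN conjunct2, THEN conjunct2, THEN conjunct2, rule_format]

lemma rs_E [simp]: "\<xi> \<in> borel_measurable M \<Longrightarrow> x \<in> E \<Longrightarrow> rs \<xi> x \<in> E"
  by (rule smul_E[OF of_real_L0])

lemma rs_neg: "x \<in> E \<Longrightarrow> add x (rs (\<lambda>_. - 1) x) = th"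
  using smul_neg by simp

lemma rs_rs:
  "\<xi> \<in> borel_measurable M \<Longrightarrow> \<eta> \<in> borel_measurable M \<Longrightarrow> x \<in> E \<Longrightarrow>
    rs \<xi> (rs \<eta> x) = rs (\<lambda>\<omega>. \<xi> \<omega> * \<eta> \<omega>) x"
  using smul_smul[OF of_real_L0 of_real_L0, of \<xi> \<eta> x] by simp

lemma rs_left:
  "\<xi> \<in> borel_measurable M \<Longrightarrow> \<eta> \<in> borel_measurable M \<Longrightarrow> x \<in> E \<Longrightarrow>
    rs (\<lambda>\<omega>. \<xi> \<omega> + \<eta> \<omega>) x = add (rs \<xi> x) (rs \<eta> x)"
  using smul_left[OF of_real_L0 of_real_L0, of \<xi> \<eta> x] by simp

lemmas rs_right = smul_right[OF of_real_L0]

lemma mdiff_eq: "mdiff add smul x y = add x (rs (\<lambda>_. - 1) y)"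
  unfolding mdiff_def by simp

abbreviation seminorm :: "('e \<Rightarrow> 'w \<Rightarrow> real) \<Rightarrow> bool" where
  "seminorm p \<equiv> L0_seminorm M E add smul p"

lemma seminorm_meas [measurable (raw)]: "seminorm p \<Longrightarrow> x \<in> E \<Longrightarrow> p x \<in> borel_measurable M"
  and seminorm_nonneg: "seminorm p \<Longrightarrow> x \<in> E \<Longrightarrow> AE \<omega> in M. 0 \<le> p x \<omega>"
  and seminorm_add: "seminorm p \<Longrightarrow> x \<in> E \<Longrightarrow> y \<in> E \<Longrightarrow> AE \<omega> in M. p (add x y) \<omega> \<le> p x \<omega> + p y \<omega>"
  unfolding L0_seminorm_def by blast+

lemma seminorm_rs:
  assumes "seminorm p" "\<xi> \<in> borel_measurable M" "x \<in> E"
  shows "AE \<omega> in M. p (rs \<xi> x) \<omega> = \<bar>\<xi> \<omega>\<bar> * p x \<omega>"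
proof -
  have "AE \<omega> in M. p (rs \<xi> x) \<omega> = norm (of_real (\<xi> \<omega>) :: 'k) * p x \<omega>"
    using assms of_real_L0[OF assms(2)] unfolding L0_seminorm_def by blast
  then show ?thesis by simp
qed

text \<open>Values are representatives, so linearity is stated almost surely, with an exceptional
  set that depends on the vectors and the scalar. Pointwise arguments can therefore combine only
  countably many such relations.\<close>

definition functional :: "('e \<Rightarrow> 'w \<Rightarrow> real) \<Rightarrow> bool" where
  "functional f \<longleftrightarrow> (\<forall>x\<in>E. f x \<in> borel_measurable M) \<and>
     (\<forall>x\<in>E. \<forall>y\<in>E. AE \<omega> in M. f (add x y) \<omega> = f x \<omega> + f y \<omega>) \<and>
     (\<forall>\<xi>\<in>borel_measurable M. \<forall>x\<in>E. AE \<omega> in M. f (rs \<xi> x) \<omega> = \<xi> \<omega> * f x \<omega>)"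

lemma functional_meas [measurable (raw)]: "functional f \<Longrightarrow> x \<in> E \<Longrightarrow> f x \<in> borel_measurable M"
  and functional_add: "functional f \<Longrightarrow> x \<in> E \<Longrightarrow> y \<in> E \<Longrightarrow> AE \<omega> in M. f (add x y) \<omega> = f x \<omega> + f y \<omega>"
  and functional_rs: "functional f \<Longrightarrow> \<xi> \<in> borel_measurable M \<Longrightarrow> x \<in> E \<Longrightarrow>
        AE \<omega> in M. f (rs \<xi> x) \<omega> = \<xi> \<omega> * f x \<omega>"
  unfolding functional_def by blast+

text \<open>The seminorm of a module element need not be integrable. This is the real subspace on
  which \<open>E (p x)\<close> is finite; a positive random weight moves any element of
  \<open>E\<close> into it.\<close>

definition integrable_part :: "('e \<Rightarrow> 'w \<Rightarrow> real) \<Rightarrow> 'e set" where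
  "integrable_part p = {x \<in> E. integrable M (p x)}"

lemma rs_integrable_part:
  assumes p: "seminorm p" and [measurable]: "\<xi> \<in> borel_measurable M" and x: "x \<in> E"
  shows "rs \<xi> x \<in> integrable_part p \<longleftrightarrow> integrable M (\<lambda>\<omega>. \<xi> \<omega> * p x \<omega>)"
proof -
  have [measurable]: "p x \<in> borel_measurable M" "p (rs \<xi> x) \<in> borel_measurable M"
    using p x by (auto intro: seminorm_meas)
  have "integrable M (p (rs \<xi> x)) \<longleftrightarrow> integrable M (\<lambda>\<omega>. \<bar>\<xi> \<omega>\<bar> * p x \<omega>)"
    using seminorm_rs[OF p assms(2) x] by (intro integrable_cong_AE) auto
  also have "\<dots> \<longleftrightarrow> integrable M (\<lambda>\<omega>. \<bar>\<xi> \<omega> * p x \<omega>\<bar>)"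
    using seminorm_nonneg[OF p x] by (intro integrable_cong_AE) (auto simp: abs_mult elim!: eventually_mono)
  also have "\<dots> \<longleftrightarrow> integrable M (\<lambda>\<omega>. \<xi> \<omega> * p x \<omega>)"
    by (rule integrable_abs_iff) measurable
  finally show ?thesis unfolding integrable_part_def using x by simp
qed

text \<open>The subspace varies with \<open>p\<close> inside the carrier \<open>E\<close>, which is
  why the Hahn-Banach section works with an explicit carrier and explicit operations.\<close>

lemma integrable_part_space:
  assumes p: "seminorm p"
  shows "carrier_vector_space (integrable_part p) add (\<lambda>s. rs (\<lambda>_. s)) th"
proof
  have thI: "integrable M (p th)"
  proof -
    have "rs (\<lambda>_. 0) th \<in> integrable_part p"
      unfolding rs_integrable_part[OF p borel_measurable_const th_E] by simp
    moreover have "rs (\<lambda>_. 0) th = rs (\<lambda>_. 1 + - 1) th" by simp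
    moreover have "\<dots> = th"
      using rs_left[of "\<lambda>_. 1" "\<lambda>_. - 1" th] rs_neg[of th] by simp
    ultimately show ?thesis unfolding integrable_part_def by simp
  qed
  then show "th \<in> integrable_part p" unfolding integrable_part_def by simp
  show "add x y \<in> integrable_part p" if "x \<in> integrable_part p" "y \<in> integrable_part p" for x y
  proof -
    have xy: "x \<in> E" "y \<in> E" "integrable M (p x)" "integrable M (p y)"
      using that unfolding integrable_part_def by auto
    have "integrable M (p (add x y))"
    proof (rule Bochner_Integration.integrable_bound)
      show "integrable M (\<lambda>\<omega>. p x \<omega> + p y \<omega>)" using xy by simp
      show "AE \<omega> in M. norm (p (add x y) \<omega>) \<le> norm (p x \<omega> + p y \<omega>)"
        using seminorm_add[OF p xy(1,2)] seminorm_nonneg[OF p add_E[OF xy(1,2)]]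
        by eventually_elim simp
    qed (use p xy in \<open>auto intro: seminorm_meas\<close>)
    then show ?thesis using xy unfolding integrable_part_def by simp
  qed
  show "rs (\<lambda>_. s) x \<in> integrable_part p" if "x \<in> integrable_part p" for s x
    using that rs_integrable_part[OF p, of "\<lambda>_. s" x] unfolding integrable_part_def by simp
  show "rs (\<lambda>_. s) (rs (\<lambda>_. t) x) = rs (\<lambda>_. s * t) x" if "x \<in> integrable_part p" for s t x
    using that rs_rs[of "\<lambda>_. s" "\<lambda>_. t" x] unfolding integrable_part_def by simp
  show "rs (\<lambda>_. s + t) x = add (rs (\<lambda>_. s) x) (rs (\<lambda>_. t) x)" if "x \<in> integrable_part p" for s t x
    using that rs_left[of "\<lambda>_. s" "\<lambda>_. t" x] unfolding integrable_part_def by simp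
qed (auto simp: integrable_part_def rs_right rs_neg[simplified] intro: add_assoc add_comm)

end

lemma weight_le_one: "0 \<le> s \<Longrightarrow> 1 / (1 + s) * s \<le> (1 :: real)"
  by (simp add: divide_le_eq_1)

context random_module
begin

lemma seminorm_expectation_sublinear:
  assumes p: "seminorm p"
  shows "carrier_vector_space.sublinear (integrable_part p) add (\<lambda>s. rs (\<lambda>_. s)) (\<lambda>x. \<integral>\<omega>. p x \<omega> \<partial>M)"
proof -
  interpret V: carrier_vector_space "integrable_part p" add "\<lambda>s. rs (\<lambda>_. s)" th
    by (rule integrable_part_space[OF p])
  have V: "x \<in> E" "integrable M (p x)" if "x \<in> integrable_part p" for x
    using that unfolding integrable_part_def by auto
  show ?thesis
    unfolding V.sublinear_def
  proof (intro conjI ballI allI impI)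
    fix x y assume xy: "x \<in> integrable_part p" "y \<in> integrable_part p"
    have "(\<integral>\<omega>. p (add x y) \<omega> \<partial>M) \<le> (\<integral>\<omega>. p x \<omega> + p y \<omega> \<partial>M)"
      using V[OF V.add_V[OF xy]] V[OF xy(1)] V[OF xy(2)] seminorm_add[OF p] by (intro integral_mono_AE) auto
    then show "(\<integral>\<omega>. p (add x y) \<omega> \<partial>M) \<le> (\<integral>\<omega>. p x \<omega> \<partial>M) + (\<integral>\<omega>. p y \<omega> \<partial>M)"
      using V xy by simp
  next
    fix x and s :: real assume x: "x \<in> integrable_part p" "0 < s"
    have "(\<integral>\<omega>. p (rs (\<lambda>_. s) x) \<omega> \<partial>M) = (\<integral>\<omega>. s * p x \<omega> \<partial>M)"
      using seminorm_rs[OF p, of "\<lambda>_. s" x] x V[OF x(1)] V[OF V.sc_V[OF x(1)]]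
      by (intro integral_cong_AE) auto
    then show "(\<integral>\<omega>. p (rs (\<lambda>_. s) x) \<omega> \<partial>M) \<le> s * (\<integral>\<omega>. p x \<omega> \<partial>M)" by simp
  qed
qed

text \<open>For fixed \<open>y\<close>, the set function \<open>A \<mapsto> l (1\<^sub>A y)\<close> is dominated by \<open>A \<mapsto> E[1\<^sub>A p y]\<close>; its
  Radon-Nikodym density is the value at \<open>y\<close> of the \<open>L\<^sup>0\<close>-linear functional represented by \<open>l\<close>.\<close>

lemma functional_of_linear:
  assumes p: "seminorm p"
    and l: "carrier_vector_space.linear_on (integrable_part p) add (\<lambda>s. rs (\<lambda>_. s)) l"
    and le: "\<And>x. x \<in> integrable_part p \<Longrightarrow> l x \<le> (\<integral>\<omega>. p x \<omega> \<partial>M)"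
  obtains f where "functional f" "\<And>x. x \<in> E \<Longrightarrow> AE \<omega> in M. \<bar>f x \<omega>\<bar> \<le> p x \<omega>"
    "\<And>x. x \<in> integrable_part p \<Longrightarrow> (\<integral>\<omega>. f x \<omega> \<partial>M) = l x"
proof -
  interpret V: carrier_vector_space "integrable_part p" add "\<lambda>s. rs (\<lambda>_. s)" th
    by (rule integrable_part_space[OF p])
  have V: "x \<in> E" "integrable M (p x)" if "x \<in> integrable_part p" for x
    using that unfolding integrable_part_def by auto
  have ladd: "l (add x y) = l x + l y" if "x \<in> integrable_part p" "y \<in> integrable_part p" for x y
    using l that unfolding V.linear_on_def by blast
  have lsc: "l (rs (\<lambda>_. s) x) = s * l x" if "x \<in> integrable_part p" for s x
    using l that unfolding V.linear_on_def by blast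
  have Ers: "(\<integral>\<omega>. p (rs \<xi> x) \<omega> \<partial>M) = (\<integral>\<omega>. \<bar>\<xi> \<omega>\<bar> * p x \<omega> \<partial>M)"
    if "\<xi> \<in> borel_measurable M" "x \<in> E" for \<xi> x
    using seminorm_rs[OF p that] that seminorm_meas[OF p] by (intro integral_cong_AE) auto
  have labs: "\<bar>l x\<bar> \<le> (\<integral>\<omega>. p x \<omega> \<partial>M)" if x: "x \<in> integrable_part p" for x
  proof -
    have "l (rs (\<lambda>_. - 1) x) \<le> (\<integral>\<omega>. p (rs (\<lambda>_. - 1) x) \<omega> \<partial>M)"
      by (rule le) (rule V.sc_V[OF x])
    also have "\<dots> = (\<integral>\<omega>. p x \<omega> \<partial>M)" using Ers[of "\<lambda>_. - 1" x] V[OF x] by simp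
    finally show ?thesis using lsc[OF x, of "- 1"] le[OF x] by simp
  qed
  \<comment> \<open>\<open>g\<close> is to represent \<open>l\<close> on all admissible multiples of
    \<open>x\<close>: \<open>\<xi> x\<close> lies in the integrable part exactly when
    \<open>\<xi> * p x\<close> is integrable, and then \<open>l (\<xi> x)\<close> has to be
    \<open>E (\<xi> * g)\<close>.\<close>
  define D where "D = (\<lambda>x g. g \<in> borel_measurable M \<and> (AE \<omega> in M. \<bar>g \<omega>\<bar> \<le> p x \<omega>) \<and>
    (\<forall>\<xi>\<in>borel_measurable M. integrable M (\<lambda>\<omega>. \<xi> \<omega> * p x \<omega>) \<longrightarrow> (\<integral>\<omega>. \<xi> \<omega> * g \<omega> \<partial>M) = l (rs \<xi> x)))"
  have D_eq: "(\<integral>\<omega>. \<xi> \<omega> * g \<omega> \<partial>M) = l (rs \<xi> x)"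
    if "D x g" "\<xi> \<in> borel_measurable M" "integrable M (\<lambda>\<omega>. \<xi> \<omega> * p x \<omega>)" for x g \<xi>
    using that(1)[unfolded D_def, THEN conjunct2, THEN conjunct2, rule_format, OF that(2,3)] .
  have D_V: "\<exists>g. D y g" if y: "y \<in> integrable_part p" for y
  proof -
    have yE: "y \<in> E" and py: "integrable M (p y)" using V[OF y] by auto
    have [measurable]: "p y \<in> borel_measurable M" using py by simp
    have pn: "AE \<omega> in M. 0 \<le> p y \<omega>" using seminorm_nonneg[OF p yE] .
    have ind: "rs (indicator A) y \<in> integrable_part p" if "A \<in> sets M" for A
      using integrable_mult_indicator[OF that py] that yE by (simp add: rs_integrable_part[OF p])
    have badd: "l (rs (indicator (A \<union> B)) y) = l (rs (indicator A) y) + l (rs (indicator B) y)"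
      if "A \<in> sets M" "B \<in> sets M" "A \<inter> B = {}" for A B
    proof -
      have "(indicator (A \<union> B) :: 'w \<Rightarrow> real) = (\<lambda>\<omega>. indicator A \<omega> + indicator B \<omega>)"
        using that(3) by (auto simp: indicator_def fun_eq_iff)
      then have "rs (indicator (A \<union> B)) y = rs (\<lambda>\<omega>. indicator A \<omega> + indicator B \<omega>) y" by simp
      also have "\<dots> = add (rs (indicator A) y) (rs (indicator B) y)"
        by (rule rs_left) (use that yE in auto)
      finally show ?thesis using ladd ind that by simp
    qed
    have bbound: "\<bar>l (rs (indicator A) y)\<bar> \<le> (\<integral>\<omega>. indicator A \<omega> * p y \<omega> \<partial>M)" if "A \<in> sets M" for A
      using labs[OF ind[OF that]] Ers[of "indicator A" y] that yE by simp
    obtain g where g: "integrable M g" "AE \<omega> in M. \<bar>g \<omega>\<bar> \<le> p y \<omega>"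
      "\<And>A. A \<in> sets M \<Longrightarrow> (\<integral>\<omega>. indicator A \<omega> * g \<omega> \<partial>M) = l (rs (indicator A) y)"
      using bounded_additive_density[OF py pn, of "\<lambda>A. l (rs (indicator A) y)"] badd bbound by blast
    note [measurable] = borel_measurable_integrable[OF g(1)]
    \<comment> \<open>The admissible multipliers are the integrable functions for the measure with
      density \<open>p y\<close>, so the passage from indicators to all of them is the induction
      over integrable functions for this measure.\<close>
    let ?N = "density M (p y)"
    have iN: "integrable ?N \<zeta> \<longleftrightarrow> integrable M (\<lambda>\<omega>. \<zeta> \<omega> * p y \<omega>)" if "\<zeta> \<in> borel_measurable M" for \<zeta> :: "'w \<Rightarrow> real"
      using integrable_real_density[OF _ pn that] by (simp add: mult.commute)
    have ig: "integrable M (\<lambda>\<omega>. \<zeta> \<omega> * g \<omega>)"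
      if [measurable]: "\<zeta> \<in> borel_measurable M" and i: "integrable M (\<lambda>\<omega>. \<zeta> \<omega> * p y \<omega>)" for \<zeta> :: "'w \<Rightarrow> real"
    proof (rule Bochner_Integration.integrable_bound[OF i])
      show "AE \<omega> in M. norm (\<zeta> \<omega> * g \<omega>) \<le> norm (\<zeta> \<omega> * p y \<omega>)"
        using g(2) by eventually_elim (auto simp: abs_mult intro: mult_left_mono)
    qed measurable
    have main: "(\<integral>\<omega>. \<zeta> \<omega> * g \<omega> \<partial>M) = l (rs \<zeta> y)" if "integrable ?N \<zeta>" for \<zeta> :: "'w \<Rightarrow> real"
      using that
    proof (induction rule: integrable_induct)
      case (base A c)
      then have [measurable]: "A \<in> sets M" by simp
      have "rs (\<lambda>\<omega>. indicator A \<omega> * c) y = rs (\<lambda>_. c) (rs (indicator A) y)"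
        using rs_rs[of "\<lambda>_. c" "indicator A" y] yE by (simp add: mult.commute)
      then have "l (rs (\<lambda>\<omega>. indicator A \<omega> * c) y) = c * l (rs (indicator A) y)"
        using lsc[OF ind] by simp
      moreover have "(\<integral>\<omega>. (indicator A \<omega> *\<^sub>R c) * g \<omega> \<partial>M) = (\<integral>\<omega>. c * (indicator A \<omega> * g \<omega>) \<partial>M)"
        by (simp add: ac_simps)
      ultimately show ?case using g(3)[of A] by simp
    next
      case (add f h)
      have m[measurable]: "f \<in> borel_measurable M" "h \<in> borel_measurable M"
        using borel_measurable_integrable[OF add.hyps(1)] borel_measurable_integrable[OF add.hyps(2)] by auto
      have i: "integrable M (\<lambda>\<omega>. f \<omega> * p y \<omega>)" "integrable M (\<lambda>\<omega>. h \<omega> * p y \<omega>)"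
        using iN add m by auto
      then have "rs f y \<in> integrable_part p" "rs h y \<in> integrable_part p"
        using rs_integrable_part[OF p] m yE by auto
      then have "l (rs (\<lambda>\<omega>. f \<omega> + h \<omega>) y) = l (rs f y) + l (rs h y)"
        unfolding rs_left[OF m yE] by (rule ladd)
      then show ?case using add ig[OF m(1) i(1)] ig[OF m(2) i(2)] by (simp add: distrib_right)
    next
      case (lim f s)
      have m[measurable]: "f \<in> borel_measurable M" "\<And>i. s i \<in> borel_measurable M"
        using borel_measurable_integrable[OF lim.hyps(4)] borel_measurable_integrable[OF lim.hyps(1)] by auto
      have i: "integrable M (\<lambda>\<omega>. f \<omega> * p y \<omega>)" "\<And>i. integrable M (\<lambda>\<omega>. s i \<omega> * p y \<omega>)"
        using iN lim m by auto
      have dom: "norm (s i \<omega>) \<le> 2 * norm (f \<omega>)" "(\<lambda>i. s i \<omega>) \<longlonglongrightarrow> f \<omega>" if "\<omega> \<in> space M" for i \<omega>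
        using lim.hyps(2,3) that by auto
      have "(\<lambda>i. \<integral>\<omega>. s i \<omega> * g \<omega> \<partial>M) \<longlonglongrightarrow> (\<integral>\<omega>. f \<omega> * g \<omega> \<partial>M)"
      proof (rule integral_dominated_convergence)
        show "integrable M (\<lambda>\<omega>. 2 * \<bar>f \<omega> * g \<omega>\<bar>)" using ig[OF m(1) i(1)] by simp
        show "AE \<omega> in M. (\<lambda>i. s i \<omega> * g \<omega>) \<longlonglongrightarrow> f \<omega> * g \<omega>"
          using dom by (intro AE_I2 tendsto_mult_right)
        show "AE \<omega> in M. norm (s i \<omega> * g \<omega>) \<le> 2 * \<bar>f \<omega> * g \<omega>\<bar>" for i
          using dom(1)[of _ i] by (intro AE_I2) (auto simp: abs_mult mult.assoc[symmetric] intro!: mult_right_mono)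
      qed measurable
      then have 1: "(\<lambda>i. l (rs (s i) y)) \<longlonglongrightarrow> (\<integral>\<omega>. f \<omega> * g \<omega> \<partial>M)" using lim.IH by simp
      \<comment> \<open>\<open>l\<close> is continuous along the approximants because
        \<open>\<bar>l (\<xi> y)\<bar>\<close> is at most
        \<open>E (\<bar>\<xi>\<bar> * p y)\<close>. They satisfy
        \<open>\<bar>s i\<bar> \<le> 2 * \<bar>f\<bar>\<close>, so the differences are dominated by
        \<open>3 * \<bar>f\<bar>\<close>.\<close>
      have 2: "(\<lambda>i. \<integral>\<omega>. \<bar>s i \<omega> - f \<omega>\<bar> * p y \<omega> \<partial>M) \<longlonglongrightarrow> (\<integral>\<omega>. 0 \<partial>M)"
      proof (rule integral_dominated_convergence)
        show "integrable M (\<lambda>\<omega>. 3 * \<bar>f \<omega> * p y \<omega>\<bar>)" using i by simp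
        show "AE \<omega> in M. (\<lambda>i. \<bar>s i \<omega> - f \<omega>\<bar> * p y \<omega>) \<longlonglongrightarrow> 0"
        proof (rule AE_I2)
          fix \<omega> assume "\<omega> \<in> space M"
          then have "(\<lambda>i. \<bar>s i \<omega> - f \<omega>\<bar> * p y \<omega>) \<longlonglongrightarrow> \<bar>f \<omega> - f \<omega>\<bar> * p y \<omega>"
            by (intro tendsto_intros dom)
          then show "(\<lambda>i. \<bar>s i \<omega> - f \<omega>\<bar> * p y \<omega>) \<longlonglongrightarrow> 0" by simp
        qed
        show "AE \<omega> in M. norm (\<bar>s i \<omega> - f \<omega>\<bar> * p y \<omega>) \<le> 3 * \<bar>f \<omega> * p y \<omega>\<bar>" for i
        proof (rule AE_I2)
          fix \<omega> assume "\<omega> \<in> space M"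
          then have "\<bar>s i \<omega> - f \<omega>\<bar> \<le> 3 * \<bar>f \<omega>\<bar>" using dom(1)[of \<omega> i] by simp
          then have "\<bar>s i \<omega> - f \<omega>\<bar> * \<bar>p y \<omega>\<bar> \<le> (3 * \<bar>f \<omega>\<bar>) * \<bar>p y \<omega>\<bar>" by (rule mult_right_mono) simp
          then show "norm (\<bar>s i \<omega> - f \<omega>\<bar> * p y \<omega>) \<le> 3 * \<bar>f \<omega> * p y \<omega>\<bar>" by (simp add: abs_mult)
        qed
      qed measurable
      have 3: "\<bar>l (rs (s i) y) - l (rs f y)\<bar> \<le> (\<integral>\<omega>. \<bar>s i \<omega> - f \<omega>\<bar> * p y \<omega> \<partial>M)" for i
      proof -
        have dm: "(\<lambda>\<omega>. s i \<omega> - f \<omega>) \<in> borel_measurable M" by measurable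
        have di: "rs (\<lambda>\<omega>. s i \<omega> - f \<omega>) y \<in> integrable_part p"
          unfolding rs_integrable_part[OF p dm yE] using i by (simp add: left_diff_distrib)
        have fi: "rs f y \<in> integrable_part p" using rs_integrable_part[OF p m(1) yE] i by simp
        have "rs (s i) y = add (rs (\<lambda>\<omega>. s i \<omega> - f \<omega>) y) (rs f y)"
          using rs_left[OF dm m(1) yE] by simp
        then have "l (rs (s i) y) - l (rs f y) = l (rs (\<lambda>\<omega>. s i \<omega> - f \<omega>) y)"
          using ladd[OF di fi] by simp
        then show ?thesis using labs[OF di] Ers[OF dm yE] by simp
      qed
      have "(\<lambda>i. l (rs (s i) y) - l (rs f y)) \<longlonglongrightarrow> 0"
        by (rule Lim_null_comparison[OF _ 2[simplified]]) (use 3 in simp)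
      then have "(\<lambda>i. l (rs (s i) y)) \<longlonglongrightarrow> l (rs f y)" by (simp add: LIM_zero_iff)
      then show ?case using 1 LIMSEQ_unique by blast
    qed
    have "D y g" unfolding D_def using g(2) main iN by simp
    then show ?thesis by blast
  qed
  have D_ex: "\<exists>g. D x g" if x: "x \<in> E" for x
  proof -
    have [measurable]: "p x \<in> borel_measurable M" using seminorm_meas[OF p x] .
    \<comment> \<open>\<open>u\<close> scales \<open>x\<close> into the integrable part; a density
      for \<open>u x\<close>, divided by \<open>u\<close>, is one for \<open>x\<close>.\<close>
    define u where "u = (\<lambda>\<omega>. 1 / (1 + \<bar>p x \<omega>\<bar>))"
    have um[measurable]: "u \<in> borel_measurable M" unfolding u_def by measurable
    have u: "(1 + \<bar>p x \<omega>\<bar>) * u \<omega> = 1" "u \<omega> > 0" for \<omega> unfolding u_def by (auto simp: add_pos_nonneg)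
    have "integrable M (\<lambda>\<omega>. u \<omega> * p x \<omega>)"
      by (rule integrable_const_bound[where B = 1]) (auto simp: u_def divide_simps)
    then have y: "rs u x \<in> integrable_part p" using rs_integrable_part[OF p um x] by simp
    obtain g where g: "D (rs u x) g" using D_V[OF y] by blast
    let ?g = "\<lambda>\<omega>. (1 + \<bar>p x \<omega>\<bar>) * g \<omega>"
    have [measurable]: "g \<in> borel_measurable M" using g unfolding D_def by simp
    have pu: "AE \<omega> in M. p (rs u x) \<omega> = u \<omega> * p x \<omega>"
      using seminorm_rs[OF p um x] by eventually_elim (simp add: u(2) less_imp_le)
    have "D x ?g"
      unfolding D_def
    proof (intro conjI ballI impI)
      have "AE \<omega> in M. \<bar>g \<omega>\<bar> \<le> p (rs u x) \<omega>" using g unfolding D_def by simp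
      then show "AE \<omega> in M. \<bar>?g \<omega>\<bar> \<le> p x \<omega>"
        using pu
      proof eventually_elim
        case (elim \<omega>)
        have "(1 + \<bar>p x \<omega>\<bar>) * \<bar>g \<omega>\<bar> \<le> (1 + \<bar>p x \<omega>\<bar>) * (u \<omega> * p x \<omega>)"
          using elim by (intro mult_left_mono) auto
        also have "\<dots> = p x \<omega>" using u(1)[of \<omega>] by (simp add: mult.assoc[symmetric])
        finally show ?case by (simp add: abs_mult)
      qed
      fix \<xi> :: "'w \<Rightarrow> real" assume [measurable]: "\<xi> \<in> borel_measurable M" and i: "integrable M (\<lambda>\<omega>. \<xi> \<omega> * p x \<omega>)"
      let ?z = "\<lambda>\<omega>. \<xi> \<omega> * (1 + \<bar>p x \<omega>\<bar>)"
      have zm: "?z \<in> borel_measurable M" by measurable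
      have zu: "?z \<omega> * u \<omega> = \<xi> \<omega>" for \<omega> using u(1)[of \<omega>] by (simp add: mult.assoc)
      have [measurable]: "p (rs u x) \<in> borel_measurable M" using seminorm_meas[OF p rs_E[OF um x]] .
      have "integrable M (\<lambda>\<omega>. ?z \<omega> * p (rs u x) \<omega>) \<longleftrightarrow> integrable M (\<lambda>\<omega>. \<xi> \<omega> * p x \<omega>)"
      proof (rule integrable_cong_AE)
        show "AE \<omega> in M. ?z \<omega> * p (rs u x) \<omega> = \<xi> \<omega> * p x \<omega>"
          using pu
        proof eventually_elim
          case (elim \<omega>)
          have "?z \<omega> * (u \<omega> * p x \<omega>) = (?z \<omega> * u \<omega>) * p x \<omega>" by (simp only: mult.assoc)
          then show ?case using elim zu by simp
        qed
      qed measurable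
      with i have "integrable M (\<lambda>\<omega>. ?z \<omega> * p (rs u x) \<omega>)" by simp
      then have "(\<integral>\<omega>. ?z \<omega> * g \<omega> \<partial>M) = l (rs ?z (rs u x))"
        by (rule D_eq[OF g zm])
      also have "rs ?z (rs u x) = rs \<xi> x" unfolding rs_rs[OF zm um x] zu ..
      finally show "(\<integral>\<omega>. \<xi> \<omega> * ?g \<omega> \<partial>M) = l (rs \<xi> x)" by (simp add: mult.assoc)
    qed measurable
    then show ?thesis by blast
  qed
  define f where "f = (\<lambda>x. SOME g. D x g)"
  have f: "D x (f x)" if "x \<in> E" for x unfolding f_def using someI_ex[OF D_ex[OF that]] .
  have fm[measurable]: "f x \<in> borel_measurable M" if "x \<in> E" for x using f[OF that] unfolding D_def by simp
  have fle: "AE \<omega> in M. \<bar>f x \<omega>\<bar> \<le> p x \<omega>" if "x \<in> E" for x using f[OF that] unfolding D_def by simp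
  have fi: "(\<integral>\<omega>. \<xi> \<omega> * f x \<omega> \<partial>M) = l (rs \<xi> x)"
    if "x \<in> E" "\<xi> \<in> borel_measurable M" "integrable M (\<lambda>\<omega>. \<xi> \<omega> * p x \<omega>)" for x \<xi>
    by (rule D_eq[OF f[OF that(1)] that(2,3)])
  have fint: "integrable M (\<lambda>\<omega>. \<xi> \<omega> * f x \<omega>)"
    if x: "x \<in> E" and [measurable]: "\<xi> \<in> borel_measurable M" and i: "integrable M (\<lambda>\<omega>. \<xi> \<omega> * p x \<omega>)" for x \<xi>
  proof (rule Bochner_Integration.integrable_bound[OF i])
    show "AE \<omega> in M. norm (\<xi> \<omega> * f x \<omega>) \<le> norm (\<xi> \<omega> * p x \<omega>)"
      using fle[OF x] by eventually_elim (auto simp: abs_mult intro: mult_left_mono)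
  qed (use fm[OF x] in measurable)
  have "functional f"
    unfolding functional_def
  proof (intro conjI ballI)
    show "f x \<in> borel_measurable M" if "x \<in> E" for x using fm that .
    fix x y assume x: "x \<in> E" and y: "y \<in> E"
    have m[measurable]: "p x \<in> borel_measurable M" "p y \<in> borel_measurable M" "p (add x y) \<in> borel_measurable M"
      using seminorm_meas[OF p] x y by auto
    \<comment> \<open>One weight serves \<open>x\<close>, \<open>y\<close> and their sum, so that
      \<open>l\<close> can be evaluated on all three after multiplication by \<open>u\<close> and
      the indicator of any measurable \<open>B\<close>. Letting \<open>B\<close> vary identifies the
      densities.\<close>
    define u where "u = (\<lambda>\<omega>. 1 / (1 + (\<bar>p x \<omega>\<bar> + \<bar>p y \<omega>\<bar>)))"
    have [measurable]: "u \<in> borel_measurable M" unfolding u_def by measurable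
    have upos: "u \<omega> > 0" for \<omega> unfolding u_def by (auto simp: add_pos_nonneg)
    have ub: "u \<omega> * (\<bar>p x \<omega>\<bar> + \<bar>p y \<omega>\<bar>) \<le> 1" for \<omega> unfolding u_def by (rule weight_le_one) simp
    have bd: "integrable M (\<lambda>\<omega>. (indicator B \<omega> * u \<omega>) * q \<omega>)"
      if [measurable]: "B \<in> sets M" "q \<in> borel_measurable M" and q: "AE \<omega> in M. \<bar>q \<omega>\<bar> \<le> \<bar>p x \<omega>\<bar> + \<bar>p y \<omega>\<bar>" for B q
    proof (rule integrable_const_bound[where B = 1])
      show "AE \<omega> in M. norm (indicator B \<omega> * u \<omega> * q \<omega>) \<le> 1"
        using q
      proof eventually_elim
        case (elim \<omega>)
        have "u \<omega> * \<bar>q \<omega>\<bar> \<le> u \<omega> * (\<bar>p x \<omega>\<bar> + \<bar>p y \<omega>\<bar>)" using elim upos[of \<omega>] by (intro mult_left_mono) auto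
        then have "u \<omega> * \<bar>q \<omega>\<bar> \<le> 1" using ub[of \<omega>] by simp
        then show ?case using upos[of \<omega>] by (auto simp: abs_mult indicator_def)
      qed
    qed measurable
    have qs: "AE \<omega> in M. \<bar>p x \<omega>\<bar> \<le> \<bar>p x \<omega>\<bar> + \<bar>p y \<omega>\<bar>" "AE \<omega> in M. \<bar>p y \<omega>\<bar> \<le> \<bar>p x \<omega>\<bar> + \<bar>p y \<omega>\<bar>"
      by (auto intro: AE_I2)
    have q3: "AE \<omega> in M. \<bar>p (add x y) \<omega>\<bar> \<le> \<bar>p x \<omega>\<bar> + \<bar>p y \<omega>\<bar>"
      using seminorm_add[OF p x y] seminorm_nonneg[OF p add_E[OF x y]] by eventually_elim linarith
    let ?I = "\<lambda>B \<omega>. indicator B \<omega> * u \<omega>"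
    have im: "?I B \<in> borel_measurable M" if "B \<in> sets M" for B using that by measurable
    note b = bd[OF _ m(1) qs(1)] bd[OF _ m(2) qs(2)] bd[OF _ m(3) q3]
    have fi3: "integrable M (\<lambda>\<omega>. ?I B \<omega> * f x \<omega>)" "integrable M (\<lambda>\<omega>. ?I B \<omega> * f y \<omega>)"
        "integrable M (\<lambda>\<omega>. ?I B \<omega> * f (add x y) \<omega>)" if "B \<in> sets M" for B
      using fint[OF x im[OF that] b(1)[OF that]] fint[OF y im[OF that] b(2)[OF that]]
        fint[OF add_E[OF x y] im[OF that] b(3)[OF that]] by auto
    show "AE \<omega> in M. f (add x y) \<omega> = f x \<omega> + f y \<omega>"
    proof (rule AE_eq_of_weighted_integrals[where u = u])
      have sp: "(\<lambda>\<omega>. u \<omega> * q \<omega>) = (\<lambda>\<omega>. (indicator UNIV \<omega> * u \<omega>) * q \<omega>)" for q :: "'w \<Rightarrow> real" by simp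
      have cong: "integrable M (\<lambda>\<omega>. u \<omega> * q \<omega>) \<longleftrightarrow> integrable M (\<lambda>\<omega>. ?I (space M) \<omega> * q \<omega>)" for q :: "'w \<Rightarrow> real"
        by (rule Bochner_Integration.integrable_cong) auto
      show "integrable M (\<lambda>\<omega>. u \<omega> * f (add x y) \<omega>)" "integrable M (\<lambda>\<omega>. u \<omega> * (f x \<omega> + f y \<omega>))"
        unfolding cong using fi3[OF sets.top] by (simp_all add: distrib_left)
      fix B assume B: "B \<in> sets M"
      have VV: "rs (?I B) x \<in> integrable_part p" "rs (?I B) y \<in> integrable_part p"
        using rs_integrable_part[OF p im[OF B]] x y b B by auto
      have "(\<integral>\<omega>. ?I B \<omega> * f (add x y) \<omega> \<partial>M) = l (rs (?I B) (add x y))"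
        by (rule fi) (use x y im b B in auto)
      also have "\<dots> = l (rs (?I B) x) + l (rs (?I B) y)"
        unfolding rs_right[OF im[OF B] x y] by (rule ladd[OF VV])
      also have "l (rs (?I B) x) = (\<integral>\<omega>. ?I B \<omega> * f x \<omega> \<partial>M)"
        by (rule fi[symmetric]) (use x y im b B in auto)
      also have "l (rs (?I B) y) = (\<integral>\<omega>. ?I B \<omega> * f y \<omega> \<partial>M)"
        by (rule fi[symmetric]) (use x y im b B in auto)
      finally show "(\<integral>\<omega>. ?I B \<omega> * f (add x y) \<omega> \<partial>M) = (\<integral>\<omega>. ?I B \<omega> * (f x \<omega> + f y \<omega>) \<partial>M)"
        using fi3[OF B] by (simp add: distrib_left)
    qed (rule upos)
  next
    fix \<eta> :: "'w \<Rightarrow> real" and x assume \<eta>[measurable]: "\<eta> \<in> borel_measurable M" and x: "x \<in> E"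
    have m[measurable]: "p x \<in> borel_measurable M" "p (rs \<eta> x) \<in> borel_measurable M"
      using seminorm_meas[OF p] x \<eta> by auto
    define u where "u = (\<lambda>\<omega>. 1 / (1 + \<bar>\<eta> \<omega>\<bar> * \<bar>p x \<omega>\<bar>))"
    have [measurable]: "u \<in> borel_measurable M" unfolding u_def by measurable
    have upos: "u \<omega> > 0" for \<omega> unfolding u_def by (auto simp: add_pos_nonneg)
    have ub: "u \<omega> * (\<bar>\<eta> \<omega>\<bar> * \<bar>p x \<omega>\<bar>) \<le> 1" for \<omega> unfolding u_def by (rule weight_le_one) simp
    let ?I = "\<lambda>B \<omega>. indicator B \<omega> * u \<omega>"
    have im: "?I B \<in> borel_measurable M" "(\<lambda>\<omega>. ?I B \<omega> * \<eta> \<omega>) \<in> borel_measurable M" if "B \<in> sets M" for B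
      using that by measurable
    have b2: "integrable M (\<lambda>\<omega>. (?I B \<omega> * \<eta> \<omega>) * p x \<omega>)" if [measurable]: "B \<in> sets M" for B
    proof (rule integrable_const_bound[where B = 1])
      show "AE \<omega> in M. norm ((?I B \<omega> * \<eta> \<omega>) * p x \<omega>) \<le> 1"
      proof (rule AE_I2)
        fix \<omega> show "norm ((?I B \<omega> * \<eta> \<omega>) * p x \<omega>) \<le> 1"
          using ub[of \<omega>] upos[of \<omega>] by (auto simp: abs_mult indicator_def mult.assoc)
      qed
    qed measurable
    have b1: "integrable M (\<lambda>\<omega>. ?I B \<omega> * p (rs \<eta> x) \<omega>)" if [measurable]: "B \<in> sets M" for B
    proof (rule integrable_const_bound[where B = 1])
      show "AE \<omega> in M. norm (?I B \<omega> * p (rs \<eta> x) \<omega>) \<le> 1"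
        using seminorm_rs[OF p \<eta> x]
      proof eventually_elim
        case (elim \<omega>) then show ?case using ub[of \<omega>] upos[of \<omega>] by (auto simp: abs_mult indicator_def mult.assoc)
      qed
    qed measurable
    have fi2: "integrable M (\<lambda>\<omega>. ?I B \<omega> * f (rs \<eta> x) \<omega>)" "integrable M (\<lambda>\<omega>. ?I B \<omega> * (\<eta> \<omega> * f x \<omega>))"
      if "B \<in> sets M" for B
      using fint[OF rs_E[OF \<eta> x] im(1)[OF that] b1[OF that]] fint[OF x im(2)[OF that] b2[OF that]]
      by (auto simp: mult.assoc)
    show "AE \<omega> in M. f (rs \<eta> x) \<omega> = \<eta> \<omega> * f x \<omega>"
    proof (rule AE_eq_of_weighted_integrals[where u = u])
      have cong: "integrable M (\<lambda>\<omega>. u \<omega> * q \<omega>) \<longleftrightarrow> integrable M (\<lambda>\<omega>. ?I (space M) \<omega> * q \<omega>)" for q :: "'w \<Rightarrow> real"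
        by (rule Bochner_Integration.integrable_cong) auto
      show "integrable M (\<lambda>\<omega>. u \<omega> * f (rs \<eta> x) \<omega>)" "integrable M (\<lambda>\<omega>. u \<omega> * (\<eta> \<omega> * f x \<omega>))"
        unfolding cong using fi2[OF sets.top] by simp_all
      fix B assume B: "B \<in> sets M"
      have "(\<integral>\<omega>. ?I B \<omega> * f (rs \<eta> x) \<omega> \<partial>M) = l (rs (?I B) (rs \<eta> x))"
        by (rule fi) (use x im b1 B in auto)
      also have "rs (?I B) (rs \<eta> x) = rs (\<lambda>\<omega>. ?I B \<omega> * \<eta> \<omega>) x" by (rule rs_rs[OF im(1)[OF B] \<eta> x])
      also have "l \<dots> = (\<integral>\<omega>. (?I B \<omega> * \<eta> \<omega>) * f x \<omega> \<partial>M)"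
        by (rule fi[symmetric]) (use x im b2 B in auto)
      finally show "(\<integral>\<omega>. ?I B \<omega> * f (rs \<eta> x) \<omega> \<partial>M) = (\<integral>\<omega>. ?I B \<omega> * (\<eta> \<omega> * f x \<omega>) \<partial>M)"
        by (simp add: mult.assoc)
    qed (rule upos)
  qed
  moreover have "(\<integral>\<omega>. f x \<omega> \<partial>M) = l x" if "x \<in> integrable_part p" for x
    using fi[of x "\<lambda>_. 1"] V[OF that] by simp
  ultimately show ?thesis using that fle by blast
qed

end

section \<open>Convex combinations, new seminorms from old ones, pasting along a measurable
  set\<close>

context random_module
begin

lemma comb_E:
  "\<xi> \<in> borel_measurable M \<Longrightarrow> x \<in> E \<Longrightarrow> y \<in> E \<Longrightarrow> add (rs \<xi> x) (rs (\<lambda>\<omega>. 1 - \<xi> \<omega>) y) \<in> E"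
  by (intro add_E rs_E) auto

lemma mdiff_E [simp]: "x \<in> E \<Longrightarrow> y \<in> E \<Longrightarrow> mdiff add smul x y \<in> E"
  unfolding mdiff_eq by (rule add_E) (auto intro: rs_E[of "\<lambda>_. - 1", simplified])

lemma functional_comb:
  assumes f: "functional f" and [measurable]: "\<xi> \<in> borel_measurable M" and x: "x \<in> E" "y \<in> E"
  shows "AE \<omega> in M. f (add (rs \<xi> x) (rs (\<lambda>\<omega>. 1 - \<xi> \<omega>) y)) \<omega> = \<xi> \<omega> * f x \<omega> + (1 - \<xi> \<omega>) * f y \<omega>"
proof -
  have m: "(\<lambda>\<omega>. 1 - \<xi> \<omega>) \<in> borel_measurable M" by measurable
  show ?thesis
    using functional_add[OF f rs_E[OF assms(2) x(1)] rs_E[OF m x(2)]]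
      functional_rs[OF f assms(2) x(1)] functional_rs[OF f m x(2)]
    by eventually_elim simp
qed

lemma functional_mdiff:
  assumes f: "functional f" and x: "x \<in> E" "y \<in> E"
  shows "AE \<omega> in M. f (mdiff add smul x y) \<omega> = f x \<omega> - f y \<omega>"
proof -
  have m: "(\<lambda>\<omega>. - 1) \<in> borel_measurable M" by measurable
  show ?thesis
    unfolding mdiff_eq using functional_add[OF f x(1) rs_E[OF m x(2)]] functional_rs[OF f m x(2)]
    by eventually_elim simp
qed

lemma functional_uminus:
  assumes f: "functional f"
  shows "functional (\<lambda>x \<omega>. - f x \<omega>)"
  unfolding functional_def
proof (intro conjI ballI)
  show "(\<lambda>\<omega>. - f x \<omega>) \<in> borel_measurable M" if "x \<in> E" for x using functional_meas[OF f that] by measurable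
  show "AE \<omega> in M. - f (add x y) \<omega> = - f x \<omega> + - f y \<omega>" if "x \<in> E" "y \<in> E" for x y
    using functional_add[OF f that] by eventually_elim simp
  show "AE \<omega> in M. - f (rs \<xi> x) \<omega> = \<xi> \<omega> * - f x \<omega>" if "\<xi> \<in> borel_measurable M" "x \<in> E" for \<xi> x
    using functional_rs[OF f that] by eventually_elim simp
qed

lemma seminorm_weighted:
  assumes p: "seminorm p" and w: "w \<in> borel_measurable M"
  shows "seminorm (\<lambda>x \<omega>. \<bar>w \<omega>\<bar> * p x \<omega>)"
  unfolding L0_seminorm_def
proof (intro conjI ballI)
  show "(\<lambda>\<omega>. \<bar>w \<omega>\<bar> * p x \<omega>) \<in> borel_measurable M" if "x \<in> E" for x
    using seminorm_meas[OF p that] w by measurable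
  show "AE \<omega> in M. 0 \<le> \<bar>w \<omega>\<bar> * p x \<omega>" if "x \<in> E" for x
    using seminorm_nonneg[OF p that] by eventually_elim simp
  show "AE \<omega> in M. \<bar>w \<omega>\<bar> * p (smul \<xi> x) \<omega> = norm (\<xi> \<omega>) * (\<bar>w \<omega>\<bar> * p x \<omega>)" if "\<xi> \<in> L0 M" "x \<in> E" for \<xi> x
  proof -
    have "AE \<omega> in M. p (smul \<xi> x) \<omega> = norm (\<xi> \<omega>) * p x \<omega>"
      using p that unfolding L0_seminorm_def by blast
    then show ?thesis by eventually_elim simp
  qed
  show "AE \<omega> in M. \<bar>w \<omega>\<bar> * p (add x y) \<omega> \<le> \<bar>w \<omega>\<bar> * p x \<omega> + \<bar>w \<omega>\<bar> * p y \<omega>" if "x \<in> E" "y \<in> E" for x y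
    using seminorm_add[OF p that] by eventually_elim (simp add: distrib_left[symmetric] mult_left_mono)
qed

lemma seminorm_normQ:
  assumes Q: "finite Q" "Q \<noteq> {}" and p: "\<And>p. p \<in> Q \<Longrightarrow> seminorm p"
  shows "seminorm (normQ Q)"
  unfolding L0_seminorm_def normQ_def
proof (intro conjI ballI)
  obtain q where q: "q \<in> Q" using Q by auto
  have ge: "q x \<omega> \<le> Max ((\<lambda>p. p x \<omega>) ` Q)" if "q \<in> Q" for q x \<omega> using that Q by simp
  show "(\<lambda>\<omega>. Max ((\<lambda>p. p x \<omega>) ` Q)) \<in> borel_measurable M" if "x \<in> E" for x
    using Q seminorm_meas[OF p that] by measurable
  show "AE \<omega> in M. 0 \<le> Max ((\<lambda>p. p x \<omega>) ` Q)" if "x \<in> E" for x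
    using seminorm_nonneg[OF p[OF q] that]
  proof eventually_elim
    case (elim \<omega>) then show ?case using ge[OF q, of x \<omega>] by linarith
  qed
  show "AE \<omega> in M. Max ((\<lambda>p. p (smul \<xi> x) \<omega>) ` Q) = norm (\<xi> \<omega>) * Max ((\<lambda>p. p x \<omega>) ` Q)"
    if "\<xi> \<in> L0 M" "x \<in> E" for \<xi> x
  proof -
    have "AE \<omega> in M. \<forall>p\<in>Q. p (smul \<xi> x) \<omega> = norm (\<xi> \<omega>) * p x \<omega>"
      using p that unfolding L0_seminorm_def by (intro AE_finite_allI Q) blast
    then show ?thesis
    proof eventually_elim
      case (elim \<omega>)
      have "(\<lambda>p. p (smul \<xi> x) \<omega>) ` Q = (\<lambda>a. norm (\<xi> \<omega>) * a) ` ((\<lambda>p. p x \<omega>) ` Q)"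
        unfolding image_image using elim by (intro image_cong) auto
      moreover have "mono (\<lambda>a. norm (\<xi> \<omega>) * a)" by (intro monoI mult_left_mono) auto
      ultimately show ?case
        using mono_Max_commute[of "\<lambda>a. norm (\<xi> \<omega>) * a" "(\<lambda>p. p x \<omega>) ` Q"] Q by simp
    qed
  qed
  show "AE \<omega> in M. Max ((\<lambda>p. p (add x y) \<omega>) ` Q) \<le> Max ((\<lambda>p. p x \<omega>) ` Q) + Max ((\<lambda>p. p y \<omega>) ` Q)"
    if "x \<in> E" "y \<in> E" for x y
  proof -
    have "AE \<omega> in M. \<forall>p\<in>Q. p (add x y) \<omega> \<le> p x \<omega> + p y \<omega>"
      using seminorm_add[OF p that] by (intro AE_finite_allI Q) blast
    then show ?thesis
    proof eventually_elim
      case (elim \<omega>)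
      have "p (add x y) \<omega> \<le> Max ((\<lambda>p. p x \<omega>) ` Q) + Max ((\<lambda>p. p y \<omega>) ` Q)" if "p \<in> Q" for p
        using elim that ge[OF that, of x \<omega>] ge[OF that, of y \<omega>] by fastforce
      then show ?case using Q by simp
    qed
  qed
qed

text \<open>Multiplying the combination by the indicator of \<open>B\<close> or of its complement
  annihilates one of the two pieces, and homogeneity then reads off \<open>p\<close> on each
  part.\<close>

lemma seminorm_comb_indicator:
  assumes p: "seminorm p" and B: "B \<in> sets M" and x: "x \<in> E" "y \<in> E"
  shows "AE \<omega> in M. p (add (rs (indicator B) x) (rs (\<lambda>\<omega>. 1 - indicator B \<omega>) y)) \<omega>
                = (if \<omega> \<in> B then p x \<omega> else p y \<omega>)"
proof -
  let ?c = "add (rs (indicator B) x) (rs (\<lambda>\<omega>. 1 - indicator B \<omega>) y)"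
  have m: "indicator B \<in> borel_measurable M" "(\<lambda>\<omega>. 1 - indicator B \<omega> :: real) \<in> borel_measurable M"
    using B by auto
  have r: "rs (\<lambda>\<omega>. \<xi> \<omega> * indicator B \<omega>) x = rs \<xi>' x" "rs (\<lambda>\<omega>. \<xi> \<omega> * (1 - indicator B \<omega>)) y = rs \<xi>'' y"
    if "\<And>\<omega>. \<xi> \<omega> * indicator B \<omega> = \<xi>' \<omega>" "\<And>\<omega>. \<xi> \<omega> * (1 - indicator B \<omega>) = \<xi>'' \<omega>" for \<xi> \<xi>' \<xi>''
    using that by simp_all
  have c: "?c \<in> E" using comb_E[OF m(1) x] .
  have zero: "rs (\<lambda>_. 0) z = th" if "z \<in> E" for z
    using rs_left[of "\<lambda>_. 1" "\<lambda>_. - 1" z] rs_neg[of z] that by simp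
  have "rs (indicator B) ?c = add (rs (\<lambda>\<omega>. indicator B \<omega> * indicator B \<omega>) x)
      (rs (\<lambda>\<omega>. indicator B \<omega> * (1 - indicator B \<omega>)) y)"
    using rs_right[OF m(1) rs_E[OF m(1) x(1)] rs_E[OF m(2) x(2)]] rs_rs[OF m(1) m(1) x(1)] rs_rs[OF m(1) m(2) x(2)]
    by simp
  also have "(\<lambda>\<omega>. indicator B \<omega> * indicator B \<omega> :: real) = indicator B" by (auto simp: indicator_def)
  also have "(\<lambda>\<omega>. indicator B \<omega> * (1 - indicator B \<omega>) :: real) = (\<lambda>_. 0)" by (auto simp: indicator_def)
  finally have 1: "rs (indicator B) ?c = rs (indicator B) x" using zero[OF x(2)] rs_E[OF m(1) x(1)] by simp
  have "rs (\<lambda>\<omega>. 1 - indicator B \<omega>) ?c = add (rs (\<lambda>\<omega>. (1 - indicator B \<omega>) * indicator B \<omega>) x)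
      (rs (\<lambda>\<omega>. (1 - indicator B \<omega>) * (1 - indicator B \<omega>)) y)"
    using rs_right[OF m(2) rs_E[OF m(1) x(1)] rs_E[OF m(2) x(2)]] rs_rs[OF m(2) m(1) x(1)] rs_rs[OF m(2) m(2) x(2)]
    by simp
  also have "(\<lambda>\<omega>. (1 - indicator B \<omega>) * (1 - indicator B \<omega>) :: real) = (\<lambda>\<omega>. 1 - indicator B \<omega>)" by (auto simp: indicator_def)
  also have "(\<lambda>\<omega>. (1 - indicator B \<omega>) * indicator B \<omega> :: real) = (\<lambda>_. 0)" by (auto simp: indicator_def)
  finally have 2: "rs (\<lambda>\<omega>. 1 - indicator B \<omega>) ?c = rs (\<lambda>\<omega>. 1 - indicator B \<omega>) y"
    using zero[OF x(1)] rs_E[OF m(2) x(2)] add_comm[OF th_E rs_E[OF m(2) x(2)]] by simp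
  show ?thesis
    using seminorm_rs[OF p m(1) c, unfolded 1] seminorm_rs[OF p m(1) x(1)]
      seminorm_rs[OF p m(2) c, unfolded 2] seminorm_rs[OF p m(2) x(2)]
    by eventually_elim (auto simp: indicator_def split: if_splits)
qed

end

section \<open>The \<open>(\<epsilon>, \<lambda>)\<close>-topology\<close>

locale random_locally_convex = random_module M E add smul th for M :: "'w measure" and E :: "'e set"
    and add and smul :: "('w \<Rightarrow> 'k::real_normed_field) \<Rightarrow> 'e \<Rightarrow> 'e" and th +
  fixes PP :: "('e \<Rightarrow> 'w \<Rightarrow> real) set"
  assumes PP: "p \<in> PP \<Longrightarrow> seminorm p"
begin

abbreviation T :: "'e topology" where "T \<equiv> el_topology M E add smul PP"

lemma basic_seminorm: "el_basic PP Q e l \<Longrightarrow> seminorm (normQ Q)"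
  unfolding el_basic_def by (auto intro: seminorm_normQ PP)

text \<open>The parameters \<open>Q \<union> Q'\<close>, \<open>min e e'\<close> and
  \<open>min l l'\<close> give a neighbourhood inside two given ones, which is the point to check
  for intersections of open sets.\<close>

lemma openin_T:
  "openin T U \<longleftrightarrow> U \<subseteq> E \<and> (\<forall>x\<in>U. \<exists>Q e l. el_basic PP Q e l \<and> el_nbhd M E add smul x Q e l \<subseteq> U)"
proof -
  let ?L = "\<lambda>U. U \<subseteq> E \<and> (\<forall>x\<in>U. \<exists>Q e l. el_basic PP Q e l \<and> el_nbhd M E add smul x Q e l \<subseteq> U)"
  have "istopology ?L"
    unfolding istopology_def
  proof (intro conjI allI impI)
    fix S S' assume S: "?L S" and S': "?L S'"
    show "S \<inter> S' \<subseteq> E" using S by auto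
    show "\<forall>x\<in>S \<inter> S'. \<exists>Q e l. el_basic PP Q e l \<and> el_nbhd M E add smul x Q e l \<subseteq> S \<inter> S'"
    proof
      fix x assume x: "x \<in> S \<inter> S'"
      obtain Q e l where 1: "el_basic PP Q e l" "el_nbhd M E add smul x Q e l \<subseteq> S" using S x by blast
      obtain Q' e' l' where 2: "el_basic PP Q' e' l'" "el_nbhd M E add smul x Q' e' l' \<subseteq> S'" using S' x by blast
      have b: "el_basic PP (Q \<union> Q') (min e e') (min l l')" using 1(1) 2(1) unfolding el_basic_def by auto
      have sub: "el_nbhd M E add smul x (Q \<union> Q') (min e e') (min l l') \<subseteq> el_nbhd M E add smul x R d k"
        if R: "el_basic PP R d k" "R \<subseteq> Q \<union> Q'" "min e e' \<le> d" "min l l' \<le> k" for R d k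
      proof
        fix y assume y: "y \<in> el_nbhd M E add smul x (Q \<union> Q') (min e e') (min l l')"
        have yE: "y \<in> E" using y unfolding el_nbhd_def by simp
        have D: "mdiff add smul y x \<in> E" using yE x S by (intro mdiff_E) auto
        have [measurable]: "normQ R (mdiff add smul y x) \<in> borel_measurable M"
          using seminorm_meas[OF basic_seminorm[OF R(1)] D] .
        have le: "normQ R z \<omega> \<le> normQ (Q \<union> Q') z \<omega>" for z \<omega>
          unfolding normQ_def using R b unfolding el_basic_def by (intro Max_mono image_mono) auto
        have "measure M {\<omega>\<in>space M. normQ (Q \<union> Q') (mdiff add smul y x) \<omega> < min e e'}
            \<le> measure M {\<omega>\<in>space M. normQ R (mdiff add smul y x) \<omega> < d}"
        proof (rule finite_measure_mono)
          show "{\<omega>\<in>space M. normQ (Q \<union> Q') (mdiff add smul y x) \<omega> < min e e'}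
              \<subseteq> {\<omega>\<in>space M. normQ R (mdiff add smul y x) \<omega> < d}"
            using R(3) by (auto intro!: le_less_trans[OF le])
        qed measurable
        then show "y \<in> el_nbhd M E add smul x R d k" using y R unfolding el_nbhd_def by auto
      qed
      show "\<exists>Q e l. el_basic PP Q e l \<and> el_nbhd M E add smul x Q e l \<subseteq> S \<inter> S'"
        using b sub[OF 1(1)] sub[OF 2(1)] 1(2) 2(2)
        by (intro exI[of _ "Q \<union> Q'"] exI[of _ "min e e'"] exI[of _ "min l l'"]) auto
    qed
  next
    fix K assume K: "\<forall>U\<in>K. ?L U"
    show "\<Union>K \<subseteq> E" using K by blast
    show "\<forall>x\<in>\<Union>K. \<exists>Q e l. el_basic PP Q e l \<and> el_nbhd M E add smul x Q e l \<subseteq> \<Union>K"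
    proof
      fix x assume "x \<in> \<Union>K"
      then obtain U where U: "U \<in> K" "x \<in> U" by auto
      then obtain Q e l where "el_basic PP Q e l" "el_nbhd M E add smul x Q e l \<subseteq> U" using K by blast
      then show "\<exists>Q e l. el_basic PP Q e l \<and> el_nbhd M E add smul x Q e l \<subseteq> \<Union>K" using U by blast
    qed
  qed
  then show ?thesis unfolding el_topology_def by (simp add: topology_inverse')
qed

lemma topspace_T_subset: "topspace T \<subseteq> E"
  using openin_T openin_topspace by blast

text \<open>With an empty family of seminorms no basic neighbourhood exists and only the empty set
  is open; the assumption excludes this case.\<close>

lemma topspace_T:
  assumes "el_basic PP Q e l"
  shows "topspace T = E"
proof -
  have "openin T E" unfolding openin_T using assms unfolding el_nbhd_def by blast
  then show ?thesis using openin_subset topspace_T_subset by blast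
qed

text \<open>Borel-Cantelli: the exceptional probabilities are bounded by a geometric series, so
  almost surely \<open>h n < (1/2)^n\<close> from some \<open>n\<close> on.\<close>

lemma fast_convergence_AE:
  fixes h :: "nat \<Rightarrow> 'w \<Rightarrow> real"
  assumes [measurable]: "\<And>n. h n \<in> borel_measurable M" and nn: "\<And>n. AE \<omega> in M. 0 \<le> h n \<omega>"
    and P: "\<And>n. prob {\<omega>\<in>space M. h n \<omega> < (1/2)^n} > 1 - (1/2)^(Suc n)"
  shows "AE \<omega> in M. (\<lambda>n. h n \<omega>) \<longlonglongrightarrow> 0"
proof -
  define A where "A = (\<lambda>n. {\<omega>\<in>space M. \<not> h n \<omega> < (1/2)^n})"
  have [measurable]: "A n \<in> sets M" for n unfolding A_def by measurable
  have pA: "prob (A n) \<le> (1/2)^(Suc n)" for n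
  proof -
    have "prob (A n) = 1 - prob {\<omega>\<in>space M. h n \<omega> < (1/2)^n}"
      unfolding A_def by (rule prob_neg) measurable
    then show ?thesis using P[of n] by simp
  qed
  have "summable (\<lambda>n. prob (A n))"
    by (rule summable_comparison_test'[where g = "\<lambda>n. (1/2)^(Suc n)" and N = 0])
      (use pA in \<open>auto simp: summable_geometric\<close>)
  then have "AE \<omega> in M. eventually (\<lambda>n. \<omega> \<in> space M - A n) sequentially"
    by (intro borel_cantelli_AE1) (auto simp: less_top[symmetric])
  moreover have "AE \<omega> in M. \<forall>n. 0 \<le> h n \<omega>" using nn by (simp add: AE_all_countable)
  ultimately show ?thesis
  proof eventually_elim
    case (elim \<omega>)
    have lim: "(\<lambda>n. (1/2)^n :: real) \<longlonglongrightarrow> 0" by (rule LIMSEQ_power_zero) simp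
    show ?case
      by (rule tendsto_sandwich[OF _ _ tendsto_const lim])
        (use elim in \<open>auto simp: A_def elim: eventually_mono\<close>)
  qed
qed

text \<open>The topology need not be metrizable, yet one finite \<open>Q\<close> suffices. Points
  off \<open>G\<close> are handled by the closedness of \<open>G\<close>. If every neighbourhood of
  a point of \<open>G\<close> meets \<open>K\<close>, geometrically shrinking neighbourhoods for
  this \<open>Q\<close> alone give a sequence in \<open>K\<close> whose \<open>Q\<close>-distance to
  the point tends to 0 almost surely.\<close>

lemma closedin_T_sequential:
  assumes G: "closedin T G" "K \<subseteq> G" and Q: "Q \<subseteq> PP" "finite Q" "Q \<noteq> {}"
    and seq: "\<And>x y. x \<in> G \<Longrightarrow> (\<And>n. y n \<in> K) \<Longrightarrow>
      AE \<omega> in M. (\<lambda>n. normQ Q (mdiff add smul (y n) x) \<omega>) \<longlonglongrightarrow> 0 \<Longrightarrow> x \<in> K"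
  shows "closedin T K"
  unfolding closedin_def openin_T
proof (intro conjI ballI)
  \<comment> \<open>The exponent \<open>Suc n\<close> keeps the probability parameter below 1 also
    for \<open>n = 0\<close>.\<close>
  have bas: "el_basic PP Q ((1/2)^n) ((1/2)^(Suc n))" for n
    using Q unfolding el_basic_def by (simp add: power_Suc_less_one del: power_Suc)
  have GE: "G \<subseteq> E" using G(1) closedin_subset topspace_T_subset by blast
  show "K \<subseteq> topspace T" using G closedin_subset by blast
  show "topspace T - K \<subseteq> E" using topspace_T_subset by auto
  fix x assume x: "x \<in> topspace T - K"
  show "\<exists>Q e l. el_basic PP Q e l \<and> el_nbhd M E add smul x Q e l \<subseteq> topspace T - K"
  proof (cases "x \<in> G")
    case False
    have "openin T (topspace T - G)" using G(1) by (simp add: closedin_def)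
    then obtain Q e l where "el_basic PP Q e l" "el_nbhd M E add smul x Q e l \<subseteq> topspace T - G"
      using False x unfolding openin_T by blast
    then show ?thesis using G(2) by blast
  next
    case True
    show ?thesis
    proof (rule ccontr)
      assume no: "\<not> ?thesis"
      have "\<exists>y. y \<in> K \<and> y \<in> el_nbhd M E add smul x Q ((1/2)^n) ((1/2)^(Suc n))" for n
      proof -
        have "\<not> el_nbhd M E add smul x Q ((1/2)^n) ((1/2)^(Suc n)) \<subseteq> topspace T - K"
          using no bas by blast
        then show ?thesis using topspace_T[OF bas[of 0]] unfolding el_nbhd_def by blast
      qed
      then obtain y where y: "\<And>n. y n \<in> K" "\<And>n. y n \<in> el_nbhd M E add smul x Q ((1/2)^n) ((1/2)^(Suc n))"
        by metis
      have D: "mdiff add smul (y n) x \<in> E" for n using y(1) G(2) GE True by (intro mdiff_E) auto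
      have "AE \<omega> in M. (\<lambda>n. normQ Q (mdiff add smul (y n) x) \<omega>) \<longlonglongrightarrow> 0"
      proof (rule fast_convergence_AE)
        show "normQ Q (mdiff add smul (y n) x) \<in> borel_measurable M" for n
          using seminorm_meas[OF basic_seminorm[OF bas] D] .
        show "AE \<omega> in M. 0 \<le> normQ Q (mdiff add smul (y n) x) \<omega>" for n
          using seminorm_nonneg[OF basic_seminorm[OF bas] D] .
        show "1 - (1/2)^(Suc n) < prob {\<omega>\<in>space M. normQ Q (mdiff add smul (y n) x) \<omega> < (1/2)^n}" for n
          using y(2)[of n] unfolding el_nbhd_def by simp
      qed
      then have "x \<in> K" by (rule seq[OF True y(1)])
      then show False using x by simp
    qed
  qed
qed

text \<open>Domination by a single finite \<open>Q\<close> up to a random factor is the form of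
  continuity under which almost sure inequalities survive limits in \<open>normQ Q\<close>.\<close>

definition cfunctional :: "('e \<Rightarrow> 'w \<Rightarrow> real) \<Rightarrow> bool" where
  "cfunctional f \<longleftrightarrow> functional f \<and> (\<exists>Q v. Q \<subseteq> PP \<and> finite Q \<and> Q \<noteq> {} \<and>
     (\<forall>x\<in>E. AE \<omega> in M. \<bar>f x \<omega>\<bar> \<le> v \<omega> * normQ Q x \<omega>))"

lemma cfunctional_functional: "cfunctional f \<Longrightarrow> functional f"
  unfolding cfunctional_def by simp

lemma cfunctional_uminus:
  assumes "cfunctional f"
  shows "cfunctional (\<lambda>x \<omega>. - f x \<omega>)"
  using assms functional_uminus unfolding cfunctional_def by simp

end

section \<open>Consequences of \<open>L\<^sup>0\<close>-convex compactness\<close>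

locale L0_convexly_compact_set = random_locally_convex M E add smul th PP for M :: "'w measure" and E :: "'e set"
    and add and smul :: "('w \<Rightarrow> 'k::real_normed_field) \<Rightarrow> 'e \<Rightarrow> 'e" and th and PP +
  fixes G :: "'e set"
  assumes G_closed: "closedin T G" and G_convex: "L0_convex M add smul G"
    and G_compact: "L0_convexly_compact M E add smul PP G"
begin

lemma G_E: "x \<in> G \<Longrightarrow> x \<in> E"
  using G_closed closedin_subset topspace_T_subset by blast

lemma G_comb:
  assumes "x \<in> G" "y \<in> G" "\<xi> \<in> borel_measurable M" "AE \<omega> in M. 0 \<le> \<xi> \<omega> \<and> \<xi> \<omega> \<le> 1"
  shows "add (rs \<xi> x) (rs (\<lambda>\<omega>. 1 - \<xi> \<omega>) y) \<in> G"
  using G_convex assms unfolding L0_convex_def by blast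

text \<open>The inequality is required almost surely rather than in expectation; this makes the set
  stable under random convex coefficients.\<close>

definition halfspace :: "('e \<Rightarrow> 'w \<Rightarrow> real) \<Rightarrow> ('w \<Rightarrow> real) \<Rightarrow> 'e set" where
  "halfspace f a = {z \<in> G. AE \<omega> in M. a \<omega> \<le> f z \<omega>}"

lemma halfspace_convex:
  assumes f: "functional f"
  shows "L0_convex M add smul (halfspace f a)"
  unfolding L0_convex_def
proof (intro ballI allI impI)
  fix x y and \<xi> :: "'w \<Rightarrow> real" assume x: "x \<in> halfspace f a" and y: "y \<in> halfspace f a"
    and \<xi>: "\<xi> \<in> borel_measurable M \<and> (AE \<omega> in M. 0 \<le> \<xi> \<omega> \<and> \<xi> \<omega> \<le> 1)"
  let ?c = "add (rs \<xi> x) (rs (\<lambda>\<omega>. 1 - \<xi> \<omega>) y)"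
  have xG: "x \<in> G" "y \<in> G" and a: "AE \<omega> in M. a \<omega> \<le> f x \<omega>" "AE \<omega> in M. a \<omega> \<le> f y \<omega>"
    using x y unfolding halfspace_def by auto
  have "AE \<omega> in M. f ?c \<omega> = \<xi> \<omega> * f x \<omega> + (1 - \<xi> \<omega>) * f y \<omega>"
    using functional_comb[OF f] \<xi> xG G_E by blast
  then have "AE \<omega> in M. a \<omega> \<le> f ?c \<omega>"
    using a \<xi>[THEN conjunct2]
  proof eventually_elim
    case (elim \<omega>)
    have "\<xi> \<omega> * a \<omega> + (1 - \<xi> \<omega>) * a \<omega> \<le> \<xi> \<omega> * f x \<omega> + (1 - \<xi> \<omega>) * f y \<omega>"
      using elim by (intro add_mono mult_left_mono) auto
    then show ?case using elim by (simp add: algebra_simps)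
  qed
  moreover have "?c \<in> G" using G_comb[OF xG] \<xi> by blast
  ultimately show "?c \<in> halfspace f a" unfolding halfspace_def by simp
qed

lemma halfspace_closed:
  assumes "cfunctional f"
  shows "closedin T (halfspace f a)"
proof -
  obtain Q v where Q: "Q \<subseteq> PP" "finite Q" "Q \<noteq> {}" and v: "\<And>x. x \<in> E \<Longrightarrow> AE \<omega> in M. \<bar>f x \<omega>\<bar> \<le> v \<omega> * normQ Q x \<omega>"
    and f: "functional f"
    using assms unfolding cfunctional_def by blast
  show ?thesis
  proof (rule closedin_T_sequential[OF G_closed _ Q])
    show "halfspace f a \<subseteq> G" unfolding halfspace_def by auto
    fix x y assume x: "x \<in> G" and y: "\<And>n. y n \<in> halfspace f a"
      and lim: "AE \<omega> in M. (\<lambda>n. normQ Q (mdiff add smul (y n) x) \<omega>) \<longlonglongrightarrow> 0"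
    have yG: "y n \<in> G" "AE \<omega> in M. a \<omega> \<le> f (y n) \<omega>" for n using y unfolding halfspace_def by auto
    have "AE \<omega> in M. \<forall>n. f (mdiff add smul (y n) x) \<omega> = f (y n) \<omega> - f x \<omega>"
      using functional_mdiff[OF f] G_E yG x by (simp add: AE_all_countable)
    moreover have "AE \<omega> in M. \<forall>n. \<bar>f (mdiff add smul (y n) x) \<omega>\<bar> \<le> v \<omega> * normQ Q (mdiff add smul (y n) x) \<omega>"
      using v G_E yG x by (simp add: AE_all_countable)
    moreover have "AE \<omega> in M. \<forall>n. a \<omega> \<le> f (y n) \<omega>" using yG by (simp add: AE_all_countable)
    ultimately have "AE \<omega> in M. a \<omega> \<le> f x \<omega>"
      using lim
    proof eventually_elim
      case (elim \<omega>)
      have "(\<lambda>n. v \<omega> * normQ Q (mdiff add smul (y n) x) \<omega>) \<longlonglongrightarrow> 0"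
        using tendsto_mult_right_zero[OF elim(4)] .
      then have "(\<lambda>n. f (y n) \<omega> - f x \<omega>) \<longlonglongrightarrow> 0"
        by (rule Lim_null_comparison[rotated]) (use elim in \<open>auto intro!: always_eventually\<close>)
      then have "(\<lambda>n. f (y n) \<omega>) \<longlonglongrightarrow> f x \<omega>" by (simp add: LIM_zero_iff)
      then show ?case by (rule LIMSEQ_le_const) (use elim in auto)
    qed
    then show "x \<in> halfspace f a" using x unfolding halfspace_def by simp
  qed
qed

text \<open>All uses of the compactness of \<open>G\<close> pass through this statement. The index
  set may be uncountable, since every inequality keeps its own null set.\<close>

lemma halfspace_compact:
  assumes I: "\<And>i. i \<in> I \<Longrightarrow> cfunctional (f i)"
    and fin: "\<And>J. finite J \<Longrightarrow> J \<subseteq> I \<Longrightarrow> \<exists>z\<in>G. \<forall>i\<in>J. AE \<omega> in M. a i \<omega> \<le> f i z \<omega>"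
  shows "\<exists>z\<in>G. \<forall>i\<in>I. AE \<omega> in M. a i \<omega> \<le> f i z \<omega>"
proof (cases "I = {}")
  \<comment> \<open>The intersection of the empty family is \<open>UNIV\<close> and yields no point
    of \<open>G\<close>; the empty \<open>J\<close> does.\<close>
  case True then show ?thesis using fin[of "{}"] by auto
next
  case False
  let ?F = "(\<lambda>i. halfspace (f i) (a i)) ` I"
  have "\<forall>A\<in>?F. A \<subseteq> G \<and> L0_convex M add smul A \<and> closedin T A"
    using halfspace_convex[OF cfunctional_functional[OF I]] halfspace_closed[OF I] by (auto simp: halfspace_def)
  moreover have "fip ?F"
    unfolding fip_def
  proof (intro allI impI)
    fix H assume H: "H \<subseteq> ?F \<and> finite H \<and> H \<noteq> {}"
    then obtain J where J: "J \<subseteq> I" "finite J" "H = (\<lambda>i. halfspace (f i) (a i)) ` J"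
      using finite_subset_image[of H "\<lambda>i. halfspace (f i) (a i)" I] by blast
    obtain z where "z \<in> G" "\<forall>i\<in>J. AE \<omega> in M. a i \<omega> \<le> f i z \<omega>" using fin[OF J(2,1)] by blast
    then have "z \<in> \<Inter>H" unfolding J(3) halfspace_def by auto
    then show "\<Inter>H \<noteq> {}" by auto
  qed
  ultimately have "\<Inter>?F \<noteq> {}" using G_compact unfolding L0_convexly_compact_def by blast
  then obtain z where z: "z \<in> \<Inter>?F" by blast
  have "z \<in> halfspace (f i) (a i)" if "i \<in> I" for i using z that by blast
  then have "z \<in> G" "\<forall>i\<in>I. AE \<omega> in M. a i \<omega> \<le> f i z \<omega>" using False unfolding halfspace_def by auto
  then show ?thesis by blast
qed

text \<open>A strip is the intersection of two halfspaces, one for \<open>f\<close> and one for its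
  negative; the boolean index selects the sign.\<close>

lemma strip_compact:
  assumes I: "\<And>i. i \<in> I \<Longrightarrow> cfunctional (f i)"
    and fin: "\<And>J. finite J \<Longrightarrow> J \<subseteq> I \<Longrightarrow> \<exists>z\<in>G. \<forall>i\<in>J. AE \<omega> in M. \<bar>f i z \<omega> - a i \<omega>\<bar> \<le> r i \<omega>"
  shows "\<exists>z\<in>G. \<forall>i\<in>I. AE \<omega> in M. \<bar>f i z \<omega> - a i \<omega>\<bar> \<le> r i \<omega>"
proof -
  define s where "s = (\<lambda>b. if b then 1 else - 1 :: real)"
  have s: "(AE \<omega> in M. \<bar>f i z \<omega> - a i \<omega>\<bar> \<le> r i \<omega>) \<longleftrightarrow>
      (\<forall>b. AE \<omega> in M. s b * a i \<omega> - r i \<omega> \<le> s b * f i z \<omega>)" for i z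
    unfolding s_def all_bool_eq by (auto simp: abs_le_iff simp flip: AE_conj_iff elim!: eventually_mono)
  have "\<exists>z\<in>G. \<forall>q\<in>I \<times> UNIV. AE \<omega> in M. s (snd q) * a (fst q) \<omega> - r (fst q) \<omega> \<le> s (snd q) * f (fst q) z \<omega>"
  proof (rule halfspace_compact)
    show "cfunctional (\<lambda>x \<omega>. s (snd q) * f (fst q) x \<omega>)" if "q \<in> I \<times> UNIV" for q
      using that I[of "fst q"] cfunctional_uminus[of "f (fst q)"] by (auto simp: s_def)
    fix J :: "('a \<times> bool) set" assume J: "finite J" "J \<subseteq> I \<times> UNIV"
    have "\<exists>z\<in>G. \<forall>i\<in>fst ` J. AE \<omega> in M. \<bar>f i z \<omega> - a i \<omega>\<bar> \<le> r i \<omega>"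
      by (rule fin) (use J in auto)
    then show "\<exists>z\<in>G. \<forall>q\<in>J. AE \<omega> in M. s (snd q) * a (fst q) \<omega> - r (fst q) \<omega> \<le> s (snd q) * f (fst q) z \<omega>"
      unfolding s by blast
  qed
  then show ?thesis unfolding s by auto
qed

end

lemma (in prob_space) tight_random_variable:
  fixes b :: "'a \<Rightarrow> real"
  assumes [measurable]: "b \<in> borel_measurable M" and "0 < e"
  obtains c where "prob {\<omega>\<in>space M. c < b \<omega>} < e"
proof -
  let ?A = "\<lambda>n. {\<omega>\<in>space M. real n < b \<omega>}"
  have "(\<lambda>n. prob (?A n)) \<longlonglongrightarrow> prob (\<Inter>n. ?A n)"
    by (rule finite_Lim_measure_decseq) (auto simp: decseq_def)
  moreover have "(\<Inter>n. ?A n) = {}"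
  proof -
    have "\<exists>n. \<not> real n < b \<omega>" for \<omega> using real_arch_simple[of "b \<omega>"] by (auto simp: not_less)
    then show ?thesis by blast
  qed
  ultimately have "(\<lambda>n. prob (?A n)) \<longlonglongrightarrow> 0" by simp
  then have "eventually (\<lambda>n. prob (?A n) < e) sequentially" using \<open>0 < e\<close> by (rule order_tendstoD)
  then obtain n where "prob (?A n) < e" unfolding eventually_sequentially by blast
  then show ?thesis by (rule that)
qed

text \<open>Hahn-Banach separation is applied to the singleton \<open>{u y}\<close> at its full
  height \<open>E (p (u y))\<close>. The functional is dominated by \<open>p\<close> and has the
  same expectation at \<open>u y\<close>, so the two agree there almost surely, and \<open>u\<close>
  cancels.\<close>

lemma (in random_module) norming_functional:
  assumes p: "seminorm p" and y: "y \<in> E"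
  obtains h where "functional h" "\<And>x. x \<in> E \<Longrightarrow> AE \<omega> in M. \<bar>h x \<omega>\<bar> \<le> p x \<omega>"
    "AE \<omega> in M. h y \<omega> = p y \<omega>"
proof -
  interpret V: carrier_vector_space "integrable_part p" add "\<lambda>s. rs (\<lambda>_. s)" th
    by (rule integrable_part_space[OF p])
  have [measurable]: "p y \<in> borel_measurable M" using seminorm_meas[OF p y] .
  define u where "u = (\<lambda>\<omega>. 1 / (1 + \<bar>p y \<omega>\<bar>))"
  have um[measurable]: "u \<in> borel_measurable M" unfolding u_def by measurable
  have upos: "u \<omega> > 0" for \<omega> unfolding u_def by (auto simp: add_pos_nonneg)
  have "integrable M (\<lambda>\<omega>. u \<omega> * p y \<omega>)"
    by (rule integrable_const_bound[where B = 1]) (auto simp: u_def divide_simps)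
  then have uy: "rs u y \<in> integrable_part p" using rs_integrable_part[OF p um y] by simp
  then have uyE: "rs u y \<in> E" and iu: "integrable M (p (rs u y))" unfolding integrable_part_def by auto
  have conv: "add (rs (\<lambda>_. t) x) (rs (\<lambda>_. 1 - t) x') \<in> {rs u y}"
    if "x \<in> {rs u y}" "x' \<in> {rs u y}" for x x' t
  proof -
    have "add (rs (\<lambda>_. t) (rs u y)) (rs (\<lambda>_. 1 - t) (rs u y)) = rs (\<lambda>_. t + (1 - t)) (rs u y)"
      using V.sc_left[OF uy, of t "1 - t"] by simp
    also have "\<dots> = rs u y" using uyE by simp
    finally show ?thesis using that by simp
  qed
  obtain l where l: "V.linear_on l" "\<And>x. x \<in> integrable_part p \<Longrightarrow> l x \<le> (\<integral>\<omega>. p x \<omega> \<partial>M)"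
    "\<And>x. x \<in> {rs u y} \<Longrightarrow> (\<integral>\<omega>. p (rs u y) \<omega> \<partial>M) \<le> l x"
    by (rule V.hahn_banach_separation[OF seminorm_expectation_sublinear[OF p], where C = "{rs u y}"
        and d = "\<integral>\<omega>. p (rs u y) \<omega> \<partial>M"]) (use uy conv in auto)
  obtain h where h: "functional h" "\<And>x. x \<in> E \<Longrightarrow> AE \<omega> in M. \<bar>h x \<omega>\<bar> \<le> p x \<omega>"
    "\<And>x. x \<in> integrable_part p \<Longrightarrow> (\<integral>\<omega>. h x \<omega> \<partial>M) = l x"
    using functional_of_linear[OF p l(1,2)] by blast
  have hm[measurable]: "h (rs u y) \<in> borel_measurable M" using functional_meas[OF h(1) uyE] .
  have ih: "integrable M (h (rs u y))"
    by (rule Bochner_Integration.integrable_bound[OF iu hm]) (use h(2)[OF uyE] in \<open>auto elim!: eventually_mono\<close>)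
  have nn: "AE \<omega> in M. 0 \<le> p (rs u y) \<omega> - h (rs u y) \<omega>" using h(2)[OF uyE] by eventually_elim linarith
  have "(\<integral>\<omega>. p (rs u y) \<omega> - h (rs u y) \<omega> \<partial>M) = (\<integral>\<omega>. p (rs u y) \<omega> \<partial>M) - l (rs u y)"
    using ih iu h(3)[OF uy] by simp
  then have "(\<integral>\<omega>. p (rs u y) \<omega> - h (rs u y) \<omega> \<partial>M) = 0"
    using l(3)[of "rs u y"] integral_nonneg_AE[OF nn] by simp
  then have "AE \<omega> in M. p (rs u y) \<omega> - h (rs u y) \<omega> = 0"
    using integral_nonneg_eq_0_iff_AE[OF _ nn] ih iu by simp
  then have "AE \<omega> in M. h y \<omega> = p y \<omega>"
    using seminorm_rs[OF p um y] functional_rs[OF h(1) um y]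
  proof eventually_elim
    case (elim \<omega>)
    then have "u \<omega> * p y \<omega> = u \<omega> * h y \<omega>" using upos[of \<omega>] by simp
    then show ?case using upos[of \<omega>] by simp
  qed
  with h(1,2) show ?thesis by (rule that)
qed

section \<open>Directedness of \<open>G\<close>, boundedness in probability, the weight\<close>

context L0_convexly_compact_set
begin

text \<open>\<open>x\<close> is used where its seminorm is the larger one and \<open>y\<close>
  elsewhere. Pasting of this kind stays in an \<open>L0\<close>-convex set, but not in a merely
  convex one.\<close>

lemma seminorm_directed:
  assumes p: "seminorm p" and x: "x \<in> G" "y \<in> G"
  shows "\<exists>z\<in>G. AE \<omega> in M. p z \<omega> = max (p x \<omega>) (p y \<omega>)"
proof -
  have [measurable]: "p x \<in> borel_measurable M" "p y \<in> borel_measurable M"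
    using seminorm_meas[OF p] x G_E by auto
  define B where "B = {\<omega>\<in>space M. p y \<omega> \<le> p x \<omega>}"
  have B: "B \<in> sets M" unfolding B_def by measurable
  let ?c = "add (rs (indicator B) x) (rs (\<lambda>\<omega>. 1 - indicator B \<omega>) y)"
  have "?c \<in> G" by (rule G_comb) (use x B in \<open>auto simp: indicator_def\<close>)
  moreover have "AE \<omega> in M. p ?c \<omega> = max (p x \<omega>) (p y \<omega>)"
    using seminorm_comb_indicator[OF p B G_E[OF x(1)] G_E[OF x(2)]] AE_space
    by eventually_elim (auto simp: B_def)
  ultimately show ?thesis by blast
qed

lemma functional_directed:
  assumes f: "functional f" and x: "x \<in> G" "y \<in> G"
  shows "\<exists>z\<in>G. AE \<omega> in M. f z \<omega> = max (f x \<omega>) (f y \<omega>)"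
proof -
  have [measurable]: "f x \<in> borel_measurable M" "f y \<in> borel_measurable M"
    using functional_meas[OF f] x G_E by auto
  define B where "B = {\<omega>\<in>space M. f y \<omega> \<le> f x \<omega>}"
  have B: "B \<in> sets M" unfolding B_def by measurable
  let ?c = "add (rs (indicator B) x) (rs (\<lambda>\<omega>. 1 - indicator B \<omega>) y)"
  have "?c \<in> G" by (rule G_comb) (use x B in \<open>auto simp: indicator_def\<close>)
  moreover have "AE \<omega> in M. f ?c \<omega> = max (f x \<omega>) (f y \<omega>)"
    using functional_comb[OF f borel_measurable_indicator[OF B] G_E[OF x(1)] G_E[OF x(2)]] AE_space
    by eventually_elim (auto simp: B_def indicator_def)
  ultimately show ?thesis by blast
qed

lemma directed_finite:
  assumes dir: "\<And>x y. x \<in> G \<Longrightarrow> y \<in> G \<Longrightarrow> \<exists>z\<in>G. AE \<omega> in M. s z \<omega> = max (s x \<omega>) (s y \<omega> :: real)"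
    and S: "finite S" "S \<noteq> {}" "S \<subseteq> G"
  shows "\<exists>z\<in>G. \<forall>x\<in>S. AE \<omega> in M. s x \<omega> \<le> s z \<omega>"
  using S
proof (induction rule: finite_ne_induct)
  case (singleton x) then show ?case by auto
next
  case (insert x S)
  then obtain z where z: "z \<in> G" "\<forall>y\<in>S. AE \<omega> in M. s y \<omega> \<le> s z \<omega>" by auto
  obtain z' where z': "z' \<in> G" "AE \<omega> in M. s z' \<omega> = max (s x \<omega>) (s z \<omega>)"
    using dir[of x z] insert z by blast
  have "AE \<omega> in M. s y \<omega> \<le> s z' \<omega>" if "y \<in> insert x S" for y
  proof (cases "y = x")
    case True then show ?thesis using z'(2) by (auto elim!: eventually_mono)
  next
    case False
    then have "AE \<omega> in M. s y \<omega> \<le> s z \<omega>" using z that by blast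
    then show ?thesis using z'(2) by eventually_elim simp
  qed
  then show ?case using z'(1) by blast
qed

text \<open>The halfspaces given by the lower bounds \<open>f (x n)\<close> have the finite
  intersection property because \<open>G\<close> is directed for \<open>f\<close>; compactness
  supplies one point for all \<open>n\<close>.\<close>

lemma cfunctional_dominated:
  assumes f: "cfunctional f" and x: "\<And>n::nat. x n \<in> G"
  shows "\<exists>z\<in>G. \<forall>n. AE \<omega> in M. f (x n) \<omega> \<le> f z \<omega>"
proof -
  have "\<exists>z\<in>G. \<forall>n\<in>UNIV. AE \<omega> in M. f (x n) \<omega> \<le> f z \<omega>"
  proof (rule halfspace_compact)
    fix J :: "nat set" assume "finite J"
    have "\<exists>z\<in>G. \<forall>y\<in>x ` insert 0 J. AE \<omega> in M. f y \<omega> \<le> f z \<omega>"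
      by (rule directed_finite[OF functional_directed[OF cfunctional_functional[OF f]]]) (use \<open>finite J\<close> x in auto)
    then show "\<exists>z\<in>G. \<forall>n\<in>J. AE \<omega> in M. f (x n) \<omega> \<le> f z \<omega>" by auto
  qed (rule f)
  then show ?thesis by simp
qed

lemma cfunctional_bounded:
  assumes f: "cfunctional f" and x: "\<And>n::nat. x n \<in> G"
  shows "\<exists>b\<in>borel_measurable M. \<forall>n. AE \<omega> in M. \<bar>f (x n) \<omega>\<bar> \<le> b \<omega>"
proof -
  obtain z1 where z1: "z1 \<in> G" "\<And>n. AE \<omega> in M. f (x n) \<omega> \<le> f z1 \<omega>"
    using cfunctional_dominated[of f x, OF f x] by blast
  obtain z2 where z2: "z2 \<in> G" "\<And>n. AE \<omega> in M. - f (x n) \<omega> \<le> - f z2 \<omega>"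
    using cfunctional_dominated[of "\<lambda>x \<omega>. - f x \<omega>" x, OF cfunctional_uminus[OF f] x] by blast
  have m[measurable]: "f z1 \<in> borel_measurable M" "f z2 \<in> borel_measurable M"
    using functional_meas[OF cfunctional_functional[OF f]] G_E z1(1) z2(1) by auto
  have "AE \<omega> in M. \<bar>f (x n) \<omega>\<bar> \<le> \<bar>f z1 \<omega>\<bar> + \<bar>f z2 \<omega>\<bar>" for n
    using z1(2)[of n] z2(2)[of n] by eventually_elim linarith
  moreover have "(\<lambda>\<omega>. \<bar>f z1 \<omega>\<bar> + \<bar>f z2 \<omega>\<bar>) \<in> borel_measurable M" by measurable
  ultimately show ?thesis by (intro bexI[where x = "\<lambda>\<omega>. \<bar>f z1 \<omega>\<bar> + \<bar>f z2 \<omega>\<bar>"]) auto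
qed

text \<open>Gliding hump: if \<open>p\<close> were unbounded in probability along \<open>y\<close>, then the functional
  \<open>\<Sum>k. \<plusminus> h\<^sub>k / 3\<^sup>k\<close> with \<open>h\<^sub>k\<close> norming \<open>y\<^sub>k\<close> would be unbounded along \<open>y\<close>; the signs depend on \<open>\<omega>\<close> and
  prevent the \<open>k\<close>-th summand at \<open>y\<^sub>k\<close> from being cancelled by the previous ones.\<close>

lemma normQ_bounded_in_probability:
  assumes Q: "Q \<subseteq> PP" "finite Q" "Q \<noteq> {}" and e: "0 < e"
  shows "\<exists>c. \<forall>x\<in>G. prob {\<omega>\<in>space M. c < normQ Q x \<omega>} \<le> e"
proof (rule ccontr)
  let ?p = "normQ Q"
  have p: "seminorm ?p" using Q PP by (intro seminorm_normQ) auto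
  assume "\<not> ?thesis"
  \<comment> \<open>The threshold \<open>4 ^ k\<close> is chosen to outgrow the decay
    \<open>(1/3)^k\<close> of the series below.\<close>
  then have "\<forall>k::nat. \<exists>y. y \<in> G \<and> e < prob {\<omega>\<in>space M. 4 ^ k < ?p y \<omega>}" by (meson not_le)
  then obtain y where y: "\<And>k. y k \<in> G" "\<And>k. e < prob {\<omega>\<in>space M. 4 ^ k < ?p (y k) \<omega>}" by metis
  have yE: "y k \<in> E" for k using y(1) G_E by blast
  have "\<exists>h. functional h \<and> (\<forall>x\<in>E. AE \<omega> in M. \<bar>h x \<omega>\<bar> \<le> ?p x \<omega>) \<and> (AE \<omega> in M. h (y k) \<omega> = ?p (y k) \<omega>)" for k
    using norming_functional[OF p yE[of k]] by metis
  then obtain h where h: "\<And>k. functional (h k)" "\<And>k x. x \<in> E \<Longrightarrow> AE \<omega> in M. \<bar>h k x \<omega>\<bar> \<le> ?p x \<omega>"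
    "\<And>k. AE \<omega> in M. h k (y k) \<omega> = ?p (y k) \<omega>"
    by metis
  \<comment> \<open>Unlike \<open>sgn\<close>, this sign is never 0, so the new summand keeps its
    full size where the preceding partial sum vanishes.\<close>
  define s where "s = (\<lambda>t::real. if 0 \<le> t then 1 else - 1 :: real)"
  have s: "\<bar>s t\<bar> = 1" for t unfolding s_def by simp
  have sm[measurable]: "s \<in> borel_measurable borel" unfolding s_def by measurable
  \<comment> \<open>The sign of the \<open>k\<close>-th summand is that of the preceding partial sum
    at \<open>y k\<close>, whatever the argument \<open>x\<close>; hence the recursion runs over
    functions of all \<open>x\<close>.\<close>
  define F where "F = rec_nat (\<lambda>x \<omega>. 0) (\<lambda>k Fk x \<omega>. Fk x \<omega> + s (Fk (y k) \<omega>) * (1/3)^k * h k x \<omega>)"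
  define t where "t = (\<lambda>k x \<omega>. s (F k (y k) \<omega>) * (1/3)^k * h k x \<omega>)"
  have F_Suc: "F (Suc k) x \<omega> = F k x \<omega> + t k x \<omega>" and F_0: "F 0 x \<omega> = 0" for k x \<omega>
    unfolding F_def t_def by simp_all
  have F_sum: "F k x \<omega> = (\<Sum>j<k. t j x \<omega>)" for k x \<omega>
    by (induction k) (simp_all add: F_Suc F_0)
  have hm[measurable]: "h k x \<in> borel_measurable M" if "x \<in> E" for k x using functional_meas[OF h(1) that] .
  have Fm[measurable]: "F k x \<in> borel_measurable M" if "x \<in> E" for k x
    using that
  proof (induction k arbitrary: x)
    case 0
    have "F 0 x = (\<lambda>_. 0)" using F_0 by (intro ext) simp
    then show ?case by simp
  next
    case (Suc k)
    have [measurable]: "F k x \<in> borel_measurable M" "F k (y k) \<in> borel_measurable M" "h k x \<in> borel_measurable M"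
      using Suc yE hm by auto
    have "F (Suc k) x = (\<lambda>\<omega>. F k x \<omega> + s (F k (y k) \<omega>) * (1/3)^k * h k x \<omega>)"
      using F_Suc unfolding t_def by (intro ext) simp
    then show ?case by simp
  qed
  have tm: "t k x \<in> borel_measurable M" if "x \<in> E" for k x
  proof -
    have [measurable]: "F k (y k) \<in> borel_measurable M" "h k x \<in> borel_measurable M" using that yE by auto
    show ?thesis unfolding t_def by measurable
  qed
  have tle: "AE \<omega> in M. \<forall>k. \<bar>t k x \<omega>\<bar> \<le> (1/3)^k * ?p x \<omega>" if "x \<in> E" for x
  proof -
    have "AE \<omega> in M. \<forall>k. \<bar>h k x \<omega>\<bar> \<le> ?p x \<omega>" using h(2)[OF that] by (simp add: AE_all_countable)
    then show ?thesis
      by eventually_elim (auto simp: t_def abs_mult s power_divide intro!: mult_left_mono divide_right_mono)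
  qed
  have geo: "(\<lambda>k. (1/3)^(k + n) * c) sums ((1/3)^n * (3/2) * c)" for c :: real and n :: nat
    using sums_mult2[OF sums_mult2[OF geometric_sums[of "1/3 :: real"], of "(1/3)^n"], of c]
    by (simp add: power_add algebra_simps)
  have sum: "summable (\<lambda>k. t (k + n) x \<omega>)" "\<bar>\<Sum>k. t (k + n) x \<omega>\<bar> \<le> (1/3)^n * (3/2) * ?p x \<omega>"
    if le: "\<forall>k. \<bar>t k x \<omega>\<bar> \<le> (1/3)^k * ?p x \<omega>" for x \<omega> n
  proof -
    have 1: "norm (t (k + n) x \<omega>) \<le> (1/3)^(k + n) * ?p x \<omega>" for k using le by simp
    show "summable (\<lambda>k. t (k + n) x \<omega>)"
      by (rule summable_comparison_test'[OF sums_summable[OF geo], where N = 0]) (rule 1)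
    show "\<bar>\<Sum>k. t (k + n) x \<omega>\<bar> \<le> (1/3)^n * (3/2) * ?p x \<omega>"
      using norm_suminf_le[where f = "\<lambda>k. t (k + n) x \<omega>", OF 1 sums_summable[OF geo]] sums_unique[OF geo, of n "?p x \<omega>"]
      by simp
  qed
  define f where "f = (\<lambda>x \<omega>. \<Sum>k. t k x \<omega>)"
  have "functional f"
    unfolding functional_def
  proof (intro conjI ballI)
    show "f x \<in> borel_measurable M" if "x \<in> E" for x
      unfolding f_def using tm[OF that] by measurable
    show "AE \<omega> in M. f (add x z) \<omega> = f x \<omega> + f z \<omega>" if xz: "x \<in> E" "z \<in> E" for x z
    proof -
      have "AE \<omega> in M. \<forall>k. h k (add x z) \<omega> = h k x \<omega> + h k z \<omega>"
        using functional_add[OF h(1) xz] by (simp add: AE_all_countable)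
      then show ?thesis
        using tle[OF xz(1)] tle[OF xz(2)]
      proof eventually_elim
        case (elim \<omega>)
        have "t k (add x z) \<omega> = t k x \<omega> + t k z \<omega>" for k using elim(1) unfolding t_def by (simp add: distrib_left)
        then show ?case
          unfolding f_def using suminf_add[OF sum(1)[OF elim(2), of 0, simplified] sum(1)[OF elim(3), of 0, simplified]]
          by simp
      qed
    qed
    show "AE \<omega> in M. f (rs \<xi> x) \<omega> = \<xi> \<omega> * f x \<omega>" if x: "\<xi> \<in> borel_measurable M" "x \<in> E" for \<xi> x
    proof -
      have "AE \<omega> in M. \<forall>k. h k (rs \<xi> x) \<omega> = \<xi> \<omega> * h k x \<omega>"
        using functional_rs[OF h(1) x] by (simp add: AE_all_countable)
      then show ?thesis
        using tle[OF x(2)]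
      proof eventually_elim
        case (elim \<omega>)
        have "t k (rs \<xi> x) \<omega> = \<xi> \<omega> * t k x \<omega>" for k using elim(1) unfolding t_def by simp
        then show ?case
          unfolding f_def using suminf_mult[OF sum(1)[OF elim(2), of 0, simplified]] by simp
      qed
    qed
  qed
  moreover have "\<forall>x\<in>E. AE \<omega> in M. \<bar>f x \<omega>\<bar> \<le> (3/2) * ?p x \<omega>"
  proof
    fix x assume x: "x \<in> E"
    show "AE \<omega> in M. \<bar>f x \<omega>\<bar> \<le> (3/2) * ?p x \<omega>"
      using tle[OF x]
    proof eventually_elim
      case (elim \<omega>) then show ?case using sum(2)[OF elim, of 0] by (simp add: f_def)
    qed
  qed
  ultimately have f: "cfunctional f" unfolding cfunctional_def using Q by (intro conjI exI[of _ Q] exI[of _ "\<lambda>_. 3/2"])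
  obtain b where b[measurable]: "b \<in> borel_measurable M" and fb: "\<And>k. AE \<omega> in M. \<bar>f (y k) \<omega>\<bar> \<le> b \<omega>"
    using cfunctional_bounded[of f y, OF f y(1)] by blast
  \<comment> \<open>At \<open>y k\<close> the partial sum and the \<open>k\<close>-th summand agree
    in sign, so together they have size at least \<open>(1/3)^k * ?p (y k)\<close>. The ratio 1/3
    makes the remaining tail at most \<open>(1/3)^(k+1) * 3/2\<close> times \<open>?p (y k)\<close>,
    which is half of that.\<close>
  have low: "AE \<omega> in M. (1/2) * (1/3)^k * ?p (y k) \<omega> \<le> b \<omega>" for k
    using tle[OF yE[of k]] h(3)[of k] fb[of k] seminorm_nonneg[OF p yE[of k]]
  proof eventually_elim
    case (elim \<omega>)
    note le = elim(1)
    have "f (y k) \<omega> = (\<Sum>j. t (j + Suc k) (y k) \<omega>) + F (Suc k) (y k) \<omega>"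
      unfolding f_def F_sum using suminf_split_initial_segment[OF sum(1)[OF le, of 0, simplified], of "Suc k"] by simp
    moreover have "\<bar>\<Sum>j. t (j + Suc k) (y k) \<omega>\<bar> \<le> (1/2) * (1/3)^k * ?p (y k) \<omega>"
      using sum(2)[OF le, of "Suc k"] by simp
    moreover have "\<bar>F (Suc k) (y k) \<omega>\<bar> \<ge> (1/3)^k * ?p (y k) \<omega>"
    proof -
      have "0 \<le> (1/3)^k * ?p (y k) \<omega>" using elim by simp
      then show ?thesis unfolding F_Suc t_def s_def using elim(2) by (auto simp: mult.assoc)
    qed
    ultimately show ?case using elim(3) by linarith
  qed
  obtain c where c: "prob {\<omega>\<in>space M. c < b \<omega>} < e" using tight_random_variable[OF b e] .
  obtain k where k: "2 * c < (4/3)^k" using real_arch_pow[of "4/3" "2 * c"] by auto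
  have [measurable]: "?p (y k) \<in> borel_measurable M" using seminorm_meas[OF p yE] .
  have "prob {\<omega>\<in>space M. 4 ^ k < ?p (y k) \<omega>} \<le> prob {\<omega>\<in>space M. c < b \<omega>}"
  proof (rule finite_measure_mono_AE)
    show "AE \<omega> in M. \<omega> \<in> {\<omega>\<in>space M. 4 ^ k < ?p (y k) \<omega>} \<longrightarrow> \<omega> \<in> {\<omega>\<in>space M. c < b \<omega>}"
      using low[of k]
    proof eventually_elim
      case (elim \<omega>)
      have "c < b \<omega>" if "4 ^ k < ?p (y k) \<omega>"
      proof -
        have "(1/3)^k * 4^k < (1/3)^k * ?p (y k) \<omega>" using that by (intro mult_strict_left_mono) auto
        moreover have "(1/3)^k * 4^k = (4/3 :: real)^k" by (simp add: power_mult_distrib[symmetric])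
        ultimately show ?thesis using elim k by simp
      qed
      then show ?case by simp
    qed
  qed measurable
  then show False using c y(2)[of k] by simp
qed

text \<open>The weight is the infimum of \<open>1 / (1 + p x\<^sub>n)\<close> along a sequence in \<open>G\<close> that minimises the
  expectation of \<open>1 / (1 + p x)\<close>.\<close>

lemma weight_exists:
  assumes Q: "Q \<subseteq> PP" "finite Q" "Q \<noteq> {}"
  obtains w where "w \<in> borel_measurable M" "\<And>\<omega>. 0 \<le> w \<omega>" "AE \<omega> in M. 0 < w \<omega>"
    "\<And>x. x \<in> G \<Longrightarrow> AE \<omega> in M. w \<omega> * normQ Q x \<omega> \<le> 1"
proof (cases "G = {}")
  case True
  show ?thesis by (rule that[of "\<lambda>_. 1"]) (use True in auto)
next
  case False
  let ?p = "normQ Q"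
  have p: "seminorm ?p" using Q PP by (intro seminorm_normQ) auto
  have pm[measurable]: "?p x \<in> borel_measurable M" if "x \<in> G" for x using seminorm_meas[OF p G_E[OF that]] .
  define psi where "psi = (\<lambda>x \<omega>. 1 / (1 + \<bar>?p x \<omega>\<bar>))"
  have psim[measurable]: "psi x \<in> borel_measurable M" if "x \<in> G" for x unfolding psi_def using pm[OF that] by measurable
  have psi: "0 < psi x \<omega>" "psi x \<omega> \<le> 1" for x \<omega> unfolding psi_def by (auto simp: add_pos_nonneg)
  have psii: "integrable M (psi x)" if "x \<in> G" for x
    by (rule integrable_const_bound[where B = 1]) (use psi psim that in \<open>auto simp: less_imp_le\<close>)
  define m where "m = (INF x\<in>G. \<integral>\<omega>. psi x \<omega> \<partial>M)"
  have bdd: "bdd_below ((\<lambda>x. \<integral>\<omega>. psi x \<omega> \<partial>M) ` G)"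
    by (rule bdd_belowI2[where m = 0]) (use psi in \<open>auto intro!: Bochner_Integration.integral_nonneg simp: less_imp_le\<close>)
  have m: "m \<le> (\<integral>\<omega>. psi x \<omega> \<partial>M)" if "x \<in> G" for x unfolding m_def by (rule cINF_lower[OF bdd that])
  have "\<exists>x\<in>G. (\<integral>\<omega>. psi x \<omega> \<partial>M) < m + 1 / real (Suc n)" for n
  proof -
    have "m < m + 1 / real (Suc n)" by simp
    then show ?thesis
      using cINF_less_iff[OF False bdd, of "m + 1 / real (Suc n)"] unfolding m_def by blast
  qed
  then obtain x where x: "\<And>n. x n \<in> G" "\<And>n. (\<integral>\<omega>. psi (x n) \<omega> \<partial>M) < m + 1 / real (Suc n)" by metis
  \<comment> \<open>A countable infimum stays measurable; the minimising property of the sequence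
    makes it an almost sure lower bound for \<open>psi z\<close> at every \<open>z\<close> in
    \<open>G\<close>.\<close>
  define w where "w = (\<lambda>\<omega>. INF n. psi (x n) \<omega>)"
  have wbdd: "bdd_below (range (\<lambda>n. psi (x n) \<omega>))" for \<omega>
    by (rule bdd_belowI2[where m = 0]) (use psi in \<open>auto simp: less_imp_le\<close>)
  have wm[measurable]: "w \<in> borel_measurable M"
    unfolding w_def by (rule borel_measurable_cINF) (use wbdd psim x in auto)
  have wle: "w \<omega> \<le> psi (x n) \<omega>" for n \<omega> unfolding w_def by (rule cINF_lower[OF wbdd]) simp
  have wge: "r \<le> w \<omega>" if "\<And>n. r \<le> psi (x n) \<omega>" for r \<omega> unfolding w_def by (rule cINF_greatest) (use that in auto)
  have w0: "0 \<le> w \<omega>" for \<omega> using wge[of 0 \<omega>] psi(1) by (simp add: less_imp_le)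
  have w1: "w \<omega> \<le> 1" for \<omega> using wle[of \<omega> 0] psi(2)[of "x 0" \<omega>] by linarith
  have wpsi: "AE \<omega> in M. w \<omega> \<le> psi z \<omega>" if z: "z \<in> G" for z
  proof -
    have [measurable]: "psi z \<in> borel_measurable M" "\<And>n. psi (x n) \<in> borel_measurable M" using psim z x by auto
    let ?d = "\<lambda>\<omega>. max 0 (w \<omega> - psi z \<omega>)"
    have id: "integrable M ?d"
    proof (rule integrable_const_bound[where B = 1])
      have "norm (?d \<omega>) \<le> 1" for \<omega> using w1[of \<omega>] psi(1)[of z \<omega>] by simp
      then show "AE \<omega> in M. norm (?d \<omega>) \<le> 1" by simp
    qed measurable
    \<comment> \<open>Passing from \<open>x n\<close> to its join \<open>c\<close> with
      \<open>z\<close> lowers the expectation of \<open>psi\<close> by at most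
      \<open>1 / real (Suc n)\<close>, since \<open>m\<close> is the infimum, but lowers
      \<open>psi\<close> itself by at least the excess of \<open>w\<close> over
      \<open>psi z\<close>.\<close>
    have le: "(\<integral>\<omega>. ?d \<omega> \<partial>M) \<le> 1 / real (Suc n)" for n
    proof -
      obtain c where c: "c \<in> G" "AE \<omega> in M. ?p c \<omega> = max (?p z \<omega>) (?p (x n) \<omega>)"
        using seminorm_directed[OF p z x(1)] by blast
      have "AE \<omega> in M. ?d \<omega> \<le> psi (x n) \<omega> - psi c \<omega>"
        using c(2) seminorm_nonneg[OF p G_E[OF z]] seminorm_nonneg[OF p G_E[OF x(1)[of n]]]
      proof eventually_elim
        case (elim \<omega>)
        have "psi c \<omega> \<le> psi z \<omega>" "psi c \<omega> \<le> psi (x n) \<omega>"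
          using elim unfolding psi_def by (auto intro!: divide_left_mono)
        then show ?case using wle[of \<omega> n] by simp
      qed
      then have "(\<integral>\<omega>. ?d \<omega> \<partial>M) \<le> (\<integral>\<omega>. psi (x n) \<omega> - psi c \<omega> \<partial>M)"
        using id psii x c by (intro integral_mono_AE) auto
      also have "\<dots> \<le> 1 / real (Suc n)"
        using x(2)[of n] m[OF c(1)] psii[OF x(1)] psii[OF c(1)] by simp
      finally show ?thesis .
    qed
    have "(\<integral>\<omega>. ?d \<omega> \<partial>M) \<le> 0"
      by (rule LIMSEQ_le_const[OF LIMSEQ_inverse_real_of_nat]) (use le in \<open>auto simp: inverse_eq_divide\<close>)
    moreover have nn: "AE \<omega> in M. 0 \<le> ?d \<omega>" by simp
    ultimately have "(\<integral>\<omega>. ?d \<omega> \<partial>M) = 0" using integral_nonneg_AE[OF nn] by linarith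
    then have "AE \<omega> in M. ?d \<omega> = 0" using integral_nonneg_eq_0_iff_AE[OF id nn] by simp
    then show ?thesis by eventually_elim (simp add: max_def split: if_splits)
  qed
  \<comment> \<open>Where \<open>w\<close> vanishes, the values \<open>?p (x n)\<close> exceed every
    level. Finitely many of them are dominated by the value at one point of \<open>G\<close>, so
    boundedness in probability gives a bound uniform in their number, and continuity from below
    extends it to the whole sequence.\<close>
  have pz: "prob {\<omega>\<in>space M. w \<omega> \<le> 0} \<le> e" if e: "0 < e" for e
  proof -
    obtain c' where c': "\<And>x. x \<in> G \<Longrightarrow> prob {\<omega>\<in>space M. c' < ?p x \<omega>} \<le> e"
      using normQ_bounded_in_probability[OF Q e] by blast
    define c where "c = max 0 c'"
    let ?A = "\<lambda>N. {\<omega>\<in>space M. \<exists>n\<in>{..N::nat}. c < \<bar>?p (x n) \<omega>\<bar>}"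
    have [measurable]: "?p (x n) \<in> borel_measurable M" for n using pm x by auto
    have pA: "prob (?A N) \<le> e" for N
    proof -
      have "\<exists>z\<in>G. \<forall>y\<in>x ` {..N}. AE \<omega> in M. ?p y \<omega> \<le> ?p z \<omega>"
        by (rule directed_finite[OF seminorm_directed[OF p]]) (use x(1) in auto)
      then obtain z where z: "z \<in> G" "\<forall>y\<in>x ` {..N}. AE \<omega> in M. ?p y \<omega> \<le> ?p z \<omega>" by blast
      have [measurable]: "?p z \<in> borel_measurable M" using pm z by auto
      have "AE \<omega> in M. \<forall>n\<in>{..N}. ?p (x n) \<omega> \<le> ?p z \<omega>" using z(2) by (intro AE_finite_allI) auto
      moreover have "AE \<omega> in M. \<forall>n\<in>{..N}. 0 \<le> ?p (x n) \<omega>"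
        using seminorm_nonneg[OF p G_E[OF x(1)]] by (intro AE_finite_allI) auto
      ultimately have "AE \<omega> in M. \<omega> \<in> ?A N \<longrightarrow> \<omega> \<in> {\<omega>\<in>space M. c' < ?p z \<omega>}"
      proof eventually_elim
        case (elim \<omega>)
        have "c' < ?p z \<omega>" if "n \<le> N" "c < \<bar>?p (x n) \<omega>\<bar>" for n
        proof -
          have "?p (x n) \<omega> \<le> ?p z \<omega>" "0 \<le> ?p (x n) \<omega>" using elim that(1) by auto
          then show ?thesis using that(2) unfolding c_def by linarith
        qed
        then show ?case by auto
      qed
      then have "prob (?A N) \<le> prob {\<omega>\<in>space M. c' < ?p z \<omega>}"
        by (rule finite_measure_mono_AE) measurable
      then show ?thesis using c'[OF z(1)] by simp
    qed
    have "(\<lambda>N. prob (?A N)) \<longlonglongrightarrow> prob (\<Union>N. ?A N)"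
      by (rule finite_Lim_measure_incseq) (fastforce simp: incseq_def)+
    then have "prob (\<Union>N. ?A N) \<le> e"
      by (rule LIMSEQ_le_const2) (use pA in auto)
    moreover have "prob {\<omega>\<in>space M. w \<omega> \<le> 0} \<le> prob (\<Union>N. ?A N)"
    proof (rule finite_measure_mono)
      show "{\<omega>\<in>space M. w \<omega> \<le> 0} \<subseteq> (\<Union>N. ?A N)"
      proof safe
        fix \<omega> assume \<omega>: "\<omega> \<in> space M" "w \<omega> \<le> 0"
        have "\<exists>n. c < \<bar>?p (x n) \<omega>\<bar>"
        proof (rule ccontr)
          assume "\<not> ?thesis"
          then have "\<bar>?p (x n) \<omega>\<bar> \<le> c" for n by (simp add: not_less)
          then have "1 / (1 + c) \<le> psi (x n) \<omega>" for n
            unfolding psi_def by (intro frac_le) (auto simp: add_pos_nonneg)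
          then have "1 / (1 + c) \<le> w \<omega>" by (rule wge)
          moreover have "0 < 1 / (1 + c)" unfolding c_def by simp
          ultimately show False using \<omega> by linarith
        qed
        then show "\<omega> \<in> (\<Union>N. ?A N)" using \<omega> by blast
      qed
    qed measurable
    ultimately show ?thesis by simp
  qed
  then have "prob {\<omega>\<in>space M. w \<omega> \<le> 0} \<le> 0" by (rule field_le_epsilon[of _ 0, simplified])
  then have "prob {\<omega>\<in>space M. w \<omega> \<le> 0} = 0" by (simp add: measure_le_0_iff)
  then have "AE \<omega> in M. \<not> w \<omega> \<le> 0" by (subst (asm) prob_eq_0) auto
  then have wpos: "AE \<omega> in M. 0 < w \<omega>" by eventually_elim simp
  show ?thesis
  proof (rule that[OF wm w0 wpos])
    fix z assume z: "z \<in> G"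
    show "AE \<omega> in M. w \<omega> * ?p z \<omega> \<le> 1"
      using wpsi[OF z]
    proof eventually_elim
      case (elim \<omega>)
      have "w \<omega> * ?p z \<omega> \<le> w \<omega> * \<bar>?p z \<omega>\<bar>" using w0 by (intro mult_left_mono) auto
      also have "\<dots> \<le> psi z \<omega> * \<bar>?p z \<omega>\<bar>" using elim by (intro mult_right_mono) auto
      also have "\<dots> \<le> 1" unfolding psi_def by (rule weight_le_one) simp
      finally show ?case .
    qed
  qed
qed

end

section \<open>Maximal families of convex sets\<close>

lemma maximal_fip_family:
  assumes P_Int: "\<And>A B. P A \<Longrightarrow> P B \<Longrightarrow> P (A \<inter> B)"
    and F: "\<And>A. A \<in> F \<Longrightarrow> P A" "fip F" "F \<noteq> {}"
  obtains U where "F \<subseteq> U" "\<And>A. A \<in> U \<Longrightarrow> P A" "\<And>A. A \<in> U \<Longrightarrow> A \<noteq> {}"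
    "\<And>A B. A \<in> U \<Longrightarrow> B \<in> U \<Longrightarrow> A \<inter> B \<in> U"
    "\<And>C. P C \<Longrightarrow> (\<And>A. A \<in> U \<Longrightarrow> C \<inter> A \<noteq> {}) \<Longrightarrow> C \<in> U"
proof -
  define W where "W = {U. F \<subseteq> U \<and> (\<forall>A\<in>U. P A) \<and> fip U}"
  have "\<exists>U\<in>W. \<forall>X\<in>W. U \<subseteq> X \<longrightarrow> X = U"
  proof (rule subset_Zorn_nonempty)
    show "W \<noteq> {}" using F unfolding W_def by auto
    fix K assume K: "K \<noteq> {}" "subset.chain W K"
    then have KW: "\<And>U. U \<in> K \<Longrightarrow> U \<in> W" unfolding subset.chain_def by blast
    have "fip (\<Union>K)"
      unfolding fip_def
    proof (intro allI impI)
      fix H assume H: "H \<subseteq> \<Union>K \<and> finite H \<and> H \<noteq> {}"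
      then obtain U where "U \<in> K" "H \<subseteq> U" using finite_subset_Union_chain[of H K W] K by blast
      then show "\<Inter>H \<noteq> {}" using KW H unfolding W_def fip_def by blast
    qed
    then show "\<Union>K \<in> W" using KW K(1) unfolding W_def by blast
  qed
  then obtain U where U: "U \<in> W" "\<And>X. X \<in> W \<Longrightarrow> U \<subseteq> X \<Longrightarrow> X = U" by blast
  have FU: "F \<subseteq> U" and PU: "\<And>A. A \<in> U \<Longrightarrow> P A" and fU: "fip U" using U(1) unfolding W_def by auto
  have ne: "A \<noteq> {}" if "A \<in> U" for A
    using fU[unfolded fip_def, rule_format, of "{A}"] that by simp
  have ins: "C \<in> U" if C: "P C" and fC: "fip (insert C U)" for C
  proof -
    have "insert C U \<in> W" using FU PU C fC unfolding W_def by auto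
    then have "insert C U = U" by (rule U(2)) auto
    then show ?thesis by blast
  qed
  have Int: "A \<inter> B \<in> U" if AB: "A \<in> U" "B \<in> U" for A B
  proof (rule ins)
    show "P (A \<inter> B)" using P_Int PU AB by blast
    show "fip (insert (A \<inter> B) U)"
      unfolding fip_def
    proof (intro allI impI)
      fix H assume H: "H \<subseteq> insert (A \<inter> B) U \<and> finite H \<and> H \<noteq> {}"
      let ?H = "(H - {A \<inter> B}) \<union> {A, B}"
      have "\<Inter>?H \<noteq> {}" by (rule fU[unfolded fip_def, rule_format]) (use H AB in auto)
      moreover have "\<Inter>?H \<subseteq> \<Inter>H" by auto
      ultimately show "\<Inter>H \<noteq> {}" by blast
    qed
  qed
  have finInt: "\<Inter>H \<in> U" if "finite H" "H \<noteq> {}" "H \<subseteq> U" for H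
    using that by (induction rule: finite_ne_induct) (auto intro: Int)
  show ?thesis
  proof (rule that[OF FU PU ne Int])
    fix C assume C: "P C" and meet: "\<And>A. A \<in> U \<Longrightarrow> C \<inter> A \<noteq> {}"
    show "C \<in> U"
    proof (rule ins[OF C])
      show "fip (insert C U)"
        unfolding fip_def
      proof (intro allI impI)
        fix H assume H: "H \<subseteq> insert C U \<and> finite H \<and> H \<noteq> {}"
        \<comment> \<open>An extra member covers the case \<open>H = {C}\<close>, in which no member
          of \<open>U\<close> would remain to be intersected with \<open>C\<close>.\<close>
        obtain A where A: "A \<in> U" using F(3) FU by blast
        have "\<Inter>(insert A (H - {C})) \<in> U" by (rule finInt) (use H A in auto)
        then have "C \<inter> \<Inter>(insert A (H - {C})) \<noteq> {}" by (rule meet)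
        moreover have "C \<inter> \<Inter>(insert A (H - {C})) \<subseteq> \<Inter>H" by auto
        ultimately show "\<Inter>H \<noteq> {}" by blast
      qed
    qed
  qed auto
qed

lemma (in prob_space) AE_summable_geometric:
  fixes u :: "nat \<Rightarrow> 'a \<Rightarrow> real"
  assumes u: "\<And>m. integrable M (u m)" and le: "\<And>m. (\<integral>\<omega>. \<bar>u m \<omega>\<bar> \<partial>M) \<le> (1/2)^m"
  shows "AE \<omega> in M. summable (\<lambda>m. \<bar>u m \<omega>\<bar>)"
proof -
  have [measurable]: "u m \<in> borel_measurable M" for m using u by simp
  have "(\<integral>\<^sup>+\<omega>. (\<Sum>m. ennreal \<bar>u m \<omega>\<bar>) \<partial>M) = (\<Sum>m. \<integral>\<^sup>+\<omega>. ennreal \<bar>u m \<omega>\<bar> \<partial>M)"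
    by (rule nn_integral_suminf) measurable
  also have "\<dots> = (\<Sum>m. ennreal (\<integral>\<omega>. \<bar>u m \<omega>\<bar> \<partial>M))"
    using u by (intro suminf_cong nn_integral_eq_integral) auto
  also have "\<dots> \<le> (\<Sum>m. ennreal ((1/2)^m))"
    using le by (intro suminf_le ennreal_leI) auto
  also have "\<dots> = ennreal (\<Sum>m. (1/2)^m)" by (intro suminf_ennreal2) (auto simp: summable_geometric)
  also have "\<dots> < \<infinity>" by simp
  finally have "AE \<omega> in M. (\<Sum>m. ennreal \<bar>u m \<omega>\<bar>) \<noteq> \<infinity>" by (intro nn_integral_PInf_AE) auto
  then show ?thesis by eventually_elim (rule summable_suminf_not_top, auto)
qed

section \<open>Hilbert space geometry of the values of bounded functionals\<close>

context L0_convexly_compact_set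
begin

abbreviation "mcomb t x y \<equiv> add (rs (\<lambda>_. t) x) (rs (\<lambda>_. 1 - t) y)"

lemma mconvexD:
  "mconvex add smul C \<Longrightarrow> x \<in> C \<Longrightarrow> y \<in> C \<Longrightarrow> 0 \<le> t \<Longrightarrow> t \<le> 1 \<Longrightarrow> mcomb t x y \<in> C"
  unfolding mconvex_def by blast

lemma mcomb_G: "x \<in> G \<Longrightarrow> y \<in> G \<Longrightarrow> 0 \<le> t \<Longrightarrow> t \<le> 1 \<Longrightarrow> mcomb t x y \<in> G"
  by (rule G_comb) auto

lemma mconvex_G: "mconvex add smul G"
  unfolding mconvex_def using mcomb_G by blast

definition unit_functional :: "('e \<Rightarrow> 'w \<Rightarrow> real) \<Rightarrow> bool" where
  "unit_functional f \<longleftrightarrow> cfunctional f \<and> (\<forall>x\<in>G. AE \<omega> in M. \<bar>f x \<omega>\<bar> \<le> 1)"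

lemma unit_functionalD:
  assumes "unit_functional f"
  shows "cfunctional f" "functional f" "x \<in> G \<Longrightarrow> f x \<in> borel_measurable M"
    "x \<in> G \<Longrightarrow> AE \<omega> in M. \<bar>f x \<omega>\<bar> \<le> 1"
  using assms cfunctional_functional functional_meas G_E unfolding unit_functional_def by auto

lemma bounded_sq_integrable:
  assumes [measurable]: "a \<in> borel_measurable M" "b \<in> borel_measurable M"
    and ab: "AE \<omega> in M. \<bar>a \<omega>\<bar> \<le> 1" "AE \<omega> in M. \<bar>b \<omega>\<bar> \<le> (1::real)"
  shows "integrable M (\<lambda>\<omega>. (a \<omega> - b \<omega>)\<^sup>2)" "AE \<omega> in M. (a \<omega> - b \<omega>)\<^sup>2 \<le> 4"
proof -
  show 1: "AE \<omega> in M. (a \<omega> - b \<omega>)\<^sup>2 \<le> 4"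
    using ab
  proof eventually_elim
    case (elim \<omega>)
    then have "\<bar>a \<omega> - b \<omega>\<bar> \<le> 2" by linarith
    then have "\<bar>a \<omega> - b \<omega>\<bar>\<^sup>2 \<le> 2\<^sup>2" by (intro power_mono) auto
    then show ?case by simp
  qed
  show "integrable M (\<lambda>\<omega>. (a \<omega> - b \<omega>)\<^sup>2)"
    by (rule integrable_const_bound[where B = 4]) (use 1 in auto)
qed

text \<open>The identity serves twice: with \<open>a = f z\<close> it gives the convexity of balls,
  with \<open>a = 0\<close> and \<open>t = 1/2\<close> the parallelogram law.\<close>

lemma sq_dist_mcomb:
  assumes f: "unit_functional f" and x: "x \<in> G" "y \<in> G" and t: "0 \<le> t" "t \<le> 1"
    and a: "a \<in> borel_measurable M" "AE \<omega> in M. \<bar>a \<omega>\<bar> \<le> 1"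
  shows "(\<integral>\<omega>. (f (mcomb t x y) \<omega> - a \<omega>)\<^sup>2 \<partial>M)
    = t * (\<integral>\<omega>. (f x \<omega> - a \<omega>)\<^sup>2 \<partial>M) + (1 - t) * (\<integral>\<omega>. (f y \<omega> - a \<omega>)\<^sup>2 \<partial>M)
      - t * (1 - t) * (\<integral>\<omega>. (f x \<omega> - f y \<omega>)\<^sup>2 \<partial>M)"
proof -
  note fm = unit_functionalD(3,4)[OF f]
  have c: "mcomb t x y \<in> G" using mcomb_G x t by blast
  note [measurable] = fm(1)[OF x(1)] fm(1)[OF x(2)] fm(1)[OF c] a(1)
  have "(\<integral>\<omega>. (f (mcomb t x y) \<omega> - a \<omega>)\<^sup>2 \<partial>M)
    = (\<integral>\<omega>. t * (f x \<omega> - a \<omega>)\<^sup>2 + (1 - t) * (f y \<omega> - a \<omega>)\<^sup>2 - t * (1 - t) * (f x \<omega> - f y \<omega>)\<^sup>2 \<partial>M)"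
  proof (rule integral_cong_AE)
    show "AE \<omega> in M. (f (mcomb t x y) \<omega> - a \<omega>)\<^sup>2
      = t * (f x \<omega> - a \<omega>)\<^sup>2 + (1 - t) * (f y \<omega> - a \<omega>)\<^sup>2 - t * (1 - t) * (f x \<omega> - f y \<omega>)\<^sup>2"
      using functional_comb[OF unit_functionalD(2)[OF f] borel_measurable_const G_E[OF x(1)] G_E[OF x(2)], of t]
    proof eventually_elim
      case (elim \<omega>)
      have "(t * X + (1 - t) * Y - A)\<^sup>2 = t * (X - A)\<^sup>2 + (1 - t) * (Y - A)\<^sup>2 - t * (1 - t) * (X - Y)\<^sup>2"
        for X Y A :: real
        by (simp add: power2_eq_square algebra_simps)
      then show ?case unfolding elim .
    qed
  qed measurable
  also have "\<dots> = t * (\<integral>\<omega>. (f x \<omega> - a \<omega>)\<^sup>2 \<partial>M) + (1 - t) * (\<integral>\<omega>. (f y \<omega> - a \<omega>)\<^sup>2 \<partial>M)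
      - t * (1 - t) * (\<integral>\<omega>. (f x \<omega> - f y \<omega>)\<^sup>2 \<partial>M)"
    using bounded_sq_integrable(1)[OF fm(1)[OF x(1)] a(1) fm(2)[OF x(1)] a(2)]
      bounded_sq_integrable(1)[OF fm(1)[OF x(2)] a(1) fm(2)[OF x(2)] a(2)]
      bounded_sq_integrable(1)[OF fm(1)[OF x(1)] fm(1)[OF x(2)] fm(2)[OF x(1)] fm(2)[OF x(2)]]
    by simp
  finally show ?thesis .
qed

text \<open>The squared \<open>L^2\<close> pseudo-distance that \<open>f\<close> induces on
  \<open>G\<close>. Keeping the square avoids roots, at the price of factors 2 in the triangle
  inequality.\<close>

definition sq_dist :: "('e \<Rightarrow> 'w \<Rightarrow> real) \<Rightarrow> 'e \<Rightarrow> 'e \<Rightarrow> real" where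
  "sq_dist f x y = (\<integral>\<omega>. (f x \<omega> - f y \<omega>)\<^sup>2 \<partial>M)"

lemma sq_dist_nonneg: "0 \<le> sq_dist f x y"
  unfolding sq_dist_def by simp

lemma mconvex_sq_dist_ball:
  assumes f: "unit_functional f" and z: "z \<in> G"
  shows "mconvex add smul {x\<in>G. sq_dist f x z \<le> e}"
  unfolding mconvex_def
proof (intro ballI allI impI)
  fix x y and t :: real assume x: "x \<in> {x\<in>G. sq_dist f x z \<le> e}" and y: "y \<in> {x\<in>G. sq_dist f x z \<le> e}" and t: "0 \<le> t \<and> t \<le> 1"
  have "sq_dist f (mcomb t x y) z \<le> t * sq_dist f x z + (1 - t) * sq_dist f y z"
    unfolding sq_dist_def
    using sq_dist_mcomb[OF f, of x y t "f z"] x y t z unit_functionalD(3,4)[OF f] by simp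
  also have "\<dots> \<le> t * e + (1 - t) * e" using x y t by (intro add_mono mult_left_mono) auto
  finally have "sq_dist f (mcomb t x y) z \<le> e" by (simp add: algebra_simps)
  then show "mcomb t x y \<in> {x\<in>G. sq_dist f x z \<le> e}" using mcomb_G x y t by simp
qed

text \<open>The elementary bound of a number \<open>u\<close> by \<open>(al + u^2 / al) / 2\<close>
  takes the place of the Cauchy-Schwarz inequality.\<close>

lemma L1_le_of_sq_dist:
  assumes f: "unit_functional f" and x: "x \<in> G" "y \<in> G" and al: "0 < al" and D: "sq_dist f x y \<le> al\<^sup>2"
  shows "integrable M (\<lambda>\<omega>. f x \<omega> - f y \<omega>)" "(\<integral>\<omega>. \<bar>f x \<omega> - f y \<omega>\<bar> \<partial>M) \<le> al"
proof -
  note fm = unit_functionalD(3,4)[OF f]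
  note [measurable] = fm(1)[OF x(1)] fm(1)[OF x(2)]
  show i: "integrable M (\<lambda>\<omega>. f x \<omega> - f y \<omega>)"
    by (rule integrable_const_bound[where B = 2])
      (use fm(2)[OF x(1)] fm(2)[OF x(2)] in \<open>eventually_elim, simp\<close>, measurable)
  have sq: "integrable M (\<lambda>\<omega>. (f x \<omega> - f y \<omega>)\<^sup>2)"
    using bounded_sq_integrable(1)[OF fm(1)[OF x(1)] fm(1)[OF x(2)] fm(2)[OF x(1)] fm(2)[OF x(2)]] .
  have "(\<integral>\<omega>. \<bar>f x \<omega> - f y \<omega>\<bar> \<partial>M) \<le> (\<integral>\<omega>. (al + (f x \<omega> - f y \<omega>)\<^sup>2 / al) / 2 \<partial>M)"
  proof (rule integral_mono)
    fix \<omega>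
    have "0 \<le> (al - \<bar>f x \<omega> - f y \<omega>\<bar>)\<^sup>2" by simp
    then have "2 * al * \<bar>f x \<omega> - f y \<omega>\<bar> \<le> al * al + (f x \<omega> - f y \<omega>)\<^sup>2"
      by (simp add: power2_diff power2_eq_square[of al])
    then show "\<bar>f x \<omega> - f y \<omega>\<bar> \<le> (al + (f x \<omega> - f y \<omega>)\<^sup>2 / al) / 2" using al by (simp add: field_simps)
  qed (use i sq in auto)
  also have "\<dots> = (al + sq_dist f x y / al) / 2" using sq unfolding sq_dist_def by (simp add: prob_space)
  also have "\<dots> \<le> (al + al\<^sup>2 / al) / 2" using D al by (intro divide_right_mono add_left_mono) auto
  also have "\<dots> = al" using al by (simp add: power2_eq_square)
  finally show "(\<integral>\<omega>. \<bar>f x \<omega> - f y \<omega>\<bar> \<partial>M) \<le> al" .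
qed

lemma sq_dist_triangle:
  assumes f: "unit_functional f" and x: "x \<in> G" "y \<in> G" "z \<in> G"
  shows "sq_dist f y z \<le> 2 * sq_dist f x y + 2 * sq_dist f x z"
proof -
  note fm = unit_functionalD(3,4)[OF f]
  have i: "integrable M (\<lambda>\<omega>. (f u \<omega> - f v \<omega>)\<^sup>2)" if "u \<in> G" "v \<in> G" for u v
    using bounded_sq_integrable(1)[OF fm(1) fm(1) fm(2) fm(2)] that by blast
  have "sq_dist f y z \<le> (\<integral>\<omega>. 2 * (f x \<omega> - f y \<omega>)\<^sup>2 + 2 * (f x \<omega> - f z \<omega>)\<^sup>2 \<partial>M)"
    unfolding sq_dist_def
  proof (rule integral_mono)
    fix \<omega>
    \<comment> \<open>This square is the term dropped from the parallelogram law for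
      \<open>f x - f y\<close> and \<open>f x - f z\<close>.\<close>
    have "0 \<le> (2 * f x \<omega> - f y \<omega> - f z \<omega>)\<^sup>2" by simp
    then show "(f y \<omega> - f z \<omega>)\<^sup>2 \<le> 2 * (f x \<omega> - f y \<omega>)\<^sup>2 + 2 * (f x \<omega> - f z \<omega>)\<^sup>2"
      by (simp add: power2_eq_square algebra_simps)
  qed (use i x in auto)
  then show ?thesis unfolding sq_dist_def using i x by simp
qed

lemma sq_dist_zero:
  assumes f: "unit_functional f" and x: "x \<in> G" "y \<in> G" and D: "sq_dist f x y \<le> 0"
  shows "AE \<omega> in M. f x \<omega> = f y \<omega>"
proof -
  note fm = unit_functionalD(3,4)[OF f]
  have "integrable M (\<lambda>\<omega>. (f x \<omega> - f y \<omega>)\<^sup>2)"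
    using bounded_sq_integrable(1)[OF fm(1) fm(1) fm(2) fm(2)] x by blast
  then have "AE \<omega> in M. (f x \<omega> - f y \<omega>)\<^sup>2 = 0"
    using D sq_dist_nonneg[of f x y] unfolding sq_dist_def by (subst integral_nonneg_eq_0_iff_AE[symmetric]) auto
  then show ?thesis by eventually_elim simp
qed

end

section \<open>Limits along a maximal family of convex sets\<close>

locale maximal_convex_family = L0_convexly_compact_set M E add smul th PP G for M :: "'w measure" and E :: "'e set"
    and add and smul :: "('w \<Rightarrow> 'k::real_normed_field) \<Rightarrow> 'e \<Rightarrow> 'e" and th and PP and G +
  fixes U :: "'e set set"
  assumes U_ne: "U \<noteq> {}" and U_sub: "A \<in> U \<Longrightarrow> A \<subseteq> G" and U_convex: "A \<in> U \<Longrightarrow> mconvex add smul A"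
    and U_nonempty: "A \<in> U \<Longrightarrow> A \<noteq> {}" and U_Int: "A \<in> U \<Longrightarrow> B \<in> U \<Longrightarrow> A \<inter> B \<in> U"
    and U_max: "C \<subseteq> G \<Longrightarrow> mconvex add smul C \<Longrightarrow> (\<And>A. A \<in> U \<Longrightarrow> C \<inter> A \<noteq> {}) \<Longrightarrow> C \<in> U"
begin

text \<open>By maximality the almost-minimisers of the convex function \<open>\<Sum>f. E (f x)\<^sup>2\<close> form a member of
  the family; the parallelogram identity makes it small in \<open>L\<^sup>2\<close> with respect to each \<open>f\<close>.\<close>

lemma small_member:
  assumes F: "finite F" "\<And>f. f \<in> F \<Longrightarrow> unit_functional f" and e: "0 < e"
  shows "\<exists>T\<in>U. \<forall>x\<in>T. \<forall>y\<in>T. \<forall>f\<in>F. sq_dist f x y \<le> e"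
proof -
  define Phi where "Phi = (\<lambda>x. \<Sum>f\<in>F. \<integral>\<omega>. (f x \<omega> - 0)\<^sup>2 \<partial>M)"
  have Phi0: "0 \<le> Phi x" for x unfolding Phi_def by (intro sum_nonneg) simp
  have Phi1: "Phi x \<le> real (card F)" if x: "x \<in> G" for x
  proof -
    have "(\<integral>\<omega>. (f x \<omega> - 0)\<^sup>2 \<partial>M) \<le> (\<integral>\<omega>. 1 \<partial>M)" if "f \<in> F" for f
    proof (rule integral_mono_AE)
      note fm = unit_functionalD(3,4)[OF F(2)[OF that] x]
      show "integrable M (\<lambda>\<omega>. (f x \<omega> - 0)\<^sup>2)"
        by (rule bounded_sq_integrable(1)[OF fm(1) _ fm(2)]) auto
      show "AE \<omega> in M. (f x \<omega> - 0)\<^sup>2 \<le> 1"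
        using fm(2) by eventually_elim (simp add: abs_square_le_1)
    qed simp
    then have "Phi x \<le> (\<Sum>f\<in>F. 1)" unfolding Phi_def by (intro sum_mono) (simp add: prob_space)
    then show ?thesis by simp
  qed
  have mid: "Phi (mcomb t x y) = t * Phi x + (1 - t) * Phi y - t * (1 - t) * (\<Sum>f\<in>F. sq_dist f x y)"
    if "x \<in> G" "y \<in> G" "0 \<le> t" "t \<le> 1" for x y t
  proof -
    have "Phi (mcomb t x y) = (\<Sum>f\<in>F. t * (\<integral>\<omega>. (f x \<omega> - 0)\<^sup>2 \<partial>M) + (1 - t) * (\<integral>\<omega>. (f y \<omega> - 0)\<^sup>2 \<partial>M)
        - t * (1 - t) * sq_dist f x y)"
      unfolding Phi_def sq_dist_def
      by (intro sum.cong refl sq_dist_mcomb F that) auto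
    then show ?thesis unfolding Phi_def by (simp add: sum.distrib sum_subtractf sum_distrib_left)
  qed
  define mu where "mu = (\<lambda>A. INF x\<in>A. Phi x)"
  have mu_le: "mu A \<le> Phi x" if "x \<in> A" for A x
    unfolding mu_def by (rule cINF_lower[OF bdd_belowI2[OF Phi0] that])
  \<comment> \<open>\<open>c\<close> is the critical level of \<open>Phi\<close> along the family:
    some member has infimum just below \<open>c\<close>, and the sublevel set just above
    \<open>c\<close> meets every member. The margins \<open>e / 8\<close> on both sides leave a gap
    of \<open>e / 4\<close>, which the midpoint coefficient 1/4 turns into \<open>e\<close>.\<close>
  define c where "c = (SUP A\<in>U. mu A)"
  have mu_card: "mu A \<le> real (card F)" if A: "A \<in> U" for A
  proof -
    obtain x where x: "x \<in> A" using U_nonempty[OF A] by blast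
    then have "x \<in> G" using U_sub[OF A] by blast
    then show ?thesis using mu_le[OF x] Phi1[of x] by linarith
  qed
  have mu_c: "mu A \<le> c" if "A \<in> U" for A
    unfolding c_def by (rule cSUP_upper[OF that bdd_aboveI2[OF mu_card]])
  have "bdd_above (mu ` U)" by (rule bdd_aboveI2[OF mu_card])
  then have "(c - e / 8 < c) = (\<exists>A\<in>U. c - e / 8 < mu A)" unfolding c_def by (rule less_cSUP_iff[OF U_ne])
  then obtain A where A: "A \<in> U" "c - e / 8 < mu A" using e by auto
  let ?S = "{x\<in>G. Phi x \<le> c + e / 8}"
  have "?S \<in> U"
  proof (rule U_max)
    show "mconvex add smul ?S"
      unfolding mconvex_def
    proof (intro ballI allI impI)
      fix x y and t :: real assume x: "x \<in> ?S" and y: "y \<in> ?S" and t: "0 \<le> t \<and> t \<le> 1"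
      have "0 \<le> t * (1 - t) * (\<Sum>f\<in>F. sq_dist f x y)"
        using t by (intro mult_nonneg_nonneg sum_nonneg sq_dist_nonneg) auto
      then have "Phi (mcomb t x y) \<le> t * Phi x + (1 - t) * Phi y" using mid x y t by simp
      also have "\<dots> \<le> t * (c + e / 8) + (1 - t) * (c + e / 8)" using x y t by (intro add_mono mult_left_mono) auto
      also have "\<dots> = c + e / 8" unfolding distrib_right[symmetric] by simp
      finally have "Phi (mcomb t x y) \<le> c + e / 8" .
      then show "mcomb t x y \<in> ?S" using mcomb_G x y t by simp
    qed
    fix B assume B: "B \<in> U"
    have "bdd_below (Phi ` B)" by (rule bdd_belowI2[OF Phi0])
    then have "mu B < c + e / 8 \<longleftrightarrow> (\<exists>x\<in>B. Phi x < c + e / 8)"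
      unfolding mu_def by (rule cINF_less_iff[OF U_nonempty[OF B]])
    then obtain x where "x \<in> B" "Phi x < c + e / 8" using mu_c[OF B] e by auto
    then show "?S \<inter> B \<noteq> {}" using U_sub[OF B] by (auto simp: less_imp_le)
  qed auto
  then have T: "A \<inter> ?S \<in> U" using A(1) U_Int by blast
  have "sq_dist f x y \<le> e" if x: "x \<in> A \<inter> ?S" and y: "y \<in> A \<inter> ?S" and f: "f \<in> F" for x y f
  proof -
    have "mcomb (1/2) x y \<in> A" by (rule mconvexD[OF U_convex[OF A(1)]]) (use x y in auto)
    then have "c - e / 8 < Phi (mcomb (1/2) x y)" using mu_le A(2) by fastforce
    also have "\<dots> = 1/2 * Phi x + (1 - 1/2) * Phi y - 1/2 * (1 - 1/2) * (\<Sum>f\<in>F. sq_dist f x y)"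
      using x y by (intro mid) auto
    finally have "(\<Sum>f\<in>F. sq_dist f x y) < e" using x y by simp
    moreover have "sq_dist f x y \<le> (\<Sum>f\<in>F. sq_dist f x y)"
      using F(1) f sq_dist_nonneg by (intro member_le_sum) auto
    ultimately show ?thesis by simp
  qed
  then show ?thesis using T by blast
qed

text \<open>Points taken from finite intersections of shrinking members have almost surely
  convergent images under each \<open>f\<close> in \<open>F\<close>, although the points themselves
  need not converge. Strips around \<open>f (x k)\<close> whose random width is the tail of the
  increments hold a late \<open>x N\<close> in any finite selection, so compactness provides a point
  \<open>z\<close> that attains all the limits.\<close>

lemma common_limit:
  assumes F: "finite F" "\<And>f. f \<in> F \<Longrightarrow> unit_functional f"
  shows "\<exists>z\<in>G. \<forall>f\<in>F. \<forall>e>0. {x\<in>G. sq_dist f x z \<le> e} \<in> U"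
proof -
  \<comment> \<open>The square makes the \<open>L^1\<close> distance of consecutive points at most
    \<open>(1/2)^m\<close>, which is summable.\<close>
  have "\<exists>T\<in>U. \<forall>x\<in>T. \<forall>y\<in>T. \<forall>f\<in>F. sq_dist f x y \<le> ((1/2)^m)\<^sup>2" for m :: nat
    by (rule small_member[OF F]) auto
  then obtain T where T: "\<And>m. T m \<in> U"
    "\<And>m x y f. x \<in> T m \<Longrightarrow> y \<in> T m \<Longrightarrow> f \<in> F \<Longrightarrow> sq_dist f x y \<le> ((1/2)^m)\<^sup>2"
    by metis
  have "(\<Inter>j\<in>{..m::nat}. T j) \<in> U" for m
    by (induction m) (auto simp: atMost_Suc intro: T(1) U_Int)
  then have "\<exists>x. \<forall>j\<le>m. x \<in> T j" for m :: nat
    using U_nonempty by (metis (no_types, lifting) INT_E atMost_iff equals0I)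
  then obtain x where x: "\<And>m j. j \<le> m \<Longrightarrow> x m \<in> T j" by metis
  have TG: "y \<in> G" if "y \<in> T m" for y m using U_sub T(1) that by blast
  have xG: "x m \<in> G" for m using x[of m m] TG by blast
  define u :: "('e \<Rightarrow> 'w \<Rightarrow> real) \<Rightarrow> nat \<Rightarrow> 'w \<Rightarrow> real"
    where "u = (\<lambda>f m \<omega>. f (x (Suc m)) \<omega> - f (x m) \<omega>)"
  define r where "r = (\<lambda>f k \<omega>. \<Sum>i. \<bar>u f (i + k) \<omega>\<bar>)"
  have summ: "AE \<omega> in M. summable (\<lambda>m. \<bar>u f m \<omega>\<bar>)" if f: "f \<in> F" for f
  proof (rule AE_summable_geometric)
    fix m
    have "sq_dist f (x (Suc m)) (x m) \<le> ((1/2)^m)\<^sup>2" using T(2)[OF x x f] by simp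
    note L1_le_of_sq_dist[OF F(2)[OF f] xG xG _ this]
    then show "integrable M (u f m)" "(\<integral>\<omega>. \<bar>u f m \<omega>\<bar> \<partial>M) \<le> (1/2)^m" unfolding u_def by auto
  qed
  have tele: "\<bar>f (x j) \<omega> - f (x k) \<omega>\<bar> \<le> r f k \<omega>" if s: "summable (\<lambda>m. \<bar>u f m \<omega>\<bar>)" and "k \<le> j" for f j k \<omega>
  proof -
    have "\<bar>f (x (k + n)) \<omega> - f (x k) \<omega>\<bar> \<le> (\<Sum>i<n. \<bar>u f (i + k) \<omega>\<bar>)" for n
    proof (induction n)
      case (Suc n)
      have "\<bar>f (x (k + Suc n)) \<omega> - f (x k) \<omega>\<bar> \<le> \<bar>f (x (k + n)) \<omega> - f (x k) \<omega>\<bar> + \<bar>u f (n + k) \<omega>\<bar>"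
        unfolding u_def by (simp add: add.commute)
      then show ?case using Suc by simp
    qed simp
    also have "(\<Sum>i<n. \<bar>u f (i + k) \<omega>\<bar>) \<le> r f k \<omega>" for n
      unfolding r_def by (rule sum_le_suminf) (use s in \<open>auto simp: summable_iff_shift[of "\<lambda>m. \<bar>u f m \<omega>\<bar>"]\<close>)
    finally show ?thesis using le_add_diff_inverse[OF \<open>k \<le> j\<close>] by metis
  qed
  have "\<exists>z\<in>G. \<forall>q\<in>F \<times> (UNIV :: nat set).
      AE \<omega> in M. \<bar>fst q z \<omega> - fst q (x (snd q)) \<omega>\<bar> \<le> r (fst q) (snd q) \<omega>"
  proof (rule strip_compact)
    show "cfunctional (fst q)" if "q \<in> F \<times> UNIV" for q :: "('e \<Rightarrow> 'w \<Rightarrow> real) \<times> nat"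
      using that F(2) unit_functionalD(1) by auto
    fix J :: "(('e \<Rightarrow> 'w \<Rightarrow> real) \<times> nat) set" assume J: "finite J" "J \<subseteq> F \<times> UNIV"
    obtain N where N: "\<And>q. q \<in> J \<Longrightarrow> snd q \<le> N"
      using finite_nat_set_iff_bounded_le[of "snd ` J"] J(1) by auto
    have "AE \<omega> in M. \<bar>fst q (x N) \<omega> - fst q (x (snd q)) \<omega>\<bar> \<le> r (fst q) (snd q) \<omega>" if q: "q \<in> J" for q
    proof -
      have "fst q \<in> F" using J(2) q by auto
      from summ[OF this] show ?thesis by eventually_elim (rule tele[OF _ N[OF q]])
    qed
    then show "\<exists>z\<in>G. \<forall>q\<in>J. AE \<omega> in M. \<bar>fst q z \<omega> - fst q (x (snd q)) \<omega>\<bar> \<le> r (fst q) (snd q) \<omega>"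
      using xG[of N] by (intro bexI[of _ "x N"]) auto
  qed
  then obtain z where z: "z \<in> G" "\<And>f k. f \<in> F \<Longrightarrow> AE \<omega> in M. \<bar>f z \<omega> - f (x k) \<omega>\<bar> \<le> r f k \<omega>"
    by (auto simp: Ball_def)
  have lim: "AE \<omega> in M. (\<lambda>k. f (x k) \<omega>) \<longlonglongrightarrow> f z \<omega>" if f: "f \<in> F" for f
  proof -
    have "AE \<omega> in M. \<forall>k. \<bar>f z \<omega> - f (x k) \<omega>\<bar> \<le> r f k \<omega>"
      using z(2)[OF f] by (simp add: AE_all_countable)
    then show ?thesis using summ[OF f]
    proof eventually_elim
      case (elim \<omega>)
      have le: "\<bar>f (x k) \<omega> - f z \<omega>\<bar> \<le> r f k \<omega>" for k
        using elim(1)[rule_format, of k] by linarith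
      have "(\<lambda>k. r f k \<omega>) \<longlonglongrightarrow> 0"
        unfolding r_def
      proof (rule LIMSEQ_I)
        fix e :: real assume "0 < e"
        then show "\<exists>no. \<forall>n\<ge>no. norm ((\<Sum>i. \<bar>u f (i + n) \<omega>\<bar>) - 0) < e"
          using suminf_exist_split[OF _ elim(2)] by simp
      qed
      then have "(\<lambda>k. f (x k) \<omega> - f z \<omega>) \<longlonglongrightarrow> 0"
        by (rule Lim_null_comparison[rotated]) (use le in simp)
      then show ?case by (simp add: LIM_zero_iff)
    qed
  qed
  \<comment> \<open>For \<open>k \<ge> m\<close> the point \<open>x k\<close> lies in
    \<open>T m\<close> together with \<open>y\<close>, so the estimate passes to the limit in
    \<open>k\<close> and places \<open>T m\<close> in a ball around \<open>z\<close>.\<close>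
  have Dz: "sq_dist f y z \<le> ((1/2)^m)\<^sup>2" if f: "f \<in> F" and y: "y \<in> T m" for f y m
  proof -
    note fm = unit_functionalD(3,4)[OF F(2)[OF f]]
    have yG: "y \<in> G" using TG y .
    have "(\<lambda>k. sq_dist f y (x k)) \<longlonglongrightarrow> sq_dist f y z"
      unfolding sq_dist_def
    proof (rule integral_dominated_convergence[where w = "\<lambda>_. 4"])
      show "AE \<omega> in M. (\<lambda>k. (f y \<omega> - f (x k) \<omega>)\<^sup>2) \<longlonglongrightarrow> (f y \<omega> - f z \<omega>)\<^sup>2"
        using lim[OF f] by eventually_elim (intro tendsto_intros)
      show "AE \<omega> in M. norm ((f y \<omega> - f (x k) \<omega>)\<^sup>2) \<le> 4" for k
        using bounded_sq_integrable(2)[OF fm(1)[OF yG] fm(1)[OF xG] fm(2)[OF yG] fm(2)[OF xG]] by simp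
      show "(\<lambda>\<omega>. (f y \<omega> - f z \<omega>)\<^sup>2) \<in> borel_measurable M"
        using fm(1)[OF yG] fm(1)[OF z(1)] by measurable
      show "(\<lambda>\<omega>. (f y \<omega> - f (x k) \<omega>)\<^sup>2) \<in> borel_measurable M" for k
        using fm(1)[OF yG] fm(1)[OF xG] by measurable
    qed simp
    then show ?thesis
      by (rule LIMSEQ_le_const2) (use T(2)[OF y x f] in auto)
  qed
  have "{y\<in>G. sq_dist f y z \<le> e} \<in> U" if f: "f \<in> F" and e: "0 < e" for f e
  proof (rule U_max)
    show "mconvex add smul {y\<in>G. sq_dist f y z \<le> e}" by (rule mconvex_sq_dist_ball[OF F(2)[OF f] z(1)])
    obtain m where m: "(1/4)^m < e" using real_arch_pow_inv[OF e, of "1/4"] by auto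
    have "((1/2)^m)\<^sup>2 = (1/4 :: real)^m" by (simp add: power_mult[symmetric] mult.commute power2_eq_square power_mult_distrib[symmetric])
    then have sub: "T m \<subseteq> {y\<in>G. sq_dist f y z \<le> e}" using Dz[OF f] m TG by fastforce
    fix A assume "A \<in> U"
    then show "{y\<in>G. sq_dist f y z \<le> e} \<inter> A \<noteq> {}" using U_nonempty[OF U_Int[OF T(1)[of m]]] sub by blast
  qed auto
  then show ?thesis using z(1) by blast
qed

text \<open>Each functional alone has a limit point \<open>\<zeta> f\<close>, whose value under
  \<open>f\<close> is unique. The point found for a finite set of functionals therefore takes the
  prescribed values for all of them, and strips of width 0 pass from finite sets to all unit
  functionals by compactness.\<close>

lemma universal_limit:
  "\<exists>z\<in>G. \<forall>f. unit_functional f \<longrightarrow> (\<forall>e>0. {x\<in>G. sq_dist f x z \<le> e} \<in> U)"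
proof -
  have "\<exists>z. z \<in> G \<and> (\<forall>e>0. {x\<in>G. sq_dist f x z \<le> e} \<in> U)" if "unit_functional f" for f
    using common_limit[of "{f}"] that by auto
  then obtain \<zeta> where \<zeta>: "\<And>f. unit_functional f \<Longrightarrow> \<zeta> f \<in> G"
    "\<And>f e. unit_functional f \<Longrightarrow> 0 < e \<Longrightarrow> {x\<in>G. sq_dist f x (\<zeta> f) \<le> e} \<in> U"
    by metis
  have uniq: "AE \<omega> in M. f z \<omega> = f (\<zeta> f) \<omega>"
    if f: "unit_functional f" and z: "z \<in> G" "\<And>e. 0 < e \<Longrightarrow> {x\<in>G. sq_dist f x z \<le> e} \<in> U" for f z
  proof (rule sq_dist_zero[OF f z(1) \<zeta>(1)[OF f]], rule field_le_epsilon)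
    fix e :: real assume e: "0 < e"
    \<comment> \<open>Both balls are members and hence meet; \<open>e / 4\<close> absorbs the
      factors 2 of the triangle inequality.\<close>
    have "{x\<in>G. sq_dist f x z \<le> e / 4} \<inter> {x\<in>G. sq_dist f x (\<zeta> f) \<le> e / 4} \<in> U"
      using e by (intro U_Int z(2) \<zeta>(2)[OF f]) auto
    then obtain x where "x \<in> G" "sq_dist f x z \<le> e / 4" "sq_dist f x (\<zeta> f) \<le> e / 4"
      using U_nonempty by blast
    then show "sq_dist f z (\<zeta> f) \<le> 0 + e"
      using sq_dist_triangle[OF f _ z(1) \<zeta>(1)[OF f], of x] by simp
  qed
  have "\<exists>z\<in>G. \<forall>f\<in>Collect unit_functional. AE \<omega> in M. \<bar>f z \<omega> - f (\<zeta> f) \<omega>\<bar> \<le> 0"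
  proof (rule strip_compact)
    show "cfunctional f" if "f \<in> Collect unit_functional" for f using that unit_functionalD(1) by blast
    fix J assume J: "finite J" "J \<subseteq> Collect unit_functional"
    obtain z where z: "z \<in> G" "\<And>f e. f \<in> J \<Longrightarrow> 0 < e \<Longrightarrow> {x\<in>G. sq_dist f x z \<le> e} \<in> U"
      using common_limit[of J] J by blast
    have "AE \<omega> in M. \<bar>f z \<omega> - f (\<zeta> f) \<omega>\<bar> \<le> 0" if "f \<in> J" for f
      using uniq[of f z] z J(2) that by auto
    then show "\<exists>z\<in>G. \<forall>f\<in>J. AE \<omega> in M. \<bar>f z \<omega> - f (\<zeta> f) \<omega>\<bar> \<le> 0" using z(1) by blast
  qed
  then obtain z where z: "z \<in> G" "\<And>f. unit_functional f \<Longrightarrow> AE \<omega> in M. f z \<omega> = f (\<zeta> f) \<omega>"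
    by auto
  have "{x\<in>G. sq_dist f x z \<le> e} \<in> U" if f: "unit_functional f" and e: "0 < e" for f e
  proof -
    note eq = z(2)[OF f]
    note fm = unit_functionalD(3)[OF f]
    have "sq_dist f x z = sq_dist f x (\<zeta> f)" if "x \<in> G" for x
      unfolding sq_dist_def
    proof (rule integral_cong_AE)
      show "AE \<omega> in M. (f x \<omega> - f z \<omega>)\<^sup>2 = (f x \<omega> - f (\<zeta> f) \<omega>)\<^sup>2" using eq by eventually_elim simp
    qed (use fm[OF that] fm[OF z(1)] fm[OF \<zeta>(1)[OF f]] in measurable)
    then have "{x\<in>G. sq_dist f x z \<le> e} = {x\<in>G. sq_dist f x (\<zeta> f) \<le> e}" by auto
    then show ?thesis using \<zeta>(2)[OF f e] by simp
  qed
  then show ?thesis using z(1) by blast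
qed

end

section \<open>Separation of a point from a closed convex set, and the conclusion\<close>

context L0_convexly_compact_set
begin

text \<open>A neighbourhood of \<open>z\<close> that misses \<open>A\<close> depends on one finite
  \<open>Q\<close> only. It keeps the weighted expectation of the seminorm on the translate
  \<open>A - z\<close> above a fixed \<open>d > 0\<close>, so Hahn-Banach separates this translate
  from the origin with the same gap.\<close>

lemma separating_functional:
  assumes A: "A \<subseteq> G" "mconvex add smul A" "closedin T A" "A \<noteq> {}" and z: "z \<in> G" "z \<notin> A"
  obtains f d where "unit_functional f" "0 < d" "\<And>a. a \<in> A \<Longrightarrow> d \<le> (\<integral>\<omega>. f a \<omega> - f z \<omega> \<partial>M)"
proof -
  have "z \<in> topspace T" using z(1) G_closed closedin_subset by blast
  moreover have "openin T (topspace T - A)" using A(3) by (simp add: closedin_def)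
  ultimately obtain Q e l where Q: "el_basic PP Q e l" "el_nbhd M E add smul z Q e l \<subseteq> topspace T - A"
    using z(2) unfolding openin_T by blast
  have Q': "Q \<subseteq> PP" "finite Q" "Q \<noteq> {}" and el: "0 < e" "0 < l" using Q(1) unfolding el_basic_def by auto
  let ?p = "normQ Q"
  have p: "seminorm ?p" using basic_seminorm[OF Q(1)] .
  obtain w where wm[measurable]: "w \<in> borel_measurable M" and w0: "\<And>\<omega>. 0 \<le> w \<omega>" and wpos: "AE \<omega> in M. 0 < w \<omega>"
    and wle: "\<And>x. x \<in> G \<Longrightarrow> AE \<omega> in M. w \<omega> * ?p x \<omega> \<le> 1"
    using weight_exists[OF Q'] by blast
  define p' where "p' = (\<lambda>x \<omega>. \<bar>w \<omega>\<bar> * ?p x \<omega>)"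
  have p': "seminorm p'" unfolding p'_def by (rule seminorm_weighted[OF p wm])
  have p'1: "AE \<omega> in M. \<bar>p' x \<omega>\<bar> \<le> 1" if x: "x \<in> G" for x
    using wle[OF x] seminorm_nonneg[OF p' G_E[OF x]]
    by eventually_elim (use w0 in \<open>simp add: p'_def\<close>)
  interpret V: carrier_vector_space "integrable_part p'" add "\<lambda>s. rs (\<lambda>_. s)" th
    by (rule integrable_part_space[OF p'])
  have GV: "x \<in> integrable_part p'" if x: "x \<in> G" for x
  proof -
    have "integrable M (p' x)"
      by (rule integrable_const_bound[where B = 1]) (use p'1[OF x] seminorm_meas[OF p' G_E[OF x]] in auto)
    then show ?thesis using G_E[OF x] unfolding integrable_part_def by simp
  qed
  let ?nz = "rs (\<lambda>_. - 1) z"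
  have nzV: "?nz \<in> integrable_part p'" using V.sc_V[OF GV[OF z(1)], of "- 1"] .
  define C where "C = (\<lambda>a. add a ?nz) ` A"
  have AV: "a \<in> integrable_part p'" if "a \<in> A" for a using GV A(1) that by blast
  have conv: "add (rs (\<lambda>_. t) x) (rs (\<lambda>_. 1 - t) y) \<in> C" if x: "x \<in> C" and y: "y \<in> C" and t: "0 \<le> t" "t \<le> 1" for x y t
  proof -
    obtain a b where ab: "a \<in> A" "b \<in> A" "x = add a ?nz" "y = add b ?nz" using x y unfolding C_def by auto
    note V' = AV[OF ab(1)] AV[OF ab(2)] nzV
    have "add (rs (\<lambda>_. t) x) (rs (\<lambda>_. 1 - t) y)
      = add (add (rs (\<lambda>_. t) a) (rs (\<lambda>_. t) ?nz)) (add (rs (\<lambda>_. 1 - t) b) (rs (\<lambda>_. 1 - t) ?nz))"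
      unfolding ab(3,4) using V.sc_right[OF V'(1,3)] V.sc_right[OF V'(2,3)] by metis
    also have "\<dots> = add (mcomb t a b) (add (rs (\<lambda>_. t) ?nz) (rs (\<lambda>_. 1 - t) ?nz))"
      by (rule V.V_exchange[OF V.sc_V[OF V'(1)] V.sc_V[OF V'(3)] V.sc_V[OF V'(2)] V.sc_V[OF V'(3)]])
    also have "add (rs (\<lambda>_. t) ?nz) (rs (\<lambda>_. 1 - t) ?nz) = ?nz"
      using V.sc_left[OF V'(3), of t "1 - t"] V.sc_one[OF V'(3)] by simp
    finally show ?thesis unfolding C_def using mconvexD[OF A(2) ab(1,2) t] by blast
  qed
  have CV: "C \<subseteq> integrable_part p'" unfolding C_def using AV nzV V.add_V by blast
  obtain c where c: "prob {\<omega>\<in>space M. c < 1 / w \<omega>} < l / 2"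
    using tight_random_variable[of "\<lambda>\<omega>. 1 / w \<omega>" "l / 2"] el by auto
  define c' where "c' = max c 1"
  \<comment> \<open>Outside the neighbourhood the seminorm is at least \<open>e\<close> with
    probability at least \<open>l\<close>. Discarding the set where \<open>1 / w\<close> exceeds
    \<open>c\<close>, of probability below \<open>l / 2\<close>, leaves probability at least
    \<open>l / 2\<close> on which the weighted seminorm is at least \<open>e / c'\<close>. The
    maximum with 1 only ensures that \<open>c'\<close> is positive.\<close>
  define d where "d = e / c' * (l / 2)"
  have d: "0 < d" unfolding d_def c'_def using el by simp
  have dC: "d \<le> (\<integral>\<omega>. p' x \<omega> \<partial>M)" if x: "x \<in> C" for x
  proof -
    obtain a where a: "a \<in> A" "x = mdiff add smul a z" using x unfolding C_def mdiff_eq by auto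
    have aE: "a \<in> E" using a A(1) G_E by blast
    have xE: "x \<in> E" and px: "integrable M (p' x)" using x CV unfolding integrable_part_def by auto
    have [measurable]: "?p x \<in> borel_measurable M" using seminorm_meas[OF p xE] .
    have "a \<notin> el_nbhd M E add smul z Q e l" using Q(2) a(1) by blast
    then have small: "prob {\<omega>\<in>space M. ?p x \<omega> < e} \<le> 1 - l" using aE a(2) unfolding el_nbhd_def by simp
    let ?B = "{\<omega>\<in>space M. e \<le> ?p x \<omega> \<and> 1 / w \<omega> \<le> c'}"
    have [measurable]: "?B \<in> sets M" by measurable
    have "prob (space M) \<le> prob (?B \<union> {\<omega>\<in>space M. ?p x \<omega> < e} \<union> {\<omega>\<in>space M. c < 1 / w \<omega>})"
      by (rule finite_measure_mono) (auto simp: c'_def not_less not_le, measurable)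
    also have "\<dots> \<le> prob (?B \<union> {\<omega>\<in>space M. ?p x \<omega> < e}) + prob {\<omega>\<in>space M. c < 1 / w \<omega>}"
      by (rule measure_Un_le) measurable
    also have "prob (?B \<union> {\<omega>\<in>space M. ?p x \<omega> < e}) \<le> prob ?B + prob {\<omega>\<in>space M. ?p x \<omega> < e}"
      by (rule measure_Un_le) measurable
    finally have pB: "l / 2 \<le> prob ?B" using small c by (simp add: prob_space)
    have "d \<le> e / c' * prob ?B" unfolding d_def using pB el by (intro mult_left_mono) (auto simp: c'_def)
    also have "\<dots> = (\<integral>\<omega>. e / c' * indicator ?B \<omega> \<partial>M)" by simp
    also have "\<dots> \<le> (\<integral>\<omega>. p' x \<omega> \<partial>M)"
    proof (rule integral_mono_AE[OF _ px])
      show "AE \<omega> in M. e / c' * indicator ?B \<omega> \<le> p' x \<omega>"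
        using wpos seminorm_nonneg[OF p' xE]
      proof eventually_elim
        case (elim \<omega>)
        show ?case
        proof (cases "\<omega> \<in> ?B")
          case True
          \<comment> \<open>\<open>?B\<close> may contain zeros of \<open>w\<close>, where
            \<open>1 / w\<close> is 0 by convention; almost sure positivity of \<open>w\<close>
            removes them.\<close>
          then have "1 / c' \<le> w \<omega>" using elim by (simp add: c'_def field_simps)
          then have "1 / c' * e \<le> w \<omega> * ?p x \<omega>" using True el w0[of \<omega>] by (intro mult_mono) auto
          then show ?thesis using True elim unfolding p'_def by simp
        qed (use elim in simp)
      qed
      show "integrable M (\<lambda>\<omega>. e / c' * indicator ?B \<omega>)"
        by (intro integrable_mult_right integrable_real_indicator) (auto simp: less_top[symmetric])
    qed
    finally show ?thesis .
  qed
  obtain lf where lf: "V.linear_on lf" "\<And>x. x \<in> integrable_part p' \<Longrightarrow> lf x \<le> (\<integral>\<omega>. p' x \<omega> \<partial>M)"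
    "\<And>x. x \<in> C \<Longrightarrow> d \<le> lf x"
    using V.hahn_banach_separation[OF seminorm_expectation_sublinear[OF p'] CV _ conv dC] A(4) unfolding C_def by blast
  obtain f where f: "functional f" "\<And>x. x \<in> E \<Longrightarrow> AE \<omega> in M. \<bar>f x \<omega>\<bar> \<le> p' x \<omega>"
    "\<And>x. x \<in> integrable_part p' \<Longrightarrow> (\<integral>\<omega>. f x \<omega> \<partial>M) = lf x"
    using functional_of_linear[OF p' lf(1,2)] by blast
  have "cfunctional f"
    unfolding cfunctional_def using f(1,2) Q' unfolding p'_def
    by (intro conjI exI[of _ Q] exI[of _ "\<lambda>\<omega>. \<bar>w \<omega>\<bar>"]) auto
  moreover have "AE \<omega> in M. \<bar>f x \<omega>\<bar> \<le> 1" if "x \<in> G" for x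
    using f(2)[OF G_E[OF that]] p'1[OF that] by eventually_elim linarith
  ultimately have "unit_functional f" unfolding unit_functional_def by blast
  moreover have "d \<le> (\<integral>\<omega>. f a \<omega> - f z \<omega> \<partial>M)" if a: "a \<in> A" for a
  proof -
    have aE: "a \<in> E" and zE: "z \<in> E" using a A(1) z G_E by auto
    have aC: "add a ?nz \<in> C" using a unfolding C_def by blast
    have "d \<le> lf (add a ?nz)" by (rule lf(3)[OF aC])
    also have "\<dots> = (\<integral>\<omega>. f (add a ?nz) \<omega> \<partial>M)" using f(3) aC CV by auto
    also have "\<dots> = (\<integral>\<omega>. f a \<omega> - f z \<omega> \<partial>M)"
    proof (rule integral_cong_AE)
      show "AE \<omega> in M. f (add a ?nz) \<omega> = f a \<omega> - f z \<omega>"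
        using functional_mdiff[OF f(1) aE zE] unfolding mdiff_eq .
    qed (use functional_meas[OF f(1)] aE zE aC CV in \<open>auto simp: integrable_part_def\<close>)
    finally show ?thesis .
  qed
  ultimately show ?thesis using that d by blast
qed

lemma convexly_compact_G: "convexly_compact M E add smul PP G"
  unfolding convexly_compact_def
proof (intro conjI allI impI)
  show "mconvex add smul G" by (rule mconvex_G)
  fix F assume F: "(\<forall>A\<in>F. A \<subseteq> G \<and> mconvex add smul A \<and> closedin T A) \<and> fip F"
  show "\<Inter>F \<noteq> {}"
  proof (cases "F = {}")
    case False
    let ?P = "\<lambda>A. A \<subseteq> G \<and> mconvex add smul A"
    have PInt: "?P (A \<inter> B)" if "?P A" "?P B" for A B
      using that unfolding mconvex_def by blast
    show ?thesis
    proof (rule maximal_fip_family[of ?P F])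
      show "?P (A \<inter> B)" if "?P A" "?P B" for A B using PInt[OF that] .
      show "?P A" if "A \<in> F" for A using F that by blast
      show "fip F" using F by blast
      show "F \<noteq> {}" by fact
      fix U
      assume U: "F \<subseteq> U" "\<And>A. A \<in> U \<Longrightarrow> ?P A" "\<And>A. A \<in> U \<Longrightarrow> A \<noteq> {}"
        "\<And>A B. A \<in> U \<Longrightarrow> B \<in> U \<Longrightarrow> A \<inter> B \<in> U"
        "\<And>C. ?P C \<Longrightarrow> (\<And>A. A \<in> U \<Longrightarrow> C \<inter> A \<noteq> {}) \<Longrightarrow> C \<in> U"
      interpret maximal_convex_family M E add smul th PP G U
      proof unfold_locales
        show "U \<noteq> {}" using U(1) False by blast
        show "A \<subseteq> G" "mconvex add smul A" "A \<noteq> {}" if "A \<in> U" for A using U(2,3)[OF that] by blast+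
        show "A \<inter> B \<in> U" if "A \<in> U" "B \<in> U" for A B using U(4)[OF that] .
        show "C \<in> U" if "C \<subseteq> G" "mconvex add smul C" "\<And>A. A \<in> U \<Longrightarrow> C \<inter> A \<noteq> {}" for C
          by (rule U(5)[OF conjI[OF that(1,2)] that(3)])
      qed
      obtain z where z: "z \<in> G" "\<And>f e. unit_functional f \<Longrightarrow> 0 < e \<Longrightarrow> {x\<in>G. sq_dist f x z \<le> e} \<in> U"
        using universal_limit by blast
      have "z \<in> A" if A: "A \<in> F" for A
      proof (rule ccontr)
        assume zA: "z \<notin> A"
        have AU: "A \<in> U" using A U(1) by blast
        obtain f d where f: "unit_functional f" "0 < d" "\<And>a. a \<in> A \<Longrightarrow> d \<le> (\<integral>\<omega>. f a \<omega> - f z \<omega> \<partial>M)"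
          using separating_functional[of A z] F A z(1) zA U(3)[OF AU] by blast
        \<comment> \<open>The radius is half the gap: a point \<open>a\<close> of \<open>A\<close>
          in this ball has \<open>E \<bar>f a - f z\<bar>\<close> at most \<open>d / 2\<close>,
          against the lower bound \<open>d\<close> from separation.\<close>
        have "{x\<in>G. sq_dist f x z \<le> (d / 2)\<^sup>2} \<inter> A \<in> U" using z(2)[OF f(1)] f(2) AU U(4) by simp
        then obtain a where a: "a \<in> G" "a \<in> A" "sq_dist f a z \<le> (d / 2)\<^sup>2" using U(3) by blast
        have "d \<le> (\<integral>\<omega>. f a \<omega> - f z \<omega> \<partial>M)" using f(3) a(2) .
        also have "\<dots> \<le> (\<integral>\<omega>. \<bar>f a \<omega> - f z \<omega>\<bar> \<partial>M)"
          using integral_abs_bound[of M "\<lambda>\<omega>. f a \<omega> - f z \<omega>"] by linarith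
        also have "\<dots> \<le> d / 2" using L1_le_of_sq_dist(2)[OF f(1) a(1) z(1) _ a(3)] f(2) by simp
        finally show False using f(2) by simp
      qed
      then show ?thesis by blast
    qed
  qed simp
qed

end

theorem theorem5p3:
  fixes M :: "'w measure" and E :: "'e set" and add :: "'e \<Rightarrow> 'e \<Rightarrow> 'e"
    and smul :: "('w \<Rightarrow> 'k::{real_normed_field,banach}) \<Rightarrow> 'e \<Rightarrow> 'e"
    and th :: 'e and PP :: "('e \<Rightarrow> 'w \<Rightarrow> real) set" and G :: "'e set"
  assumes "prob_space M"
    and "RLC_module M E add smul th PP"
    and "el_complete M E add smul th PP"
    and "closedin (el_topology M E add smul PP) G"
    and "L0_convex M add smul G"
    and "L0_convexly_compact M E add smul PP G"
  shows "convexly_compact M E add smul PP G"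
proof -
  interpret prob_space M by fact
  interpret L0_convexly_compact_set M E add smul th PP G
    by unfold_locales (use assms in \<open>auto simp: RLC_module_def\<close>)
  show ?thesis by (rule convexly_compact_G)
qed

end
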